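(* Let $\{\mu_t,\ t\in[0,\infty)\}$ be any measurable family of probability measures on the real line. Then there exists a unique chordal Loewner family $\{f(t;\cdot),\ t\in[0,\infty)\}$ such that \[ \frac{\partial}{\partial t}f(t;z)=-\int_{\mathbb R}\frac{\mu_t(dx)}{z-x}\cdot\frac{\partial}{\partial z}f(t;z) \] for all $z\in\mathbb H$ and all $t\in[0,\infty)$ outside some set of Lebesgue measure zero (not depending on $z$).
   Context: $\mathbb H=\{z\in\mathbb C:\Im(z)>0\}$. $\mathfrak R$ denotes the class of univalent (analytic and injective) functions $f:\mathbb H\to\mathbb H$ for which there is a constant $C\in[0,\infty)$ with $|f(z)-z|\le C/\Im(z)$ for all $z\in\mathbb H$. For $f\in\mathfrak R$ the limit $\lim_{y\to\infty}iy[iy-f(iy)]$ exists and equals the least such constant $C$. For $f,g\in\mathfrak R$, write $f\prec g$ if $f=g\circ h$ for some $h\in\mathfrak R$; this is a partial order. A chordal Loewner family is a maximal (with respect to inclusion) nonempty totally ordered subset of $\mathfrak R$, written in parametrized form $\{f(t;\cdot),\ t\in[0,\infty)\}$, where $f(t;\cdot)$ is the unique element $f$ of the family with $\lim_{y\to\infty}iy[iy-f(iy)]=t$ (every $t\in[0,\infty)$ occurs exactly once). A family $\{\mu_t\}$ of probability measures on $\mathbb R$ is measurable if $t\mapsto\mu_t$ is measurable as a map from $[0,\infty)$ into the space of probability measures on $\mathbb R$ with the Borel $\sigma$-field of the topology of weak convergence. Two measurable families that agree for all $t$ outside a set of Lebesgue measure zero are identified. *)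

theory Defs
  imports "HOL-Complex_Analysis.Complex_Analysis" "HOL-Probability.Probability"
begin

definition upper_half_plane :: "complex set" where
  "upper_half_plane = {z. Im z > 0}"

text \<open>
  The class of self-maps. Functions on the upper half-plane are represented by total functions that
  are \<^const>\<open>undefined\<close> off it, so that HOL equality is equality of functions on the half-plane and
  composition is \<^const>\<open>compose\<close>.
\<close>
definition hydro_maps :: "(complex \<Rightarrow> complex) set" where
  "hydro_maps = {f \<in> extensional upper_half_plane.
     f holomorphic_on upper_half_plane \<and> inj_on f upper_half_plane \<and>
     f ` upper_half_plane \<subseteq> upper_half_plane \<and>
     (\<exists>C\<ge>0. \<forall>z\<in>upper_half_plane. cmod (f z - z) \<le> C / Im z)}"

definition subord :: "(complex \<Rightarrow> complex) \<Rightarrow> (complex \<Rightarrow> complex) \<Rightarrow> bool" where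
  "subord f g \<longleftrightarrow> (\<exists>h\<in>hydro_maps. f = compose upper_half_plane g h)"

text \<open>
  \<^const>\<open>pred_on.maxchain\<close> compares elements by the reflexive closure of the given relation; this is
  harmless since \<^const>\<open>subord\<close> is already reflexive on \<^const>\<open>hydro_maps\<close>.
\<close>
definition chordal_Loewner_family :: "(complex \<Rightarrow> complex) set \<Rightarrow> bool" where
  "chordal_Loewner_family F \<longleftrightarrow> F \<noteq> {} \<and> pred_on.maxchain hydro_maps subord F"

definition has_hcap :: "(complex \<Rightarrow> complex) \<Rightarrow> real \<Rightarrow> bool" where
  "has_hcap f t \<longleftrightarrow>
     ((\<lambda>y::real. \<i> * of_real y * (\<i> * of_real y - f (\<i> * of_real y))) \<longlongrightarrow> of_real t) at_top"

definition family_at :: "(complex \<Rightarrow> complex) set \<Rightarrow> real \<Rightarrow> complex \<Rightarrow> complex" where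
  "family_at F t = (THE f. f \<in> F \<and> has_hcap f t)"

text \<open>
  The topology of weak convergence on the Borel probability measures on the line: the coarsest one
  for which integration against every bounded continuous function is continuous.
\<close>
definition weak_topology :: "real measure topology" where
  "weak_topology = topology_generated_by
     {{M \<in> space (prob_algebra borel). (LINT x|M. \<phi> x) \<in> U} | \<phi> U.
        continuous_on UNIV (\<phi> :: real \<Rightarrow> real) \<and> bounded (range \<phi>) \<and> open (U :: real set)}"

lemma topspace_weak_topology: "topspace weak_topology = space (prob_algebra borel)"
proof
  show "topspace weak_topology \<subseteq> space (prob_algebra borel)"
    by (auto simp: weak_topology_def)
  have "space (prob_algebra borel) = {M \<in> space (prob_algebra borel). (LINT x|M. 0) \<in> (UNIV :: real set)}"
    by simp
  moreover have "continuous_on UNIV (\<lambda>_::real. 0::real)" "bounded (range (\<lambda>_::real. 0::real))"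
    by auto
  ultimately show "space (prob_algebra borel) \<subseteq> topspace weak_topology"
    unfolding weak_topology_def topology_generated_by_topspace by (intro Union_upper) blast
qed

definition weak_borel :: "real measure measure" where
  "weak_borel = sigma (topspace weak_topology) {V. openin weak_topology V}"

end

theory Submission imports Defs begin

text \<open>
  Write \<open>G\<^sub>t(z) = \<integral> \<mu>\<^sub>t(dx) / (z - x)\<close>. Since \<open>Im G\<^sub>t \<le> 0\<close>, the equation \<open>w'(s) = G\<^sub>s(w(s))\<close> with
  \<open>w(t) = z\<close> can be solved backwards down to \<open>s = 0\<close> without leaving the half-plane, and
  \<open>f(t; z) = w(0)\<close> is the required family: \<open>f(t; \<cdot>) = f(s; \<cdot>) \<circ> h\<close> with \<open>h(z) = w(s)\<close>, and Lebesgue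
  differentiation of \<open>\<integral> G\<^sub>r(z) dr\<close> at a countable dense set of points \<open>z\<close> gives the differential
  equation outside one null set. Conversely, for a family \<open>f\<close> satisfying the equation,
  \<open>s \<mapsto> f(s; w(s))\<close> is Lipschitz with derivative zero almost everywhere, hence constant, so that
  \<open>f(t; z) = w(0)\<close>.

  This needs that a maximal chain has no gaps, i.e. that every \<open>h \<noteq> id\<close> in the class is a product
  of two nontrivial elements. Boundary bumping produces a simply connected domain \<open>D\<close> strictly
  between the image of \<open>h\<close> and the half-plane. Among all \<open>k = q \<circ> h\<close> in the class with \<open>q\<close> univalent
  from \<open>D\<close> into the half-plane, one of minimal capacity has \<open>q\<close> onto (otherwise a square root as in
  the proof of the Riemann mapping theorem would lower the capacity), and \<open>h = q\<inverse> \<circ> k\<close>. Existence of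
  the capacity and all estimates near infinity come from Julia's lemma.
\<close>

section \<open>Julia's lemma on the upper half-plane\<close>

text \<open>Julia's lemma turns a bound \<open>cmod (f w - w) * y \<le> C\<close> along one sequence
  of points \<open>w\<close> near \<open>\<i> * y\<close> into the same bound on the whole
  half-plane. Membership in the class and the size of the capacity can therefore be checked at
  chosen points such as \<open>k (\<i> * y)\<close>; this makes left factors of a composition
  accessible and the capacity additive. The Riemann mapping theorem alone would not produce the
  factor \<open>k\<close>: a Riemann map of \<open>D\<close> comes with no control at infinity. The
  extremal problem only compares maps whose composite with \<open>h\<close> is already normalized,
  and the inclusion of \<open>D\<close> is one of them. The field is merely measurable in time and a
  family is differentiable only at almost all times, so the chain rule is replaced throughout by
  explicit increments with error \<open>e\<close> times the length of the time interval. In the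
  uniqueness half the equation is used at the moving point \<open>w x\<close>, which is why the
  exceptional set must be common to all \<open>z\<close>.\<close>

abbreviation (input) UHP :: "complex set" where "UHP \<equiv> upper_half_plane"

lemma open_UHP: "open upper_half_plane"
  by (simp add: upper_half_plane_def open_halfspace_Im_gt)

lemma convex_UHP: "convex upper_half_plane"
  by (simp add: upper_half_plane_def convex_halfspace_Im_gt)

lemma connected_UHP: "connected upper_half_plane"
  by (simp add: convex_UHP convex_connected)

lemma UHP_iff: "z \<in> upper_half_plane \<longleftrightarrow> Im z > 0"
  by (simp add: upper_half_plane_def)

text \<open>Ties the pseudo-hyperbolic denominator \<open>z - cnj w\<close> to its numerator, so
  that hyperbolic estimates can be written without quotients.\<close>

lemma cmod_diff_cnj_sq: "(cmod (z - cnj w))\<^sup>2 = (cmod (z - w))\<^sup>2 + 4 * Im z * Im w"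
  unfolding cmod_power2 by (simp add: power2_eq_square algebra_simps)

text \<open>The Schwarz lemma for \<open>f\<close> in disc coordinates centred at \<open>w\<close>
  and \<open>f w\<close>. The form without quotients survives division by powers of \<open>y\<close>
  and passage to limits at infinity.\<close>

lemma Schwarz_Pick_UHP:
  assumes hol: "f holomorphic_on UHP" and im: "f ` UHP \<subseteq> UHP" and z: "z \<in> UHP" and w: "w \<in> UHP"
  shows "(cmod (f z - f w))\<^sup>2 * Im z * Im w \<le> (cmod (z - w))\<^sup>2 * Im (f z) * Im (f w)"
proof -
  \<comment> \<open>\<open>T\<close> inverts \<open>z \<mapsto> (z - w) / (z - cnj w)\<close>: it
    carries the unit disc into the half-plane and \<open>0\<close> to \<open>w\<close>.\<close>
  define T where "T = (\<lambda>\<zeta>. (w - cnj w * \<zeta>) / (1 - \<zeta>))"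
  define g where "g = (\<lambda>\<zeta>. (f (T \<zeta>) - f w) / (f (T \<zeta>) - cnj (f w)))"
  have Imw: "Im w > 0" "Im (f w) > 0" "Im z > 0" "Im (f z) > 0"
    using w z im by (auto simp: UHP_iff image_subset_iff)
  have T_UHP: "T \<zeta> \<in> UHP" if "cmod \<zeta> < 1" for \<zeta>
  proof -
    have ne: "1 - \<zeta> \<noteq> 0" using that by auto
    have "Im (T \<zeta>) = Im ((w - cnj w * \<zeta>) * cnj (1 - \<zeta>)) / (cmod (1 - \<zeta>))\<^sup>2"
      by (simp add: T_def complex_div_cnj [of _ "1 - \<zeta>"] Im_divide_of_real flip: of_real_power)
    also have "Im ((w - cnj w * \<zeta>) * cnj (1 - \<zeta>)) = Im w * (1 - (cmod \<zeta>)\<^sup>2)"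
      unfolding cmod_power2 by (simp add: algebra_simps power2_eq_square)
    finally have "Im (T \<zeta>) = Im w * (1 - (cmod \<zeta>)\<^sup>2) / (cmod (1 - \<zeta>))\<^sup>2" .
    moreover have "(cmod \<zeta>)\<^sup>2 < 1" using that by (simp add: power_less_one_iff)
    ultimately show ?thesis using Imw ne by (simp add: UHP_iff)
  qed
  have ne: "f (T \<zeta>) - cnj (f w) \<noteq> 0" if "cmod \<zeta> < 1" for \<zeta>
  proof -
    have "f (T \<zeta>) \<in> UHP" using T_UHP[OF that] im by blast
    then have "Im (f (T \<zeta>) - cnj (f w)) > 0" using Imw by (simp add: UHP_iff)
    then show ?thesis by auto
  qed
  have "T holomorphic_on ball 0 1"
    unfolding T_def by (intro holomorphic_intros) auto
  moreover have "T ` ball 0 1 \<subseteq> UHP" using T_UHP by auto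
  ultimately have "(f \<circ> T) holomorphic_on ball 0 1"
    using hol holomorphic_on_compose_gen by blast
  then have gh: "g holomorphic_on ball 0 1"
    unfolding g_def comp_def by (intro holomorphic_intros) (use ne in auto)
  have T0: "T 0 = w" by (simp add: T_def)
  have g0: "g 0 = 0" by (simp add: g_def T0)
  have less: "cmod ((a - b) / (a - cnj b)) < 1" if "Im a > 0" "Im b > 0" for a b
  proof -
    have "(cmod (a - b))\<^sup>2 < (cmod (a - cnj b))\<^sup>2"
      using that by (simp add: cmod_diff_cnj_sq)
    then have "cmod (a - b) < cmod (a - cnj b)"
      using power_less_imp_less_base by fastforce
    then show ?thesis
      by (simp add: norm_divide divide_less_eq_1 le_less_trans[OF norm_ge_zero])
  qed
  have g1: "cmod (g \<zeta>) < 1" if "cmod \<zeta> < 1" for \<zeta>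
    using T_UHP[OF that] im Imw unfolding g_def by (intro less) (auto simp: UHP_iff image_subset_iff)
  define \<zeta> where "\<zeta> = (z - w) / (z - cnj w)"
  have \<zeta>1: "cmod \<zeta> < 1" unfolding \<zeta>_def using Imw by (intro less)
  have zw: "z - cnj w \<noteq> 0"
  proof -
    have "Im (z - cnj w) > 0" using Imw by simp
    then show ?thesis by auto
  qed
  have ww: "w - cnj w \<noteq> 0"
    using Imw by (auto simp: complex_eq_iff)
  have "T \<zeta> = z"
  proof -
    have e1: "w - cnj w * \<zeta> = z * (w - cnj w) / (z - cnj w)"
      using zw by (simp add: \<zeta>_def field_simps)
    have e2: "1 - \<zeta> = (w - cnj w) / (z - cnj w)"
      using zw by (simp add: \<zeta>_def field_simps)
    show ?thesis unfolding T_def e1 e2 using zw ww by simp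
  qed
  then have "cmod ((f z - f w) / (f z - cnj (f w))) \<le> cmod ((z - w) / (z - cnj w))"
    using Schwarz_Lemma(1)[OF gh g0 g1 \<zeta>1] by (simp add: g_def \<zeta>_def)
  then have "(cmod ((f z - f w) / (f z - cnj (f w))))\<^sup>2 \<le> (cmod ((z - w) / (z - cnj w)))\<^sup>2"
    by (simp add: power_mono)
  then have "(cmod (f z - f w))\<^sup>2 / ((cmod (f z - f w))\<^sup>2 + 4 * Im (f z) * Im (f w))
      \<le> (cmod (z - w))\<^sup>2 / ((cmod (z - w))\<^sup>2 + 4 * Im z * Im w)"
    by (simp add: norm_divide power_divide cmod_diff_cnj_sq)
  moreover have "(cmod (f z - f w))\<^sup>2 + 4 * Im (f z) * Im (f w) > 0" "(cmod (z - w))\<^sup>2 + 4 * Im z * Im w > 0"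
    using Imw by (auto intro!: add_nonneg_pos)
  \<comment> \<open>After cross-multiplication both sides contain the product of the two squared
    distances, which cancels.\<close>
  ultimately have "(cmod (f z - f w))\<^sup>2 * ((cmod (z - w))\<^sup>2 + 4 * Im z * Im w)
      \<le> (cmod (z - w))\<^sup>2 * ((cmod (f z - f w))\<^sup>2 + 4 * Im (f z) * Im (f w))"
    by (simp add: pos_divide_le_eq pos_le_divide_eq)
  then show ?thesis
    by (simp add: algebra_simps)
qed

text \<open>Schwarz-Pick against the boundary point at infinity, approached along
  \<open>w n\<close>. The first inequality is its limit after division by \<open>y n ^ 3\<close>;
  the second repeats the argument for \<open>- 1 / (f z - z)\<close>, whose modulus at
  \<open>w n\<close> is at least \<open>y n / C\<close>. Points at bounded distance from
  \<open>\<i> * y n\<close> are allowed because compositions are evaluated at points like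
  \<open>h (\<i> * y n)\<close>.\<close>

lemma Julia_UHP:
  fixes w :: "nat \<Rightarrow> complex" and y :: "nat \<Rightarrow> real"
  assumes hol: "f holomorphic_on UHP" and im: "f ` UHP \<subseteq> UHP"
    and y: "filterlim y at_top sequentially" and w: "\<And>n. w n \<in> UHP"
    and wy: "\<And>n. cmod (w n - \<i> * y n) \<le> B"
    and fw: "\<And>n. cmod (f (w n) - w n) * y n \<le> C" and z: "z \<in> UHP"
  shows "Im z \<le> Im (f z)" and "(cmod (f z - z))\<^sup>2 * Im z \<le> C * (Im (f z) - Im z)"
proof -
  have inv: "(\<lambda>n. 1 / y n) \<longlonglongrightarrow> 0"
    by (rule tendsto_divide_0[OF tendsto_const filterlim_at_top_imp_at_infinity[OF y]])
  have ypos: "\<forall>\<^sub>F n in sequentially. y n > 0" and y1: "\<forall>\<^sub>F n in sequentially. y n > 1"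
    using y by (auto simp: filterlim_at_top_dense)
  have lim_w: "(\<lambda>n. w n / y n) \<longlonglongrightarrow> \<i>"
  proof -
    have "(\<lambda>n. w n / y n - \<i>) \<longlonglongrightarrow> 0"
    proof (rule Lim_null_comparison)
      show "\<forall>\<^sub>F n in sequentially. norm (w n / y n - \<i>) \<le> B * (1 / y n)"
        using ypos
      proof eventually_elim
        case (elim n)
        have "w n / y n - \<i> = (w n - \<i> * y n) / y n"
          using elim by (simp add: field_simps)
        then have "norm (w n / y n - \<i>) = cmod (w n - \<i> * y n) / y n"
          using elim by (simp add: norm_divide)
        then show ?case using wy[of n] elim by (simp add: divide_right_mono)
      qed
      show "(\<lambda>n. B * (1 / y n)) \<longlonglongrightarrow> 0" using tendsto_mult[OF tendsto_const inv, of B] by simp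
    qed
    then show ?thesis using LIM_zero_iff by blast
  qed
  have lim_fw: "(\<lambda>n. f (w n) / y n) \<longlonglongrightarrow> \<i>"
  proof -
    have "(\<lambda>n. (f (w n) - w n) / y n) \<longlonglongrightarrow> 0"
    proof (rule Lim_null_comparison)
      show "\<forall>\<^sub>F n in sequentially. norm ((f (w n) - w n) / y n) \<le> C * (1 / y n)"
        using y1
      proof eventually_elim
        case (elim n)
        have "cmod (f (w n) - w n) \<le> cmod (f (w n) - w n) * y n"
          using elim by (simp add: mult_le_cancel_left1)
        then have "cmod (f (w n) - w n) \<le> C" using fw[of n] by linarith
        then show ?case using elim by (simp add: norm_divide divide_right_mono)
      qed
      show "(\<lambda>n. C * (1 / y n)) \<longlonglongrightarrow> 0" using tendsto_mult[OF tendsto_const inv, of C] by simp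
    qed
    from tendsto_add[OF this lim_w] show ?thesis
      by (simp add: diff_divide_distrib)
  qed
  have lim_a: "(\<lambda>n. a / y n) \<longlonglongrightarrow> 0" for a :: complex
  proof -
    have "(\<lambda>n. a * of_real (1 / y n)) \<longlonglongrightarrow> a * of_real 0"
      by (intro tendsto_intros inv)
    then show ?thesis by simp
  qed
  have lim1: "(\<lambda>n. cmod (a / y n - w n / y n) ^ 2) \<longlonglongrightarrow> 1" for a :: complex
  proof -
    have "(\<lambda>n. cmod (a / y n - w n / y n) ^ 2) \<longlonglongrightarrow> cmod (0 - \<i>) ^ 2"
      by (intro tendsto_intros lim_a lim_w)
    then show ?thesis by simp
  qed
  have gen: "Im z \<le> Im (f z)" if z: "z \<in> UHP" for z
  proof -
    have "(\<lambda>n. cmod (f z / y n - f (w n) / y n) ^ 2 * Im z * Im (w n / y n)) \<longlonglongrightarrow> cmod (0 - \<i>) ^ 2 * Im z * Im \<i>"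
      by (intro tendsto_intros lim_a lim_fw lim_w)
    moreover have "(\<lambda>n. cmod (z / y n - w n / y n) ^ 2 * Im (f z) * Im (f (w n) / y n)) \<longlonglongrightarrow> 1 * Im (f z) * Im \<i>"
      by (intro tendsto_intros lim1 lim_fw)
    moreover have "\<forall>\<^sub>F n in sequentially. cmod (f z / y n - f (w n) / y n) ^ 2 * Im z * Im (w n / y n)
       \<le> cmod (z / y n - w n / y n) ^ 2 * Im (f z) * Im (f (w n) / y n)"
      using ypos
    proof eventually_elim
      case (elim n)
      have "(cmod (f z - f (w n)))\<^sup>2 * Im z * Im (w n) \<le> (cmod (z - w n))\<^sup>2 * Im (f z) * Im (f (w n))"
        by (rule Schwarz_Pick_UHP[OF hol im z w])
      then have "(cmod (f z - f (w n)))\<^sup>2 * Im z * Im (w n) / y n ^ 3 \<le> (cmod (z - w n))\<^sup>2 * Im (f z) * Im (f (w n)) / y n ^ 3"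
        using elim by (simp add: divide_right_mono)
      then show ?case
        using elim by (simp add: norm_divide power_divide power3_eq_cube power2_eq_square flip: diff_divide_distrib)
    qed
    ultimately have "cmod (0 - \<i>) ^ 2 * Im z * Im \<i> \<le> 1 * Im (f z) * Im \<i>"
      by (intro tendsto_le[OF sequentially_bot])
    then show ?thesis by simp
  qed
  from gen[OF z] show "Im z \<le> Im (f z)" .
  define p where "p = (\<lambda>z. f z - z)"
  have ph: "p holomorphic_on UHP"
    unfolding p_def by (intro holomorphic_intros hol)
  have C0: "0 \<le> C"
  proof -
    obtain n where "y n > 0" using eventually_happens'[OF sequentially_bot ypos] by blast
    then show ?thesis using fw[of n] by (meson mult_nonneg_nonneg norm_ge_zero less_imp_le order_trans)
  qed
  \<comment> \<open>By the first part \<open>Im (p v) \<ge> 0\<close> everywhere. If equality occurs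
    anywhere, the open mapping theorem makes \<open>p\<close> constant, and the decay along
    \<open>w n\<close> makes the constant zero.\<close>
  show "(cmod (f z - z))\<^sup>2 * Im z \<le> C * (Im (f z) - Im z)"
  proof (cases "\<forall>v\<in>UHP. Im (p v) > 0")
    case True
    define m where "m = (\<lambda>z. - 1 / p z)"
    have pn0: "p v \<noteq> 0" if "v \<in> UHP" for v using True that by force
    have Imm: "Im (m v) = Im (p v) / (cmod (p v))\<^sup>2" for v
      by (simp add: m_def Im_divide cmod_power2)
    have mh: "m holomorphic_on UHP"
      unfolding m_def by (intro holomorphic_intros ph) (use pn0 in auto)
    have mim: "m ` UHP \<subseteq> UHP"
      using True pn0 by (auto simp: UHP_iff Imm)
    have "C > 0"
    proof (rule ccontr)
      assume "\<not> C > 0"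
      obtain n where "y n > 0" using eventually_happens'[OF sequentially_bot ypos] by blast
      then have "cmod (p (w n)) * y n \<le> 0" using fw[of n] \<open>\<not> C > 0\<close> by (simp add: p_def)
      then have "p (w n) = 0" using \<open>y n > 0\<close> by (simp add: mult_le_0_iff)
      then show False using pn0 w by blast
    qed
    have "(\<lambda>n. ((1 / C) - 2 * cmod (m z) * (1 / y n)) * Im z * Im (w n / y n)) \<longlonglongrightarrow> (1 / C - 2 * cmod (m z) * 0) * Im z * Im \<i>"
      by (intro tendsto_intros lim_w inv)
    moreover have "(\<lambda>n. cmod (z / y n - w n / y n) ^ 2 * Im (m z)) \<longlonglongrightarrow> 1 * Im (m z)"
      by (intro tendsto_intros lim1)
    moreover have "\<forall>\<^sub>F n in sequentially. ((1 / C) - 2 * cmod (m z) * (1 / y n)) * Im z * Im (w n / y n)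
       \<le> cmod (z / y n - w n / y n) ^ 2 * Im (m z)"
      using ypos
    proof eventually_elim
      case (elim n)
      define M where "M = cmod (m (w n))"
      have M: "M > 0" "M \<ge> y n / C"
      proof -
        have "cmod (p (w n)) > 0" using pn0[OF w] by simp
        moreover have "y n * cmod (p (w n)) \<le> C"
          using fw[of n] by (simp add: p_def mult.commute)
        ultimately show "M > 0" "M \<ge> y n / C"
          using \<open>C > 0\<close> by (auto simp: M_def m_def norm_divide field_simps)
      qed
      \<comment> \<open>One factor \<open>M\<close> on the left meets
        \<open>Im (m (w n)) \<le> M\<close> on the right and cancels. The remaining one is at least
        \<open>y n / C\<close>, which balances the later division by the square of
        \<open>y n\<close>.\<close>
      have "M * (M - 2 * cmod (m z)) \<le> (M - cmod (m z))\<^sup>2"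
        by (simp add: power2_eq_square algebra_simps)
      also have "\<dots> \<le> (cmod (m z - m (w n)))\<^sup>2"
        using power_mono[OF norm_triangle_ineq3[of "m (w n)" "m z"], of 2]
        by (simp add: M_def norm_minus_commute)
      finally have "M * (M - 2 * cmod (m z)) * (Im z * Im (w n)) \<le> (cmod (m z - m (w n)))\<^sup>2 * (Im z * Im (w n))"
        using z w[of n] by (intro mult_right_mono) (auto simp: UHP_iff)
      also have "\<dots> \<le> (cmod (z - w n))\<^sup>2 * Im (m z) * Im (m (w n))"
        using Schwarz_Pick_UHP[OF mh mim z w] by (simp add: mult.assoc)
      also have "\<dots> \<le> (cmod (z - w n))\<^sup>2 * Im (m z) * M"
        using mim z abs_Im_le_cmod[of "m (w n)"] unfolding M_def
        by (intro mult_left_mono mult_nonneg_nonneg) (auto simp: UHP_iff image_subset_iff less_imp_le)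
      finally have "M * ((M - 2 * cmod (m z)) * (Im z * Im (w n))) \<le> M * ((cmod (z - w n))\<^sup>2 * Im (m z))"
        by (simp add: mult_ac)
      then have "(M - 2 * cmod (m z)) * (Im z * Im (w n)) \<le> (cmod (z - w n))\<^sup>2 * Im (m z)"
        using M(1) by simp
      moreover have "(y n / C - 2 * cmod (m z)) * (Im z * Im (w n)) \<le> (M - 2 * cmod (m z)) * (Im z * Im (w n))"
        using z w[of n] M(2) by (intro mult_right_mono) (auto simp: UHP_iff)
      ultimately have "(y n / C - 2 * cmod (m z)) * (Im z * Im (w n)) / (y n)\<^sup>2 \<le> (cmod (z - w n))\<^sup>2 * Im (m z) / (y n)\<^sup>2"
        by (intro divide_right_mono) auto
      moreover have "(y n / C - 2 * cmod (m z)) * (Im z * Im (w n)) / (y n)\<^sup>2 = ((1 / C) - 2 * cmod (m z) * (1 / y n)) * Im z * Im (w n / y n)"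
        using elim \<open>C > 0\<close> by (simp add: field_simps power2_eq_square)
      moreover have "(cmod (z - w n))\<^sup>2 * Im (m z) / (y n)\<^sup>2 = cmod (z / y n - w n / y n) ^ 2 * Im (m z)"
        using elim by (simp add: norm_divide power_divide flip: diff_divide_distrib)
      ultimately show ?case by simp
    qed
    ultimately have "(1 / C - 2 * cmod (m z) * 0) * Im z * Im \<i> \<le> 1 * Im (m z)"
      by (intro tendsto_le[OF sequentially_bot])
    then have "Im z / C \<le> Im (p z) / (cmod (p z))\<^sup>2" by (simp add: Imm)
    then show ?thesis
      using \<open>C > 0\<close> pn0[OF z] by (simp add: p_def divide_simps mult_ac)
  next
    case False
    then obtain v where v: "v \<in> UHP" "Im (p v) \<le> 0" by force
    have "p constant_on UHP"
    proof (rule ccontr)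
      assume "\<not> p constant_on UHP"
      then have "open (p ` UHP)"
        using open_mapping_thm[OF ph open_UHP connected_UHP open_UHP] by blast
      then obtain e where e: "e > 0" "ball (p v) e \<subseteq> p ` UHP"
        using v by (meson image_eqI open_contains_ball)
      have "p v - \<i> * of_real (e / 2) \<in> ball (p v) e"
        using e by (simp add: dist_norm norm_mult)
      then obtain x where "x \<in> UHP" "p x = p v - \<i> * of_real (e / 2)" using e by (auto simp del: mem_ball)
      then show False using gen[of x] v e by (auto simp: p_def dest: arg_cong[where f=Im])
    qed
    then obtain c where c: "\<And>z. z \<in> UHP \<Longrightarrow> p z = c" by (auto simp: constant_on_def)
    have "(\<lambda>n. C * (1 / y n)) \<longlonglongrightarrow> C * 0" by (intro tendsto_intros inv)
    moreover have "\<forall>\<^sub>F n in sequentially. cmod c \<le> C * (1 / y n)"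
      using ypos
    proof eventually_elim
      case (elim n)
      have "cmod c * y n \<le> C" using fw[of n] c[OF w[of n]] by (simp add: p_def)
      then show ?case using elim by (simp add: field_simps)
    qed
    ultimately have "cmod c \<le> C * 0"
      by (intro tendsto_le[OF sequentially_bot _ tendsto_const])
    then have "p z = 0" using c[OF z] by simp
    then have "f z = z" by (simp add: p_def)
    then show ?thesis by simp
  qed
qed

section \<open>The half-plane capacity\<close>

text \<open>Cancelling one factor \<open>cmod (f z - z)\<close> in Julia's inequality, via
  \<open>Im (f z) - Im z \<le> cmod (f z - z)\<close>, keeps the constant \<open>C\<close>: control
  along one sequence is control everywhere.\<close>

lemma Julia_UHP_bound:
  fixes w :: "nat \<Rightarrow> complex" and y :: "nat \<Rightarrow> real"
  assumes "f holomorphic_on UHP" "f ` UHP \<subseteq> UHP"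
    and "filterlim y at_top sequentially" "\<And>n. w n \<in> UHP"
    and "\<And>n. cmod (w n - \<i> * y n) \<le> B"
    and "\<And>n. cmod (f (w n) - w n) * y n \<le> C" and z: "z \<in> UHP"
  shows "cmod (f z - z) * Im z \<le> C"
proof (cases "f z = z")
  case True
  obtain n where "y n > 0"
    using assms(3) eventually_happens'[OF sequentially_bot] unfolding filterlim_at_top_dense by blast
  then have "0 \<le> C" using assms(6)[of n] by (meson mult_nonneg_nonneg norm_ge_zero less_imp_le order_trans)
  then show ?thesis using True by simp
next
  case False
  obtain n where "y n > 0"
    using assms(3) eventually_happens'[OF sequentially_bot] unfolding filterlim_at_top_dense by blast
  then have "0 \<le> C" using assms(6)[of n] by (meson mult_nonneg_nonneg norm_ge_zero less_imp_le order_trans)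
  have "cmod (f z - z) * (cmod (f z - z) * Im z) \<le> C * (Im (f z) - Im z)"
    using Julia_UHP(2)[OF assms] by (simp add: power2_eq_square)
  also have "\<dots> \<le> C * cmod (f z - z)"
    using \<open>0 \<le> C\<close> abs_Im_le_cmod[of "f z - z"] by (intro mult_left_mono) auto
  finally show ?thesis using False by (simp add: mult.commute)
qed

text \<open>The least admissible constant, taken as a supremum so that no limit has to exist
  beforehand; \<open>has_hcap_hcap\<close> identifies it with the limit along the imaginary
  axis.\<close>

definition hcap :: "(complex \<Rightarrow> complex) \<Rightarrow> real" where
  "hcap f = (SUP z\<in>upper_half_plane. cmod (f z - z) * Im z)"

lemma hydro_mapsD:
  assumes "f \<in> hydro_maps"
  shows "f \<in> extensional UHP" "f holomorphic_on UHP" "inj_on f UHP" "f ` UHP \<subseteq> UHP"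
  using assms by (auto simp: hydro_maps_def)

lemma hydro_in_UHP: "f \<in> hydro_maps \<Longrightarrow> z \<in> UHP \<Longrightarrow> f z \<in> UHP"
  using hydro_mapsD(4) by blast

lemma ii_UHP: "y > 0 \<Longrightarrow> \<i> * complex_of_real y \<in> UHP"
  by (simp add: UHP_iff)

lemma hcap_upper:
  assumes "f \<in> hydro_maps" "z \<in> UHP"
  shows "cmod (f z - z) * Im z \<le> hcap f"
proof -
  obtain C where "\<And>z. z \<in> UHP \<Longrightarrow> cmod (f z - z) \<le> C / Im z"
    using assms by (auto simp: hydro_maps_def)
  then have "cmod (f z - z) * Im z \<le> C" if "z \<in> UHP" for z
    using that by (force simp: UHP_iff field_simps)
  then have "bdd_above ((\<lambda>z. cmod (f z - z) * Im z) ` UHP)"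
    by (intro bdd_aboveI2)
  then show ?thesis unfolding hcap_def by (rule cSUP_upper[OF assms(2)])
qed

lemma UHP_nonempty: "UHP \<noteq> {}" using ii_UHP[of 1] by auto

lemma hcap_least: "(\<And>z. z \<in> UHP \<Longrightarrow> cmod (f z - z) * Im z \<le> C) \<Longrightarrow> hcap f \<le> C"
  unfolding hcap_def by (rule cSUP_least[OF UHP_nonempty])

lemma hcap_nonneg: "f \<in> hydro_maps \<Longrightarrow> 0 \<le> hcap f"
  using hcap_upper[of f \<i>] ii_UHP[of 1] by (auto intro: order_trans[OF norm_ge_zero])

lemma filterlim_real_Suc: "filterlim (\<lambda>n. real (Suc n)) at_top sequentially"
  using filterlim_real_sequentially filterlim_sequentially_Suc by blast

lemma hydro_dist_le: "f \<in> hydro_maps \<Longrightarrow> z \<in> UHP \<Longrightarrow> cmod (f z - z) \<le> hcap f / Im z"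
  using hcap_upper[of f z] by (simp add: UHP_iff field_simps)

text \<open>Sharper than the defining bound: where \<open>cmod (f z - z) * Im z\<close> is close to
  a positive \<open>hcap f\<close>, the displacement must point almost straight up. This fixes the
  argument, and not only the modulus, in \<open>hcap_seq\<close>.\<close>

lemma hydro_strong:
  assumes f: "f \<in> hydro_maps" and z: "z \<in> UHP"
  shows "Im z \<le> Im (f z)" "(cmod (f z - z))\<^sup>2 * Im z \<le> hcap f * (Im (f z) - Im z)"
proof -
  have b: "cmod (f (\<i> * complex_of_real (real (Suc n))) - \<i> * complex_of_real (real (Suc n))) * real (Suc n) \<le> hcap f" for n
    using hcap_upper[OF f ii_UHP[of "real (Suc n)"]] by simp
  show "Im z \<le> Im (f z)" "(cmod (f z - z))\<^sup>2 * Im z \<le> hcap f * (Im (f z) - Im z)"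
    by (rule Julia_UHP[OF hydro_mapsD(2,4)[OF f] filterlim_real_Suc ii_UHP[OF of_nat_0_less_iff[THEN iffD2, OF zero_less_Suc]] _ b z, of 0]; simp)+
qed

text \<open>Serves where a map is understood only at images such as \<open>k (\<i> * y n)\<close>,
  or only along a subsequence of heights.\<close>

lemma hydroI_seq:
  fixes w :: "nat \<Rightarrow> complex" and y :: "nat \<Rightarrow> real"
  assumes ext: "f \<in> extensional UHP" and inj: "inj_on f UHP"
    and hol: "f holomorphic_on UHP" "f ` UHP \<subseteq> UHP"
    and "filterlim y at_top sequentially" "\<And>n. w n \<in> UHP"
    and "\<And>n. cmod (w n - \<i> * y n) \<le> B"
    and "\<And>n. cmod (f (w n) - w n) * y n \<le> C"
  shows "f \<in> hydro_maps" "hcap f \<le> C"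
proof -
  have *: "cmod (f z - z) * Im z \<le> C" if "z \<in> UHP" for z
    by (rule Julia_UHP_bound[OF assms(3-8) that])
  then show "hcap f \<le> C" by (rule hcap_least)
  have "0 \<le> C" using *[OF ii_UHP[of 1]] by (auto intro: order_trans[OF norm_ge_zero])
  moreover have "cmod (f z - z) \<le> C / Im z" if "z \<in> UHP" for z
    using *[OF that] that by (simp add: UHP_iff field_simps)
  ultimately show "f \<in> hydro_maps" using assms by (auto simp: hydro_maps_def)
qed

lemma hydroI:
  assumes ext: "f \<in> extensional UHP" and inj: "inj_on f UHP"
    and hol: "f holomorphic_on UHP" "f ` UHP \<subseteq> UHP"
    and *: "\<And>z. z \<in> UHP \<Longrightarrow> cmod (f z - z) * Im z \<le> C"
  shows "f \<in> hydro_maps" "hcap f \<le> C"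
proof -
  show "hcap f \<le> C" by (rule hcap_least[OF *])
  have "0 \<le> C" using *[OF ii_UHP[of 1]] by (auto intro: order_trans[OF norm_ge_zero])
  moreover have "cmod (f z - z) \<le> C / Im z" if "z \<in> UHP" for z
    using *[OF that] that by (simp add: UHP_iff field_simps)
  ultimately show "f \<in> hydro_maps" using assms by (auto simp: hydro_maps_def)
qed

text \<open>First the modulus of \<open>Q n\<close> tends to \<open>c\<close>: if it stayed at or
  below some \<open>a < c\<close> along a subsequence, \<open>Julia_UHP_bound\<close> would make the
  capacity at most \<open>a\<close>. Then \<open>hydro_strong\<close> bounds the squared distance of
  \<open>- \<i> * Q n\<close> from \<open>c\<close> by a quantity tending to
  \<open>c\<^sup>2 + c\<^sup>2 - 2 * c\<^sup>2\<close>.\<close>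

lemma hcap_seq:
  fixes w :: "nat \<Rightarrow> complex" and y :: "nat \<Rightarrow> real"
  assumes f: "f \<in> hydro_maps" and y: "filterlim y at_top sequentially" and w: "\<And>n. w n \<in> UHP"
    and wy: "\<And>n. cmod (w n - \<i> * y n) \<le> B"
  shows "(\<lambda>n. \<i> * y n * (w n - f (w n))) \<longlonglongrightarrow> of_real (hcap f)"
proof -
  define c where "c = hcap f"
  define Q where "Q = (\<lambda>n. of_real (y n) * (f (w n) - w n))"
  have ypos: "\<forall>\<^sub>F n in sequentially. y n > 0"
    using y by (auto simp: filterlim_at_top_dense)
  have inv: "(\<lambda>n. 1 / y n) \<longlonglongrightarrow> 0"
    by (rule tendsto_divide_0[OF tendsto_const filterlim_at_top_imp_at_infinity[OF y]])
  have e: "(\<lambda>n. Im (w n) / y n) \<longlonglongrightarrow> 1"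
  proof -
    have "(\<lambda>n. Im (w n) / y n - 1) \<longlonglongrightarrow> 0"
    proof (rule Lim_null_comparison)
      show "\<forall>\<^sub>F n in sequentially. norm (Im (w n) / y n - 1) \<le> B * (1 / y n)"
        using ypos
      proof eventually_elim
        case (elim n)
        have "Im (w n) / y n - 1 = (Im (w n) - y n) / y n"
          using elim by (simp add: field_simps)
        then have "norm (Im (w n) / y n - 1) = \<bar>Im (w n - \<i> * y n)\<bar> / y n"
          using elim by simp
        also have "\<dots> \<le> B / y n"
          using elim by (intro divide_right_mono order_trans[OF abs_Im_le_cmod wy]) auto
        finally show ?case by simp
      qed
      show "(\<lambda>n. B * (1 / y n)) \<longlonglongrightarrow> 0" using tendsto_mult[OF tendsto_const inv, of B] by simp
    qed
    then show ?thesis using LIM_zero_iff by blast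
  qed
  have e': "(\<lambda>n. c / (Im (w n) / y n)) \<longlonglongrightarrow> c / 1"
    by (intro tendsto_intros e) auto
  have Qc: "(\<lambda>n. cmod (Q n)) \<longlonglongrightarrow> c"
  proof (rule order_tendstoI)
    fix a assume "a < c"
    show "\<forall>\<^sub>F n in sequentially. a < cmod (Q n)"
    proof (rule ccontr)
      assume "\<not> (\<forall>\<^sub>F n in sequentially. a < cmod (Q n))"
      then have "\<not> (\<forall>\<^sub>F n in sequentially. y n > 0 \<longrightarrow> a < cmod (Q n))"
        using eventually_mp[of "\<lambda>n. y n > 0" "\<lambda>n. a < cmod (Q n)" sequentially] ypos by blast
      then obtain r where r: "strict_mono (r :: nat \<Rightarrow> nat)" "\<forall>n. y (r n) > 0 \<and> \<not> a < cmod (Q (r n))"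
        using not_eventually_sequentiallyD[of "\<lambda>n. y n > 0 \<longrightarrow> a < cmod (Q n)"] by auto
      have "hcap f \<le> a"
      proof (rule hcap_least)
        fix z assume "z \<in> UHP"
        then show "cmod (f z - z) * Im z \<le> a"
        proof (rule Julia_UHP_bound[OF hydro_mapsD(2,4)[OF f], rotated -1])
          show "filterlim (\<lambda>n. y (r n)) at_top sequentially"
            using filterlim_compose[OF y filterlim_subseq[OF r(1)]] by simp
          show "w (r n) \<in> UHP" "cmod (w (r n) - \<i> * y (r n)) \<le> B" for n using w wy by auto
          show "cmod (f (w (r n)) - w (r n)) * y (r n) \<le> a" for n
            using r(2)[rule_format, of n] by (auto simp: Q_def norm_mult mult.commute not_less)
        qed
      qed
      then show False using \<open>a < c\<close> by (simp add: c_def)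
    qed
  next
    fix a assume "c < a"
    then have "\<forall>\<^sub>F n in sequentially. c / (Im (w n) / y n) < a"
      using order_tendstoD(2)[OF e'] by simp
    then show "\<forall>\<^sub>F n in sequentially. cmod (Q n) < a"
      using ypos
    proof eventually_elim
      case (elim n)
      have "cmod (Q n) \<le> c / (Im (w n) / y n)"
        using mult_left_mono[OF hydro_dist_le[OF f w[of n]], of "y n"] elim
        by (simp add: Q_def norm_mult c_def mult.commute)
      then show ?case using elim by simp
    qed
  qed
  have "(\<lambda>n. (cmod (Q n))\<^sup>2 + c\<^sup>2 - 2 * ((cmod (Q n))\<^sup>2 * (Im (w n) / y n))) \<longlonglongrightarrow> c\<^sup>2 + c\<^sup>2 - 2 * (c\<^sup>2 * 1)"
    by (intro tendsto_intros Qc e)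
  then have lim: "(\<lambda>n. (cmod (Q n))\<^sup>2 + c\<^sup>2 - 2 * ((cmod (Q n))\<^sup>2 * (Im (w n) / y n))) \<longlonglongrightarrow> 0"
    by simp
  have "(\<lambda>n. (cmod (\<i> * y n * (w n - f (w n)) - of_real c))\<^sup>2) \<longlonglongrightarrow> 0"
  proof (rule Lim_null_comparison[OF _ lim])
    show "\<forall>\<^sub>F n in sequentially. norm ((cmod (\<i> * y n * (w n - f (w n)) - of_real c))\<^sup>2)
       \<le> (cmod (Q n))\<^sup>2 + c\<^sup>2 - 2 * ((cmod (Q n))\<^sup>2 * (Im (w n) / y n))"
      using ypos
    proof eventually_elim
      case (elim n)
      have "(cmod (Q n))\<^sup>2 * (Im (w n) / y n) = y n * ((cmod (f (w n) - w n))\<^sup>2 * Im (w n))"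
        using elim by (simp add: Q_def norm_mult power_mult_distrib power2_eq_square)
      also have "\<dots> \<le> y n * (c * (Im (f (w n)) - Im (w n)))"
        using hydro_strong(2)[OF f w[of n]] elim unfolding c_def by (intro mult_left_mono) auto
      also have "\<dots> = c * Im (Q n)"
        by (simp add: Q_def)
      finally have "(cmod (Q n))\<^sup>2 * (Im (w n) / y n) \<le> c * Im (Q n)" .
      moreover have "(cmod (\<i> * y n * (w n - f (w n)) - of_real c))\<^sup>2 = (cmod (Q n))\<^sup>2 + c\<^sup>2 - 2 * (c * Im (Q n))"
      proof -
        have "\<i> * y n * (w n - f (w n)) - of_real c = - \<i> * Q n - of_real c"
          by (simp add: Q_def algebra_simps)
        then show ?thesis
          by (simp only: cmod_power2) (simp add: power2_eq_square algebra_simps)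
      qed
      ultimately have "(cmod (\<i> * y n * (w n - f (w n)) - of_real c))\<^sup>2
          \<le> (cmod (Q n))\<^sup>2 + c\<^sup>2 - 2 * ((cmod (Q n))\<^sup>2 * (Im (w n) / y n))"
        by linarith
      then show ?case by (simp only: real_norm_def abs_power2)
    qed
  qed
  from tendsto_real_sqrt[OF this] have "(\<lambda>n. cmod (\<i> * y n * (w n - f (w n)) - of_real c)) \<longlonglongrightarrow> 0"
    by (simp only: real_sqrt_abs abs_norm_cancel real_sqrt_zero)
  then have "(\<lambda>n. \<i> * y n * (w n - f (w n)) - of_real c) \<longlonglongrightarrow> 0"
    by (rule tendsto_norm_zero_cancel)
  then show ?thesis using LIM_zero_iff c_def by blast
qed

lemma has_hcap_hcap:
  assumes f: "f \<in> hydro_maps"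
  shows "has_hcap f (hcap f)"
  unfolding has_hcap_def
proof (rule tendsto_at_topI_sequentially)
  fix y :: "nat \<Rightarrow> real" assume y: "filterlim y at_top sequentially"
  \<comment> \<open>\<open>hcap_seq\<close> wants every point in the half-plane; the cut-off changes
    \<open>y\<close> at finitely many indices only.\<close>
  define y' where "y' = (\<lambda>n. max 1 (y n))"
  have ev: "\<forall>\<^sub>F n in sequentially. y' n = y n"
    using y[unfolded filterlim_at_top_dense, rule_format, of 1]
    by eventually_elim (simp add: y'_def)
  have y': "filterlim y' at_top sequentially"
    using y ev by (simp add: filterlim_cong)
  have "(\<lambda>n. \<i> * y' n * (\<i> * y' n - f (\<i> * y' n))) \<longlonglongrightarrow> of_real (hcap f)"
    by (rule hcap_seq[OF f y', of _ 0]) (auto simp: y'_def intro!: ii_UHP)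
  then show "(\<lambda>n. \<i> * y n * (\<i> * y n - f (\<i> * y n))) \<longlonglongrightarrow> of_real (hcap f)"
    by (rule Lim_transform_eventually) (use ev in eventually_elim, simp)
qed

lemma has_hcap_iff: "f \<in> hydro_maps \<Longrightarrow> has_hcap f t \<longleftrightarrow> t = hcap f"
  using has_hcap_hcap[of f]
    tendsto_unique[of at_top "\<lambda>y. \<i> * of_real y * (\<i> * of_real y - f (\<i> * of_real y))" "of_real t" "of_real (hcap f)"]
  unfolding has_hcap_def by auto

definition uhp_id :: "complex \<Rightarrow> complex" where "uhp_id = restrict (\<lambda>z. z) upper_half_plane"

lemma uhp_id [simp]: "z \<in> UHP \<Longrightarrow> uhp_id z = z"
  by (simp add: uhp_id_def)

lemma uhp_id_hydro: "uhp_id \<in> hydro_maps" and hcap_uhp_id: "hcap uhp_id = 0"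
proof -
  have "uhp_id holomorphic_on UHP"
    by (rule holomorphic_transform[of "\<lambda>z. z"]) auto
  then show *: "uhp_id \<in> hydro_maps"
    by (intro hydroI(1)[of _ 0]) (auto simp: inj_on_def, auto simp: uhp_id_def)
  have "hcap uhp_id \<le> 0" by (rule hcap_least) auto
  then show "hcap uhp_id = 0" using hcap_nonneg[OF *] by simp
qed

lemma hcap_0_imp_id:
  assumes f: "f \<in> hydro_maps" and "hcap f \<le> 0"
  shows "f = uhp_id"
proof (rule extensionalityI[OF hydro_mapsD(1)[OF f]])
  show "uhp_id \<in> extensional UHP" by (simp add: uhp_id_def)
  fix z assume z: "z \<in> UHP"
  then have "cmod (f z - z) * Im z \<le> 0" using hcap_upper[OF f z] assms by simp
  then show "f z = uhp_id z" using z by (simp add: UHP_iff mult_le_0_iff)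
qed

text \<open>Additivity comes from splitting \<open>\<i> * y - g (h (\<i> * y))\<close> at
  \<open>h (\<i> * y)\<close>. For \<open>y \<ge> 1\<close> that point stays within
  \<open>hcap h\<close> of \<open>\<i> * y\<close>, so the limit for \<open>g\<close> may be taken
  along it.\<close>

lemma compose_hydro:
  assumes g: "g \<in> hydro_maps" and h: "h \<in> hydro_maps"
  shows "compose UHP g h \<in> hydro_maps" "hcap (compose UHP g h) = hcap g + hcap h"
proof -
  let ?f = "compose UHP g h"
  note gD = hydro_mapsD[OF g] and hD = hydro_mapsD[OF h]
  have eq: "?f z = g (h z)" if "z \<in> UHP" for z using that by (simp add: compose_def)
  have "(g \<circ> h) holomorphic_on UHP"
    using holomorphic_on_compose_gen[OF hD(2) gD(2) hD(4)] .
  then have hol: "?f holomorphic_on UHP"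
    by (rule holomorphic_transform) (simp add: eq)
  show f: "?f \<in> hydro_maps"
  proof (rule hydroI(1)[where C = "hcap g + hcap h"])
    show "?f \<in> extensional UHP" by simp
    show "inj_on ?f UHP"
      using comp_inj_on[OF hD(3) inj_on_subset[OF gD(3) hD(4)]] inj_on_cong[of UHP ?f "g \<circ> h"] eq by simp
    show "?f ` UHP \<subseteq> UHP" using gD(4) hD(4) by (auto simp: eq image_subset_iff)
    fix z assume z: "z \<in> UHP"
    have hz: "h z \<in> UHP" using hD(4) z by blast
    have "cmod (?f z - z) * Im z \<le> (cmod (g (h z) - h z) + cmod (h z - z)) * Im z"
      using z norm_triangle_ineq[of "g (h z) - h z" "h z - z"] by (intro mult_right_mono) (auto simp: eq UHP_iff)
    also have "\<dots> \<le> cmod (g (h z) - h z) * Im (h z) + cmod (h z - z) * Im z"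
      using hydro_strong(1)[OF h z] by (simp add: distrib_right mult_left_mono)
    also have "\<dots> \<le> hcap g + hcap h" using hcap_upper[OF g hz] hcap_upper[OF h z] by simp
    finally show "cmod (?f z - z) * Im z \<le> hcap g + hcap h" .
  qed (rule hol)
  define y where "y = (\<lambda>n. real (Suc n))"
  have y: "filterlim y at_top sequentially" unfolding y_def by (rule filterlim_real_Suc)
  have yU: "\<i> * y n \<in> UHP" for n by (simp add: UHP_iff y_def)
  have l1: "(\<lambda>n. \<i> * y n * (\<i> * y n - ?f (\<i> * y n))) \<longlonglongrightarrow> of_real (hcap ?f)"
    by (rule hcap_seq[OF f y, of _ 0]) (auto simp: yU)
  have l2: "(\<lambda>n. \<i> * y n * (\<i> * y n - h (\<i> * y n))) \<longlonglongrightarrow> of_real (hcap h)"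
    by (rule hcap_seq[OF h y, of _ 0]) (auto simp: yU)
  have l3: "(\<lambda>n. \<i> * y n * (h (\<i> * y n) - g (h (\<i> * y n)))) \<longlonglongrightarrow> of_real (hcap g)"
  proof (rule hcap_seq[OF g y])
    show "h (\<i> * y n) \<in> UHP" for n using hD(4) yU by blast
    show "cmod (h (\<i> * y n) - \<i> * y n) \<le> hcap h" for n
    proof -
      have "cmod (h (\<i> * y n) - \<i> * y n) \<le> hcap h / Im (\<i> * y n)"
        by (rule hydro_dist_le[OF h yU])
      also have "\<dots> \<le> hcap h" using hcap_nonneg[OF h] by (simp add: y_def field_simps)
      finally show ?thesis .
    qed
  qed
  have "(\<lambda>n. \<i> * y n * (\<i> * y n - ?f (\<i> * y n))) \<longlonglongrightarrow> of_real (hcap g) + of_real (hcap h)"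
    using tendsto_add[OF l3 l2] by (simp add: eq yU algebra_simps)
  then have "complex_of_real (hcap ?f) = of_real (hcap g) + of_real (hcap h)"
    using l1 LIMSEQ_unique by blast
  then show "hcap ?f = hcap g + hcap h" by (metis of_real_add of_real_eq_iff)
qed

text \<open>Montel and Hurwitz: the bound \<open>A / Im z\<close> on displacements gives local
  boundedness, and the limit is injective because it is not constant. Capacity may drop in the
  limit, hence an inequality for \<open>hcap g\<close>.\<close>

lemma hydro_compact:
  assumes F: "\<And>n::nat. F n \<in> hydro_maps" and a: "\<And>n. hcap (F n) \<le> a n" "a \<longlonglongrightarrow> c"
  obtains r g where "strict_mono (r :: nat \<Rightarrow> nat)" "g \<in> hydro_maps" "hcap g \<le> c"
    "\<And>z. z \<in> UHP \<Longrightarrow> (\<lambda>n. F (r n) z) \<longlonglongrightarrow> g z"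
proof -
  obtain A where A: "\<And>n. \<bar>a n\<bar> \<le> A"
    using convergent_imp_Bseq[OF convergentI[OF a(2)]] by (auto simp: Bseq_def)
  then have hA: "hcap (F n) \<le> A" for n using a(1)[of n] A[of n] by linarith
  have bd: "cmod (F n z) \<le> cmod z + A / Im z" if "z \<in> UHP" for n z
  proof -
    have "cmod (F n z) \<le> cmod z + cmod (F n z - z)"
      using norm_triangle_ineq[of z "F n z - z"] by simp
    also have "cmod (F n z - z) \<le> hcap (F n) / Im z" by (rule hydro_dist_le[OF F that])
    also have "\<dots> \<le> A / Im z" using hA that by (intro divide_right_mono) (auto simp: UHP_iff)
    finally show ?thesis by simp
  qed
  have hol: "h holomorphic_on UHP" if "h \<in> range F" for h
    using that F hydro_mapsD(2) by blast
    have bdK: "\<exists>B. \<forall>h\<in>range F. \<forall>z\<in>K. cmod (h z) \<le> B" if K: "compact K" "K \<subseteq> UHP" for K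
    proof -
      have "continuous_on K (\<lambda>z. cmod z + A / Im z)"
        using K by (intro continuous_intros) (auto simp: UHP_iff)
      then have "bounded ((\<lambda>z. cmod z + A / Im z) ` K)"
        using K compact_continuous_image compact_imp_bounded by blast
      then obtain B where "\<And>z. z \<in> K \<Longrightarrow> \<bar>cmod z + A / Im z\<bar> \<le> B"
        unfolding bounded_iff by auto
      then have "cmod (F n z) \<le> B" if "z \<in> K" for n z
        using bd[of z n] that K by (meson abs_le_D1 order_trans subsetD)
      then show ?thesis by blast
    qed
  obtain g r where gr: "g holomorphic_on UHP" "strict_mono (r :: nat \<Rightarrow> nat)"
    and ptw: "\<And>x. x \<in> UHP \<Longrightarrow> ((\<lambda>n. F (r n) x) \<longlongrightarrow> g x) sequentially"
    and unif: "\<And>K. \<lbrakk>compact K; K \<subseteq> UHP\<rbrakk> \<Longrightarrow> uniform_limit K (F \<circ> r) g sequentially"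
    by (rule Montel[where \<F> = F and \<H> = "range F", OF open_UHP _ _ order_refl])
      ((use hol in blast), (use bdK in blast), (rule that; blast))
  have le: "cmod (g z - z) * Im z \<le> c" if z: "z \<in> UHP" for z
  proof (rule tendsto_le[OF sequentially_bot])
    show "(\<lambda>n. cmod (F (r n) z - z) * Im z) \<longlonglongrightarrow> cmod (g z - z) * Im z"
      by (intro tendsto_intros ptw z)
    show "(\<lambda>n. a (r n)) \<longlonglongrightarrow> c" using LIMSEQ_subseq_LIMSEQ[OF a(2) gr(2)] by (simp add: comp_def)
    show "\<forall>\<^sub>F n in sequentially. cmod (F (r n) z - z) * Im z \<le> a (r n)"
      using hcap_upper[OF F z] a(1) order_trans by (intro always_eventually) blast
  qed
  have Imle: "Im z \<le> Im (g z)" if z: "z \<in> UHP" for z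
  proof (rule tendsto_le[OF sequentially_bot])
    show "(\<lambda>n. Im (F (r n) z)) \<longlonglongrightarrow> Im (g z)" by (intro tendsto_intros ptw z)
    show "\<forall>\<^sub>F n in sequentially. Im z \<le> Im (F (r n) z)"
      using hydro_strong(1)[OF F z] by simp
  qed auto
  have noncon: "\<not> g constant_on UHP"
  proof
    assume "g constant_on UHP"
    then obtain b where b: "\<And>z. z \<in> UHP \<Longrightarrow> g z = b" by (auto simp: constant_on_def)
    \<comment> \<open>A constant value \<open>b\<close> violates the displacement bound at this
      height, because \<open>(y - cmod b) * y\<close> exceeds \<open>c\<close>.\<close>
    define y where "y = cmod b + \<bar>c\<bar> + 1"
    have "y \<ge> 1" unfolding y_def by simp
    then have "cmod (b - \<i> * y) * y \<le> c" using le[OF ii_UHP[of y]] b[OF ii_UHP[of y]] by simp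
    moreover have "y - cmod b \<le> cmod (b - \<i> * y)"
      using norm_triangle_ineq2[of "\<i> * y" b] \<open>y \<ge> 1\<close> by (simp add: norm_mult norm_minus_commute)
    ultimately have "(y - cmod b) * y \<le> c" using \<open>y \<ge> 1\<close> by (meson mult_right_mono order_trans zero_le_one)
    moreover have "(y - cmod b) * y \<ge> (\<bar>c\<bar> + 1) * 1" using \<open>y \<ge> 1\<close> unfolding y_def by (intro mult_mono) auto
    ultimately show False by simp
  qed
  define G where "G = restrict g UHP"
  have G: "G z = g z" if "z \<in> UHP" for z using that by (simp add: G_def)
  have inj: "inj_on g UHP"
  proof (rule Hurwitz_injective[OF open_UHP connected_UHP _ gr(1) unif noncon])
    show "(F \<circ> r) n holomorphic_on UHP" "inj_on ((F \<circ> r) n) UHP" for n using F hydro_mapsD by auto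
  qed auto
  have "inj_on G UHP" using inj by (simp add: G_def inj_on_def)
  moreover have "G holomorphic_on UHP" by (rule holomorphic_transform[OF gr(1)]) (simp add: G)
  moreover have "G ` UHP \<subseteq> UHP" using Imle by (force simp: G UHP_iff)
  moreover have "G \<in> extensional UHP" by (simp add: G_def)
  ultimately have "G \<in> hydro_maps" "hcap G \<le> c"
    using le by (auto intro!: hydroI[of G c] simp: G)
  then show thesis using that[of r G] gr ptw by (simp add: G)
qed

section \<open>Decomposition of hydrodynamically normalized maps\<close>

text \<open>\<open>C\<close> is the component of \<open>p\<close> in the part of \<open>X\<close>
  outside the ball, a proper part because of \<open>w\<close>. Boundary bumping makes
  \<open>C\<close> meet the relative frontier of that part; points with \<open>cmod x > s\<close>
  are interior to it, so the meeting point lies on the circle.\<close>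

lemma boundary_bumping_ball:
  fixes X :: "complex set"
  assumes X: "compact X" "connected X" and p: "p \<in> X" "s \<le> cmod p" and w: "w \<in> X" "cmod w < s"
  obtains C x where "connected C" "C \<subseteq> X - ball 0 s" "p \<in> C" "x \<in> C" "cmod x = s"
proof -
  let ?T = "top_of_set X"
  define S where "S = X - ball 0 s"
  have SX: "S \<subseteq> X" and pS: "p \<in> S" and wS: "w \<notin> S" using p w by (auto simp: S_def)
  have clS: "closedin ?T S"
    unfolding S_def Diff_eq by (intro closedin_closed_Int) auto
  define C where "C = connected_component_of_set (subtopology ?T S) p"
  have st: "subtopology ?T S = top_of_set S" using SX by (simp add: subtopology_subtopology Int_absorb1)
  have Ccomp: "C \<in> connected_components_of (subtopology ?T S)"
    unfolding C_def using pS SX by (simp add: connected_component_in_connected_components_of st)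
  have "C \<inter> ?T frontier_of S \<noteq> {}"
    using Ccomp X clS w wS connectedin_iff_connected[of X]
    unfolding connectedin_def
    by (intro boundary_bumping_theorem_closed) (auto simp: compact_space_subtopology Hausdorff_space_subtopology compactin_subtopology)
  then obtain x where x: "x \<in> C" "x \<in> ?T frontier_of S" by blast
  have CS: "C \<subseteq> S" using connected_component_of_subset_topspace[of "subtopology ?T S" p] by (simp add: C_def st)
  have "cmod x = s"
  proof (rule ccontr)
    assume "cmod x \<noteq> s"
    moreover have "x \<in> S" using x CS by blast
    ultimately have xs: "x \<in> X - cball 0 s" by (auto simp: S_def)
    have "openin ?T (X - cball 0 s)" unfolding Diff_eq by (intro openin_open_Int) auto
    moreover have "X - cball 0 s \<subseteq> S" by (auto simp: S_def)
    ultimately have "x \<in> ?T interior_of S" using interior_of_maximal xs by blast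
    then show False using x(2) by (simp add: frontier_of_def)
  qed
  moreover have "connected C"
    using connectedin_connected_component_of[of "subtopology ?T S" p] by (simp add: C_def st connectedin_subtopology)
  moreover have "p \<in> C" using pS SX by (simp add: C_def st connected_component_of_refl)
  ultimately show thesis using that x CS by (auto simp: S_def)
qed

text \<open>Every component of the complement is unbounded, so it leaves the disc and meets the
  connected exterior; hence there is only one.\<close>

lemma connected_Compl_simply_connected_bounded:
  fixes \<Omega> :: "complex set"
  assumes \<Omega>: "open \<Omega>" "simply_connected \<Omega>" "\<Omega> \<subseteq> ball 0 1"
  shows "connected (- \<Omega>)"
proof -
  have ext: "connected (- ball (0::complex) 1)"
    by (intro connected_complement_bounded_convex) auto
  have one: "1 \<in> - ball (0::complex) 1" by simp
  have "connected_component (- \<Omega>) x 1" if x: "x \<in> - \<Omega>" for x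
  proof -
    define C where "C = connected_component_set (- \<Omega>) x"
    have "C \<in> components (- \<Omega>)" using x by (auto simp: C_def components_def)
    then have "\<not> bounded C" using \<Omega> simply_connected_eq_unbounded_complement_components by blast
    then have "\<not> C \<subseteq> ball 0 1" using bounded_subset bounded_ball by blast
    then obtain y where y: "y \<in> C" "y \<notin> ball 0 1" by blast
    have "connected_component (- \<Omega>) y 1"
      unfolding connected_component_def using \<Omega>(3) ext one y by (intro exI[of _ "- ball 0 1"]) auto
    moreover have "connected_component (- \<Omega>) x y" using y by (simp add: C_def)
    ultimately show ?thesis by (rule connected_component_trans[rotated])
  qed
  then show ?thesis
    unfolding connected_iff_connected_component by (meson connected_component_sym connected_component_trans)
qed

text \<open>The new domain is the complement of a proper part of the continuum \<open>- \<Omega>\<close>, which reaches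
  a prescribed level inside the disc by boundary bumping.\<close>

lemma intermediate_simply_connected_disc:
  fixes \<Omega> :: "complex set"
  assumes \<Omega>: "open \<Omega>" "simply_connected \<Omega>" "\<Omega> \<subset> ball 0 1" "\<Omega> \<noteq> {}"
  obtains \<Omega>' where "open \<Omega>'" "connected \<Omega>'" "simply_connected \<Omega>'" "\<Omega> \<subset> \<Omega>'" "\<Omega>' \<subset> ball 0 1"
proof -
  obtain w0 z0 where w0: "w0 \<in> ball 0 1" "w0 \<notin> \<Omega>" and z0: "z0 \<in> \<Omega>" using \<Omega> by blast
  have "max (cmod w0) (cmod z0) < 1" using w0 z0 \<Omega>(3) by (auto simp: psubset_eq subset_iff)
  \<comment> \<open>The ball of radius \<open>s\<close> will lie in the new domain: since it
    contains \<open>w0\<close>, the domain becomes larger than \<open>\<Omega>\<close>, and since it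
    contains \<open>z0\<close>, it is attached to \<open>\<Omega>\<close>.\<close>
  then obtain s where s: "cmod w0 < s" "cmod z0 < s" "s < 1" using dense[of "max (cmod w0) (cmod z0)" 1] by auto
  define E where "E = - \<Omega>"
  have E: "closed E" "connected E" and extE: "- ball 0 1 \<subseteq> E"
    using \<Omega> connected_Compl_simply_connected_bounded[of \<Omega>] by (auto simp: E_def)
  define X where "X = E \<inter> cball 0 2"
  have "compact X" unfolding X_def using E by (simp add: closed_Int_compact)
  moreover have "connected X"
  proof -
    \<comment> \<open>Radial retraction onto \<open>cball 0 2\<close>. Points of \<open>E\<close>
      outside it go to the circle of radius 2, which lies in \<open>E\<close>; the image is
      therefore exactly \<open>X\<close>, and connectedness passes over from
      \<open>E\<close>.\<close>
    define r where "r = (\<lambda>x. x / complex_of_real (max 1 (cmod x / 2)))"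
    have r1: "r x = x" if "x \<in> cball 0 2" for x using that by (simp add: r_def max_def)
    have "r ` E = X"
    proof (intro equalityI subsetI)
      fix y assume "y \<in> r ` E"
      then obtain x where x: "x \<in> E" "y = r x" by blast
      show "y \<in> X"
      proof (cases "x \<in> cball 0 2")
        case True
        then show ?thesis using x r1 by (simp add: X_def)
      next
        case False
        then have "cmod y = 2" by (auto simp: x r_def norm_divide max_def)
        then have "y \<in> - ball 0 1" "y \<in> cball 0 2" by auto
        then show ?thesis using extE unfolding X_def by blast
      qed
    next
      fix x assume "x \<in> X"
      then show "x \<in> r ` E"
        by (intro image_eqI[of _ _ x]) (use r1 in \<open>auto simp: X_def\<close>)
    qed
    moreover have "connected (r ` E)"
      unfolding r_def by (intro connected_continuous_image E continuous_intros) auto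
    ultimately show ?thesis by simp
  qed
  moreover have "1 \<in> X" using extE by (auto simp: X_def)
  moreover have "w0 \<in> X" using w0 by (auto simp: X_def E_def)
  ultimately obtain C x where C: "connected C" "C \<subseteq> X - ball 0 s" "1 \<in> C" "x \<in> C" "cmod x = s"
    using boundary_bumping_ball[of X 1 s w0] s by auto
  \<comment> \<open>The part of the complement that is kept. It contains the exterior of the disc
    and also \<open>x\<close> with \<open>cmod x = s < 1\<close>, which keeps the new domain a
    proper subset of the disc.\<close>
  define Y where "Y = connected_component_set (E - ball 0 s) 1"
  have Ycl: "closed Y" unfolding Y_def by (intro closed_connected_component closed_Diff E) auto
  have Ycon: "connected Y" by (simp add: Y_def)
  have YE: "Y \<subseteq> E - ball 0 s" unfolding Y_def by (rule connected_component_subset)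
  have xY: "x \<in> Y"
    unfolding Y_def using connected_component_maximal[of 1 C "E - ball 0 s"] C by (force simp: X_def)
  have extY: "- ball 0 1 \<subseteq> Y"
    unfolding Y_def
    by (rule connected_component_maximal)
      (use extE s in \<open>auto intro!: connected_complement_bounded_convex\<close>)
  define \<Omega>' where "\<Omega>' = connected_component_set (- Y) z0"
  have z0Y: "z0 \<in> - Y" using YE z0 by (auto simp: E_def)
  have op: "open \<Omega>'" unfolding \<Omega>'_def using Ycl by (intro open_connected_component) auto
  have con: "connected \<Omega>'" by (simp add: \<Omega>'_def)
  have sub: "\<Omega> \<subseteq> \<Omega>'"
    unfolding \<Omega>'_def
    by (rule connected_component_maximal[OF z0 simply_connected_imp_connected[OF \<Omega>(2)]]) (use YE in \<open>auto simp: E_def\<close>)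
  have "ball 0 s \<subseteq> \<Omega>'"
    unfolding \<Omega>'_def
    by (rule connected_component_maximal) (use YE s in auto)
  then have "w0 \<in> \<Omega>'" using s by auto
  have "\<Omega>' \<subseteq> - Y" unfolding \<Omega>'_def by (rule connected_component_subset)
  then have sub1: "\<Omega>' \<subseteq> ball 0 1" using extY by blast
  have "x \<notin> \<Omega>'" "x \<in> ball 0 1" using \<open>\<Omega>' \<subseteq> - Y\<close> xY C s by auto
  \<comment> \<open>A component of the complement of the connected set \<open>Y\<close> has
    connected complement; as this complement is also unbounded, there are no holes.\<close>
  have "\<Omega>' \<in> components (- Y)" using z0Y by (auto simp: \<Omega>'_def components_def)
  then have conc: "connected (- \<Omega>')" using component_complement_connected[OF Ycon] by blast
  have "\<not> bounded (- \<Omega>')"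
    using sub1 bounded_subset[OF bounded_ball] cobounded_imp_unbounded[of "- \<Omega>'"] by auto
  then have "simply_connected \<Omega>'"
    using simply_connected_eq_unbounded_complement_components[OF op] con conc
    by (metis components_eq_sing_iff bounded_empty singletonD)
  with op con sub sub1 show thesis using that \<open>w0 \<in> \<Omega>'\<close> w0 \<open>x \<notin> \<Omega>'\<close> \<open>x \<in> ball 0 1\<close> by blast
qed

section \<open>The Cayley transform and passage to the half-plane\<close>

definition cayley :: "complex \<Rightarrow> complex" where "cayley z = (z - \<i>) / (z + \<i>)"
definition cayley_inv :: "complex \<Rightarrow> complex" where "cayley_inv w = \<i> * (1 + w) / (1 - w)"

lemma UHP_plus_i: "z \<in> UHP \<Longrightarrow> z + \<i> \<noteq> 0"
  by (auto simp: UHP_iff complex_eq_iff)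

lemma cayley_in: "z \<in> UHP \<Longrightarrow> cayley z \<in> ball 0 1"
proof -
  assume z: "z \<in> UHP"
  have "(cmod (z + \<i>))\<^sup>2 = (cmod (z - \<i>))\<^sup>2 + 4 * Im z"
    using cmod_diff_cnj_sq[of z \<i>] by simp
  then have "(cmod (z - \<i>))\<^sup>2 < (cmod (z + \<i>))\<^sup>2" using z by (simp add: UHP_iff)
  then have "cmod (z - \<i>) < cmod (z + \<i>)" using power_less_imp_less_base by fastforce
  then show ?thesis by (simp add: cayley_def norm_divide divide_less_eq_1)
qed

lemma cayley_inv_in: assumes "w \<in> ball 0 1" shows "cayley_inv w \<in> UHP"
proof -
  have ne: "1 - w \<noteq> 0" using assms by auto
  have "Im (cayley_inv w) = Im (\<i> * (1 + w) * cnj (1 - w)) / (cmod (1 - w))\<^sup>2"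
    by (simp add: cayley_inv_def complex_div_cnj [of _ "1 - w"] Im_divide_of_real flip: of_real_power)
  also have "Im (\<i> * (1 + w) * cnj (1 - w)) = 1 - (cmod w)\<^sup>2"
    unfolding cmod_power2 by (simp add: algebra_simps power2_eq_square)
  finally have "Im (cayley_inv w) = (1 - (cmod w)\<^sup>2) / (cmod (1 - w))\<^sup>2" .
  moreover have "(cmod w)\<^sup>2 < 1" using assms by (simp add: power_less_one_iff)
  ultimately show ?thesis using ne by (simp add: UHP_iff)
qed

lemma cayley_inv_cayley: "z \<in> UHP \<Longrightarrow> cayley_inv (cayley z) = z"
proof -
  assume "z \<in> UHP"
  then have ne: "z + \<i> \<noteq> 0" by (rule UHP_plus_i)
  have e: "1 + cayley z = 2 * z / (z + \<i>)" "1 - cayley z = 2 * \<i> / (z + \<i>)"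
    using ne by (simp_all add: cayley_def field_simps)
  show ?thesis unfolding cayley_inv_def e using ne by simp
qed

lemma cayley_cayley_inv: "w \<in> ball 0 1 \<Longrightarrow> cayley (cayley_inv w) = w"
proof -
  assume "w \<in> ball 0 1"
  then have ne: "1 - w \<noteq> 0" by auto
  have e: "cayley_inv w - \<i> = 2 * \<i> * w / (1 - w)" "cayley_inv w + \<i> = 2 * \<i> / (1 - w)"
    using ne by (simp_all add: cayley_inv_def field_simps)
  show ?thesis unfolding cayley_def e using ne by simp
qed

lemma cayley_hol: "cayley holomorphic_on UHP"
  unfolding cayley_def by (intro holomorphic_intros) (auto dest: UHP_plus_i)

lemma cayley_inv_hol: "cayley_inv holomorphic_on ball 0 1"
  unfolding cayley_inv_def by (intro holomorphic_intros) auto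

lemma cayley_inj: "inj_on cayley UHP"
  by (rule inj_on_inverseI[of _ cayley_inv]) (rule cayley_inv_cayley)

lemma cayley_inv_inj: "inj_on cayley_inv (ball 0 1)"
  by (rule inj_on_inverseI[of _ cayley]) (rule cayley_cayley_inv)

text \<open>Carried over from the disc, where the exterior of the disc ties the complement of the
  domain together.\<close>

lemma intermediate_simply_connected_UHP:
  assumes h: "h holomorphic_on UHP" "inj_on h UHP" "h ` UHP \<subset> UHP"
  obtains D where "open D" "connected D" "simply_connected D" "h ` UHP \<subset> D" "D \<subset> UHP"
proof -
  define f where "f = cayley \<circ> h"
  define \<Omega> where "\<Omega> = f ` UHP"
  have "f holomorphic_on UHP" unfolding f_def
    using h by (intro holomorphic_on_compose_gen[OF h(1) cayley_hol]) auto
  then have cf: "continuous_on UHP f" by (rule holomorphic_on_imp_continuous_on)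
  have injf: "inj_on f UHP" unfolding f_def
    using h by (intro comp_inj_on inj_on_subset[OF cayley_inj]) auto
  have "open \<Omega>" unfolding \<Omega>_def
    by (rule invariance_of_domain[OF cf open_UHP injf])
  moreover have "simply_connected \<Omega>"
    unfolding \<Omega>_def
    using homeomorphic_simply_connected[OF invariance_of_domain_homeomorphic[OF open_UHP cf _ injf]]
      convex_imp_simply_connected[OF convex_UHP] by simp
  moreover have "\<Omega> \<subset> ball 0 1"
  proof -
    have "\<Omega> \<subseteq> ball 0 1" using h cayley_in by (auto simp: \<Omega>_def f_def simp del: mem_ball)
    moreover obtain p where p: "p \<in> UHP" "p \<notin> h ` UHP" using h by blast
    have "cayley p \<notin> \<Omega>"
      using p h inj_onD[OF cayley_inj] by (force simp: \<Omega>_def f_def)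
    ultimately show ?thesis using cayley_in[OF p(1)] by blast
  qed
  moreover have "\<Omega> \<noteq> {}" using UHP_nonempty by (simp add: \<Omega>_def)
  ultimately obtain \<Omega>' where O: "open \<Omega>'" "connected \<Omega>'" "simply_connected \<Omega>'" "\<Omega> \<subset> \<Omega>'" "\<Omega>' \<subset> ball 0 1"
    by (rule intermediate_simply_connected_disc)
  have sub: "\<Omega>' \<subseteq> ball 0 1" using O by blast
  have cc: "continuous_on \<Omega>' cayley_inv" "inj_on cayley_inv \<Omega>'"
    using holomorphic_on_imp_continuous_on[OF cayley_inv_hol] cayley_inv_inj sub
    by (auto intro: continuous_on_subset inj_on_subset)
  define D where "D = cayley_inv ` \<Omega>'"
  have hz: "h z = cayley_inv (f z)" if "z \<in> UHP" for z
    using that h by (auto simp: f_def cayley_inv_cayley)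
  have "open D" unfolding D_def by (rule invariance_of_domain[OF cc(1) O(1) cc(2)])
  moreover have "simply_connected D" unfolding D_def
    using homeomorphic_simply_connected[OF invariance_of_domain_homeomorphic[OF O(1) cc(1) _ cc(2)] O(3)] by simp
  moreover have "connected D" using \<open>simply_connected D\<close> by (rule simply_connected_imp_connected)
  moreover have "h ` UHP \<subset> D"
  proof -
    have "h ` UHP \<subseteq> D" using O(4) hz by (auto simp: D_def \<Omega>_def)
    moreover obtain w where w: "w \<in> \<Omega>'" "w \<notin> \<Omega>" using O by blast
    have "cayley_inv w \<notin> h ` UHP"
    proof
      assume "cayley_inv w \<in> h ` UHP"
      then obtain z where z: "z \<in> UHP" "cayley_inv w = h z" by blast
      then have "cayley (cayley_inv w) = f z" by (simp add: f_def)
      moreover have "w \<in> ball 0 1" using w(1) sub by blast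
      ultimately have "w = f z" using cayley_cayley_inv by simp
      then show False using w z by (auto simp: \<Omega>_def)
    qed
    ultimately show ?thesis using w by (auto simp: D_def)
  qed
  moreover have "D \<subset> UHP"
  proof -
    have "D \<subseteq> UHP" using sub cayley_inv_in by (auto simp: D_def simp del: mem_ball)
    moreover obtain w where w: "w \<in> ball 0 1" "w \<notin> \<Omega>'" using O by blast
    have "cayley_inv w \<notin> D"
      using w sub inj_onD[OF cayley_inv_inj] by (force simp: D_def simp del: mem_ball)
    ultimately show ?thesis using cayley_inv_in[OF w(1)] by blast
  qed
  ultimately show thesis using that by blast
qed

section \<open>Normalized factors and the extremal problem\<close>

text \<open>At \<open>k (\<i> * y)\<close> the displacement of \<open>g\<close> is the difference of
  the displacements of \<open>h\<close> and \<open>k\<close> at \<open>\<i> * y\<close>, hence of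
  order \<open>1 / y\<close>. \<open>hydroI_seq\<close> extends this from the image of
  \<open>k\<close> to the whole half-plane.\<close>

lemma hydro_left_factor:
  assumes h: "h \<in> hydro_maps" and k: "k \<in> hydro_maps" and g: "g \<in> extensional UHP"
    and hol: "g holomorphic_on UHP" "inj_on g UHP" "g ` UHP \<subseteq> UHP"
    and eq: "\<And>z. z \<in> UHP \<Longrightarrow> h z = g (k z)"
  shows "g \<in> hydro_maps" "h = compose UHP g k"
proof -
  define y where "y = (\<lambda>n. real (Suc n))"
  have y: "filterlim y at_top sequentially" unfolding y_def by (rule filterlim_real_Suc)
  have yU: "\<i> * y n \<in> UHP" for n by (simp add: UHP_iff y_def)
  have y1: "y n \<ge> 1" for n by (simp add: y_def)
  show "g \<in> hydro_maps"
  proof (rule hydroI_seq(1)[OF g hol(2,1,3) y])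
    fix n
    show "k (\<i> * y n) \<in> UHP" using yU hydro_in_UHP[OF k] by blast
    show "cmod (k (\<i> * y n) - \<i> * y n) \<le> hcap k"
    proof -
      have "cmod (k (\<i> * y n) - \<i> * y n) \<le> hcap k / Im (\<i> * y n)"
        by (rule hydro_dist_le[OF k yU])
      also have "\<dots> \<le> hcap k" using hcap_nonneg[OF k] y1[of n] by (simp add: divide_le_eq mult_le_cancel_left1)
      finally show ?thesis .
    qed
    have "cmod (g (k (\<i> * y n)) - k (\<i> * y n)) \<le> cmod (h (\<i> * y n) - \<i> * y n) + cmod (k (\<i> * y n) - \<i> * y n)"
      using norm_triangle_ineq4[of "h (\<i> * y n) - \<i> * y n" "k (\<i> * y n) - \<i> * y n"] eq[OF yU] by simp
    then have "cmod (g (k (\<i> * y n)) - k (\<i> * y n)) * y n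
      \<le> (cmod (h (\<i> * y n) - \<i> * y n) + cmod (k (\<i> * y n) - \<i> * y n)) * y n"
      using y1[of n] by (intro mult_right_mono) linarith+
    also have "\<dots> = cmod (h (\<i> * y n) - \<i> * y n) * y n + cmod (k (\<i> * y n) - \<i> * y n) * y n"
      by (rule distrib_right)
    also have "\<dots> \<le> hcap h + hcap k"
      using hcap_upper[OF h yU[of n]] hcap_upper[OF k yU[of n]] by simp
    finally show "cmod (g (k (\<i> * y n)) - k (\<i> * y n)) * y n \<le> hcap h + hcap k" .
  qed
  show "h = compose UHP g k"
    by (rule extensionalityI[OF hydro_mapsD(1)[OF h]]) (auto simp: compose_def eq)
qed

text \<open>The inverse is a left factor of the identity, hence in the class, and two nonnegative
  capacities with sum zero both vanish.\<close>

lemma hydro_surj_imp_id: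
  assumes h: "h \<in> hydro_maps" and surj: "h ` UHP = UHP"
  shows "h = uhp_id"
proof -
  obtain g where g: "g holomorphic_on h ` UHP" "\<And>z. z \<in> UHP \<Longrightarrow> g (h z) = z"
    using holomorphic_has_inverse[OF hydro_mapsD(2)[OF h] open_UHP hydro_mapsD(3)[OF h]] by metis
  define G where "G = restrict g UHP"
  have Gh: "G (h z) = z" if "z \<in> UHP" for z using g(2)[OF that] hydro_in_UHP[OF h that] by (simp add: G_def)
  have "G holomorphic_on UHP" by (rule holomorphic_transform[of g]) (use g surj in \<open>auto simp: G_def\<close>)
  moreover have "inj_on G UHP"
    by (rule inj_on_inverseI[of _ h]) (metis Gh surj imageE)
  moreover have "G ` UHP \<subseteq> UHP" by (metis Gh surj image_subsetI imageE)
  ultimately have "G \<in> hydro_maps" "uhp_id = compose UHP G h"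
    using hydro_left_factor[OF uhp_id_hydro h, of G] Gh by (auto simp: G_def)
  then have "hcap G + hcap h = 0" using compose_hydro(2)[OF _ h] hcap_uhp_id by metis
  then show ?thesis using hcap_nonneg[OF \<open>G \<in> hydro_maps\<close>] by (intro hcap_0_imp_id h) simp
qed

text \<open>Convergence is known only on \<open>D'\<close>. After the Cayley transform the family is
  bounded, so a subsequence converges on all of \<open>D\<close>. Non-constancy of \<open>l\<close>
  makes Hurwitz's theorem applicable, and the open mapping theorem keeps the limit inside the open
  disc.\<close>

lemma holomorphic_limit_UHP:
  fixes q :: "nat \<Rightarrow> complex \<Rightarrow> complex"
  assumes D: "open D" "connected D" and D': "D' \<subseteq> D" 
    and q: "\<And>n. q n holomorphic_on D" "\<And>n. inj_on (q n) D" "\<And>n. q n ` D \<subseteq> UHP"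
    and lim: "\<And>w. w \<in> D' \<Longrightarrow> (\<lambda>n. q n w) \<longlonglongrightarrow> l w" and l: "l ` D' \<subseteq> UHP"
    and nc: "\<not> l constant_on D'"
  obtains Q where "Q holomorphic_on D" "inj_on Q D" "Q ` D \<subseteq> UHP" "\<And>w. w \<in> D' \<Longrightarrow> Q w = l w"
proof -
  define F where "F = (\<lambda>n. cayley \<circ> q n)"
  have Fhol: "F n holomorphic_on D" for n
    unfolding F_def by (rule holomorphic_on_compose_gen[OF q(1) cayley_hol q(3)])
  have qU: "q n w \<in> UHP" if "w \<in> D" for n w using q(3) that by blast
  have F1: "cmod (F n w) < 1" if "w \<in> D" for n w
    using cayley_in[OF qU[OF that]] by (simp add: F_def)
  have Finj: "inj_on (F n) D" for n
    unfolding F_def by (rule comp_inj_on[OF q(2) inj_on_subset[OF cayley_inj q(3)]])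
  have bdK: "\<exists>B. \<forall>h\<in>range F. \<forall>z\<in>K. cmod (h z) \<le> B" if "compact K" "K \<subseteq> D" for K
    using F1 that by (intro exI[of _ 1]) (auto intro!: less_imp_le)
  obtain g r where gr: "g holomorphic_on D" "strict_mono (r :: nat \<Rightarrow> nat)"
    and ptw: "\<And>x. x \<in> D \<Longrightarrow> ((\<lambda>n. F (r n) x) \<longlongrightarrow> g x) sequentially"
    and unif: "\<And>K. \<lbrakk>compact K; K \<subseteq> D\<rbrakk> \<Longrightarrow> uniform_limit K (F \<circ> r) g sequentially"
    by (rule Montel[where \<F> = F and \<H> = "range F", OF D(1) _ _ order_refl])
      ((use Fhol in blast), (use bdK in blast), (rule that; blast))
  have gl: "g w = cayley (l w)" if w: "w \<in> D'" for w
  proof -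
    have "isCont cayley (l w)"
      using l w holomorphic_on_imp_continuous_on[OF cayley_hol] open_UHP continuous_on_eq_continuous_at by blast
    then have "(\<lambda>n. cayley (q n w)) \<longlonglongrightarrow> cayley (l w)"
      using lim[OF w] by (rule isCont_tendsto_compose)
    then have "(\<lambda>n. F (r n) w) \<longlonglongrightarrow> cayley (l w)"
      using LIMSEQ_subseq_LIMSEQ[OF _ gr(2)] by (fastforce simp: F_def comp_def)
    then show ?thesis using ptw[of w] w D' LIMSEQ_unique by blast
  qed
  have lU: "l w \<in> UHP" if "w \<in> D'" for w using l that by blast
  have gnc: "\<not> g constant_on D"
  proof
    assume "g constant_on D"
    then obtain b where b: "\<And>z. z \<in> D \<Longrightarrow> g z = b" by (auto simp: constant_on_def)
    have "l w = cayley_inv b" if "w \<in> D'" for w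
      using gl[OF that] b[of w] that D' cayley_inv_cayley[OF lU[OF that]] by auto
    then show False using nc by (auto simp: constant_on_def)
  qed
  have ginj: "inj_on g D"
  proof (rule Hurwitz_injective[OF D _ gr(1) unif gnc])
    show "(F \<circ> r) n holomorphic_on D" "inj_on ((F \<circ> r) n) D" for n using Fhol Finj by auto
  qed auto
  have g1: "cmod (g w) \<le> 1" if "w \<in> D" for w
  proof (rule tendsto_le[OF sequentially_bot tendsto_const])
    show "(\<lambda>n. cmod (F (r n) w)) \<longlonglongrightarrow> cmod (g w)" by (intro tendsto_intros ptw that)
    show "\<forall>\<^sub>F n in sequentially. cmod (F (r n) w) \<le> 1" using F1[OF that] by (simp add: less_imp_le)
  qed
  have "open (g ` D)"
    using open_mapping_thm[OF gr(1) D(1,2) D(1) _ gnc] by blast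
  moreover have "g ` D \<subseteq> cball 0 1" using g1 by auto
  ultimately have gb: "g ` D \<subseteq> ball 0 1" 
    using interior_maximal[of "g ` D" "cball 0 1"] by (simp add: interior_cball)
  define Q where "Q = cayley_inv \<circ> g"
  show thesis
  proof (rule that[of Q])
    show "Q holomorphic_on D" unfolding Q_def by (rule holomorphic_on_compose_gen[OF gr(1) cayley_inv_hol gb])
    show "inj_on Q D" unfolding Q_def by (rule comp_inj_on[OF ginj inj_on_subset[OF cayley_inv_inj gb]])
    show "Q ` D \<subseteq> UHP" using gb cayley_inv_in by (auto simp: Q_def simp del: mem_ball)
    show "Q w = l w" if "w \<in> D'" for w
      using gl[OF that] cayley_inv_cayley[OF lU[OF that]] by (simp add: Q_def)
  qed
qed

text \<open>Opening a slit: if \<open>q\<close> omits the point \<open>x\<^sub>0 + \<i> y\<^sub>0\<close> of the half-plane, then with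
  \<open>c = (y\<^sub>0 / 2)\<^sup>2\<close> a branch of the inverse of \<open>u \<mapsto> u - c / u\<close> can be composed with \<open>q - x\<^sub>0\<close>,
  because the branch points of that inverse are \<open>\<plusminus>\<i> y\<^sub>0\<close>; this lowers the half-plane capacity by \<open>c\<close>.\<close>

lemma reduce_hcap:
  assumes h: "h \<in> hydro_maps" and D: "open D" "simply_connected D" "h ` UHP \<subseteq> D"
    and k: "k \<in> hydro_maps" and q: "q holomorphic_on D" "inj_on q D" "q ` D \<subseteq> UHP"
    and kq: "\<And>z. z \<in> UHP \<Longrightarrow> k z = q (h z)"
    and p: "p \<in> UHP" "p \<notin> q ` D"
  obtains k' q' where "k' \<in> hydro_maps" "q' holomorphic_on D" "inj_on q' D" "q' ` D \<subseteq> UHP"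
    "\<And>z. z \<in> UHP \<Longrightarrow> k' z = q' (h z)" "hcap k' < hcap k"
proof -
  define x0 y0 where "x0 = complex_of_real (Re p)" and "y0 = Im p"
  define c where "c = (y0 / 2)\<^sup>2"
  have y0: "y0 > 0" using p by (simp add: y0_def UHP_iff)
  have c: "c > 0" using y0 by (simp add: c_def)
  have qU: "q w \<in> UHP" if "w \<in> D" for w using q that by blast
  \<comment> \<open>Discriminant of \<open>v\<^sup>2 - (q w - x0) * v - c = 0\<close>. It vanishes
    exactly where \<open>q w\<close> is \<open>p\<close> or its conjugate: the first value is
    omitted, the second lies below the real line.\<close>
  define F where "F = (\<lambda>w. (q w - x0)\<^sup>2 + 4 * of_real c)"
  have "F w \<noteq> 0" if w: "w \<in> D" for w
  proof
    assume "F w = 0"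
    then have "(q w - x0)\<^sup>2 = (\<i> * of_real y0)\<^sup>2"
      by (simp add: F_def c_def power_mult_distrib power_divide add_eq_0_iff)
    then consider "q w - x0 = \<i> * of_real y0" | "q w - x0 = - (\<i> * of_real y0)"
      using power2_eq_iff by blast
    then show False
    proof cases
      case 1
      then have "q w = p" by (simp add: complex_eq_iff x0_def y0_def)
      then show False using p w by blast
    next
      case 2
      then have "Im (q w) = - y0" by (auto simp: complex_eq_iff x0_def)
      then show False using qU[OF w] y0 by (simp add: UHP_iff)
    qed
  qed
  moreover have "F holomorphic_on D" unfolding F_def by (intro holomorphic_intros q)
  ultimately obtain r where r: "r holomorphic_on D" "\<And>w. w \<in> D \<Longrightarrow> F w = (r w)\<^sup>2"
    using simply_connected_eq_holomorphic_sqrt[OF D(1)] D(2) by blast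
  define u where "u = (\<lambda>\<sigma>::real. \<lambda>w. ((q w - x0) + of_real \<sigma> * r w) / 2)"
  define y where "y = (\<lambda>n. real (Suc n))"
  have y: "filterlim y at_top sequentially" unfolding y_def by (rule filterlim_real_Suc)
  have yU: "\<i> * y n \<in> UHP" for n by (simp add: UHP_iff y_def)
  have hD: "h z \<in> D" if "z \<in> UHP" for z using D(3) that by blast
  \<comment> \<open>The roots \<open>u 1\<close> and \<open>u (-1)\<close> have sum
    \<open>q w - x0\<close>, and the one that is large at infinity is wanted. At each height one of
    them carries at least half the modulus, so some sign works at infinitely many heights, which is
    enough for \<open>hydroI_seq\<close>.\<close>
  have large: "cmod (q w - x0) / 2 \<le> cmod (u 1 w) \<or> cmod (q w - x0) / 2 \<le> cmod (u (-1) w)" for w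
  proof -
    have "q w - x0 = u 1 w + u (-1) w" by (simp add: u_def field_simps)
    then have "cmod (q w - x0) \<le> cmod (u 1 w) + cmod (u (-1) w)" by (metis norm_triangle_ineq)
    then show ?thesis by linarith
  qed
  define A where "A = (\<lambda>\<sigma>. {n. cmod (q (h (\<i> * y n)) - x0) / 2 \<le> cmod (u \<sigma> (h (\<i> * y n)))})"
  have "A 1 \<union> A (-1) = UNIV" unfolding A_def using large by blast
  then have "infinite (A 1) \<or> infinite (A (-1))"
    by (metis finite_Un infinite_UNIV_nat)
  then obtain \<sigma> where \<sigma>: "\<sigma>\<^sup>2 = 1" and inf: "infinite (A \<sigma>)"
    by (metis one_power2 power2_minus)
  obtain s where s: "strict_mono (s :: nat \<Rightarrow> nat)"
    "\<And>n. cmod (q (h (\<i> * y (s n))) - x0) / 2 \<le> cmod (u \<sigma> (h (\<i> * y (s n))))"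
    using infinite_enumerate[OF inf] by (auto simp: A_def)
  define v where "v = u \<sigma>"
  have vq: "v w \<noteq> 0" "q w - x0 = v w - c / v w" if w: "w \<in> D" for w
  proof -
    have "2 * v w - (q w - x0) = of_real \<sigma> * r w"
      by (simp add: v_def u_def field_simps)
    then have "(2 * v w - (q w - x0))\<^sup>2 = (of_real \<sigma>)\<^sup>2 * (r w)\<^sup>2"
      by (simp only: power_mult_distrib)
    also have "\<dots> = F w" using r(2)[OF w] \<sigma> by (simp flip: of_real_power)
    finally have "4 * (v w * v w - (q w - x0) * v w) = 4 * complex_of_real c"
      unfolding F_def by (simp add: power2_eq_square algebra_simps)
    then have e: "v w * v w - (q w - x0) * v w = c"
      by (metis mult_left_cancel zero_neq_numeral)
    then show "v w \<noteq> 0" using c by auto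
    then show "q w - x0 = v w - c / v w" using e by (simp add: field_simps)
  qed
  \<comment> \<open>\<open>v \<mapsto> v - c / v\<close> multiplies the imaginary part by a positive
    factor, so \<open>v\<close> inherits its sign from \<open>q\<close>.\<close>
  have Imv: "Im (v w) > 0" if w: "w \<in> D" for w
  proof -
    have "Im (q w) = Im (v w - c / v w)" using vq(2)[OF w] by (metis Im_complex_of_real diff_zero minus_complex.simps(2) x0_def)
    also have "\<dots> = Im (v w) * (1 + c / (cmod (v w))\<^sup>2)"
      by (simp add: Im_divide cmod_power2 field_simps)
    finally have "Im (v w) * (1 + c / (cmod (v w))\<^sup>2) > 0" using qU[OF w] by (simp add: UHP_iff)
    moreover have "1 + c / (cmod (v w))\<^sup>2 > 0" using c by (intro add_pos_nonneg) auto
    ultimately show ?thesis by (simp add: zero_less_mult_iff)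
  qed
  define q' where "q' = (\<lambda>w. x0 + v w)"
  have q'hol: "q' holomorphic_on D" unfolding q'_def v_def u_def by (intro holomorphic_intros q r) auto
  have q'inj: "inj_on q' D"
  proof (rule inj_onI)
    fix a b assume ab: "a \<in> D" "b \<in> D" "q' a = q' b"
    then have "v a = v b" by (simp add: q'_def)
    then have "q a = q b" using vq(2)[OF ab(1)] vq(2)[OF ab(2)] by (metis diff_add_cancel)
    then show "a = b" using q(2) ab by (meson inj_onD)
  qed
  have q'U: "q' ` D \<subseteq> UHP" using Imv by (auto simp: q'_def x0_def UHP_iff)
  define k' where "k' = restrict (q' \<circ> h) UHP"
  have k'q: "k' z = q' (h z)" if "z \<in> UHP" for z using that by (simp add: k'_def)
  note kD = hydro_mapsD[OF k] and hh = hydro_mapsD[OF h]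
  have ys: "filterlim (\<lambda>n. y (s n)) at_top sequentially"
    using filterlim_compose[OF y filterlim_subseq[OF s(1)]] .
  have k': "k' \<in> hydro_maps"
  proof (rule hydroI_seq(1)[OF _ _ _ _ ys, of _ "\<lambda>n. \<i> * y (s n)" 0 "hcap k + 2 * c"])
    show "k' \<in> extensional UHP" by (simp add: k'_def)
    show "inj_on k' UHP"
      using comp_inj_on[OF hh(3) inj_on_subset[OF q'inj D(3)]] by (simp add: k'_def inj_on_def)
    have "(q' \<circ> h) holomorphic_on UHP" by (rule holomorphic_on_compose_gen[OF hh(2) q'hol D(3)])
    then show "k' holomorphic_on UHP" by (rule holomorphic_transform) (simp add: k'_def)
    show "k' ` UHP \<subseteq> UHP" using q'U hD by (auto simp: k'q)
    fix n
    show "\<i> * y (s n) \<in> UHP" by (rule yU)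
    show "cmod (\<i> * y (s n) - \<i> * y (s n)) \<le> 0" by simp
    define Y where "Y = y (s n)"
    define z where "z = \<i> * complex_of_real Y"
    have zU: "z \<in> UHP" unfolding z_def Y_def by (rule yU)
    have Y0: "Y > 0" by (simp add: Y_def y_def)
    \<comment> \<open>Since \<open>Im (k z) \<ge> Im z\<close>, the root has modulus at least
      \<open>Y / 2\<close> at the chosen heights. The correction \<open>c / v\<close> is then at
      most \<open>2 * c / Y\<close> in modulus, which explains the bound
      \<open>hcap k + 2 * c\<close>.\<close>
    have "Y \<le> Im (k z)" using hydro_strong(1)[OF k zU] by (simp add: z_def)
    also have "\<dots> = Im (q (h z) - x0)" by (simp add: kq[OF zU] x0_def)
    also have "\<dots> \<le> cmod (q (h z) - x0)" using abs_Im_le_cmod[of "q (h z) - x0"] by simp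
    finally have "Y / 2 \<le> cmod (v (h z))" using s(2)[of n] unfolding v_def z_def Y_def by linarith
    then have "c / cmod (v (h z)) \<le> c / (Y / 2)" using Y0 c by (intro divide_left_mono mult_pos_pos) auto
    then have "c / cmod (v (h z)) * Y \<le> c / (Y / 2) * Y" using Y0 by (intro mult_right_mono) auto
    then have b: "c / cmod (v (h z)) * Y \<le> 2 * c" using Y0 by simp
    have k'z: "k' z - z = (k z - z) + c / v (h z)"
      using vq(2)[OF hD[OF zU]] by (simp add: k'q[OF zU] kq[OF zU] q'_def algebra_simps)
    have "cmod (k' z - z) \<le> cmod (k z - z) + c / cmod (v (h z))"
      unfolding k'z using norm_triangle_ineq[of "k z - z" "c / v (h z)"] c by (simp add: norm_divide)
    then have "cmod (k' z - z) * Y \<le> (cmod (k z - z) + c / cmod (v (h z))) * Y"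
      using Y0 by (intro mult_right_mono) auto
    also have "\<dots> = cmod (k z - z) * Im z + c / cmod (v (h z)) * Y" by (simp add: distrib_right z_def)
    also have "\<dots> \<le> hcap k + 2 * c" using hcap_upper[OF k zU] b by linarith
    finally show "cmod (k' (\<i> * y (s n)) - \<i> * y (s n)) * y (s n) \<le> hcap k + 2 * c"
      by (simp add: z_def Y_def)
  qed
  have l1: "(\<lambda>n. \<i> * y n * (\<i> * y n - k (\<i> * y n))) \<longlonglongrightarrow> of_real (hcap k)"
    by (rule hcap_seq[OF k y, of _ 0]) (auto simp: yU)
  have l2: "(\<lambda>n. \<i> * y n * (\<i> * y n - k' (\<i> * y n))) \<longlonglongrightarrow> of_real (hcap k')"
    by (rule hcap_seq[OF k' y, of _ 0]) (auto simp: yU)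
  have inv: "(\<lambda>n. 1 / y n) \<longlonglongrightarrow> 0"
    by (rule tendsto_divide_0[OF tendsto_const filterlim_at_top_imp_at_infinity[OF y]])
  have y0': "y n \<noteq> 0" for n by (simp add: y_def)
  \<comment> \<open>Now that \<open>k'\<close> is known to be normalized,
    \<open>v (h (\<i> * y))\<close> is asymptotic to \<open>\<i> * y\<close> along the full
    sequence, so the term \<open>c / v\<close> accounts for exactly \<open>c\<close> in the
    capacity.\<close>
  have l3: "(\<lambda>n. v (h (\<i> * y n)) / (\<i> * y n)) \<longlonglongrightarrow> 1"
  proof -
    have "(\<lambda>n. 1 + (\<i> * y n * (\<i> * y n - k' (\<i> * y n))) * (of_real (1 / y n))\<^sup>2 + \<i> * x0 * of_real (1 / y n))
      \<longlonglongrightarrow> 1 + of_real (hcap k') * (of_real 0)\<^sup>2 + \<i> * x0 * of_real 0"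
      by (intro tendsto_intros l2 inv)
    moreover have "1 + (\<i> * y n * (\<i> * y n - k' (\<i> * y n))) * (of_real (1 / y n))\<^sup>2 + \<i> * x0 * of_real (1 / y n)
      = v (h (\<i> * y n)) / (\<i> * y n)" for n
      using y0'[of n] by (simp add: k'q[OF yU] q'_def field_simps power2_eq_square)
    ultimately show ?thesis by simp
  qed
  have "(\<lambda>n. \<i> * y n * (\<i> * y n - k' (\<i> * y n)) + c / (v (h (\<i> * y n)) / (\<i> * y n))) \<longlonglongrightarrow> complex_of_real (hcap k') + complex_of_real c / 1"
    by (intro tendsto_intros l2 l3) auto
  moreover have "\<i> * y n * (\<i> * y n - k' (\<i> * y n)) + c / (v (h (\<i> * y n)) / (\<i> * y n)) = \<i> * y n * (\<i> * y n - k (\<i> * y n))" for n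
  proof -
    have "k (\<i> * y n) = k' (\<i> * y n) - c / v (h (\<i> * y n))"
      using vq(2)[OF hD[OF yU[of n]]] by (simp add: k'q[OF yU] kq[OF yU] q'_def algebra_simps)
    then show ?thesis by (simp only:) (simp add: algebra_simps)
  qed
  ultimately have "(\<lambda>n. \<i> * y n * (\<i> * y n - k (\<i> * y n))) \<longlonglongrightarrow> complex_of_real (hcap k' + c)"
    by simp
  then have "complex_of_real (hcap k) = complex_of_real (hcap k' + c)"
    using l1 LIMSEQ_unique by blast
  then have "hcap k = hcap k' + c" by (simp only: of_real_eq_iff)
  then have "hcap k' < hcap k" using c by simp
  then show thesis using that[of k' q'] k' q'hol q'inj q'U k'q by blast
qed

text \<open>Provides a conformal map onto \<open>D\<close> normalized at infinity. Capacity is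
  measured on the composite \<open>k = q \<circ> h\<close> because \<open>q\<close> is defined only
  on \<open>D\<close>.\<close>

lemma hydro_onto_domain:
  assumes h: "h \<in> hydro_maps" and D: "open D" "simply_connected D" "h ` UHP \<subseteq> D" "D \<subseteq> UHP"
  obtains g k where "g \<in> hydro_maps" "k \<in> hydro_maps" "h = compose UHP g k" "g ` UHP = D"
proof -
  define \<K> where "\<K> = {k \<in> hydro_maps. \<exists>q. q holomorphic_on D \<and> inj_on q D \<and> q ` D \<subseteq> UHP \<and> (\<forall>z\<in>UHP. k z = q (h z))}"
  have conD: "connected D" by (rule simply_connected_imp_connected[OF D(2)])
  have hK: "h \<in> \<K>"
    unfolding \<K>_def using h D by (auto intro!: exI[of _ "\<lambda>z. z"])
  define c where "c = (INF k\<in>\<K>. hcap k)"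
  have bdd: "bdd_below (hcap ` \<K>)"
    by (rule bdd_belowI2[of _ 0]) (auto simp: \<K>_def hcap_nonneg)
  have "\<exists>k\<in>\<K>. hcap k < c + 1 / Suc n" for n
    using cINF_less_iff[OF _ bdd, of "c + 1 / Suc n"] hK unfolding c_def by auto
  then obtain k where k: "\<And>n. k n \<in> \<K>" "\<And>n. hcap (k n) < c + 1 / Suc n" by metis
  have "(\<lambda>n. c + 1 / real (Suc n)) \<longlonglongrightarrow> c + 0"
    by (intro tendsto_intros LIMSEQ_Suc[OF lim_1_over_n])
  then have lim: "(\<lambda>n. c + 1 / real (Suc n)) \<longlonglongrightarrow> c" by simp
  have kh: "k n \<in> hydro_maps" for n using k(1)[of n] by (simp add: \<K>_def)
  obtain r K where r: "strict_mono (r :: nat \<Rightarrow> nat)" and K: "K \<in> hydro_maps" "hcap K \<le> c"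
    and ptw: "\<And>z. z \<in> UHP \<Longrightarrow> (\<lambda>n. k (r n) z) \<longlonglongrightarrow> K z"
    using hydro_compact[OF kh less_imp_le[OF k(2)] lim] by blast
  have "\<exists>q. q holomorphic_on D \<and> inj_on q D \<and> q ` D \<subseteq> UHP \<and> (\<forall>z\<in>UHP. k n z = q (h z))" for n
    using k(1)[of n] by (simp add: \<K>_def)
  then obtain q where q: "\<And>n. q n holomorphic_on D" "\<And>n. inj_on (q n) D" "\<And>n. q n ` D \<subseteq> UHP"
    and kq: "\<And>n z. z \<in> UHP \<Longrightarrow> k n z = q n (h z)" by metis
  \<comment> \<open>The limit of the maps \<open>q (r n)\<close>, so far known only on the image of
    \<open>h\<close>; \<open>holomorphic_limit_UHP\<close> extends it to \<open>D\<close>.\<close>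
  define l where "l = (\<lambda>w. K (inv_into UHP h w))"
  have lh: "l (h z) = K z" if "z \<in> UHP" for z
    using that hydro_mapsD(3)[OF h] by (simp add: l_def)
  obtain Q where Q: "Q holomorphic_on D" "inj_on Q D" "Q ` D \<subseteq> UHP" "\<And>w. w \<in> h ` UHP \<Longrightarrow> Q w = l w"
  proof (rule holomorphic_limit_UHP[OF D(1) conD D(3), of "\<lambda>n. q (r n)" l])
    show "(\<lambda>n. q (r n) w) \<longlonglongrightarrow> l w" if "w \<in> h ` UHP" for w
      using that ptw kq lh by auto
    show "l ` h ` UHP \<subseteq> UHP" using lh hydro_in_UHP[OF K(1)] by auto
    show "\<not> l constant_on h ` UHP"
    proof
      assume "l constant_on h ` UHP"
      then obtain b where "\<And>z. z \<in> UHP \<Longrightarrow> K z = b" using lh by (auto simp: constant_on_def)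
      then have "K (\<i> * of_real 1) = K (\<i> * of_real 2)" using ii_UHP[of 1] ii_UHP[of 2] by simp
      then have "\<i> * of_real 1 = \<i> * complex_of_real 2"
        by (rule inj_onD[OF hydro_mapsD(3)[OF K(1)]]) (auto simp: UHP_iff)
      then show False by simp
    qed
  qed (use q in auto)
  have KQ: "K z = Q (h z)" if "z \<in> UHP" for z using Q(4) lh that by simp
  have onto: "Q ` D = UHP"
  proof (rule ccontr)
    assume "Q ` D \<noteq> UHP"
    then obtain p where p: "p \<in> UHP" "p \<notin> Q ` D" using Q(3) by blast
    obtain k' q' where k': "k' \<in> hydro_maps" "q' holomorphic_on D" "inj_on q' D" "q' ` D \<subseteq> UHP"
      "\<And>z. z \<in> UHP \<Longrightarrow> k' z = q' (h z)" "hcap k' < hcap K"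
      using reduce_hcap[OF h D(1-3) K(1) Q(1-3) KQ p] by metis
    then have "k' \<in> \<K>" unfolding \<K>_def by blast
    then have "c \<le> hcap k'" unfolding c_def by (rule cINF_lower[OF bdd])
    then show False using k'(6) K(2) by simp
  qed
  obtain g where g: "g holomorphic_on Q ` D" "\<And>z. z \<in> D \<Longrightarrow> g (Q z) = z"
    using holomorphic_has_inverse[OF Q(1) D(1) Q(2)] by metis
  define G where "G = restrict g UHP"
  have GQ: "G (Q w) = w" if "w \<in> D" for w
    using g(2)[OF that] that onto by (auto simp: G_def)
  have GD: "G ` UHP = D" unfolding onto[symmetric] image_image by (simp add: GQ)
  have "G holomorphic_on UHP" by (rule holomorphic_transform[of g]) (use g onto in \<open>auto simp: G_def\<close>)
  note Ghol = this
  have Ginj: "inj_on G UHP"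
    unfolding onto[symmetric] by (rule inj_on_inverseI[of _ Q]) (auto simp: GQ)
  have Gext: "G \<in> extensional UHP" by (simp add: G_def)
  have GU: "G ` UHP \<subseteq> UHP" using GD D(4) by simp
  have hG: "h z = G (K z)" if "z \<in> UHP" for z
    using KQ[OF that] GQ[of "h z"] D(3) that by auto
  note hydro_left_factor[OF h K(1) Gext Ghol Ginj GU hG]
  then show thesis using that[of G K] K GD by simp
qed

text \<open>\<open>g\<close> is nontrivial because its image \<open>D\<close> is not the half-plane,
  and \<open>k\<close> because the image of \<open>h\<close> is not \<open>D\<close>.\<close>

theorem hydro_decomposition:
  assumes h: "h \<in> hydro_maps" and "h \<noteq> uhp_id"
  obtains g k where "g \<in> hydro_maps" "k \<in> hydro_maps" "h = compose UHP g k" "0 < hcap g" "0 < hcap k"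
proof -
  note hh = hydro_mapsD[OF h]
  have "h ` UHP \<subset> UHP" using hydro_surj_imp_id[OF h] assms(2) hh(4) by blast
  then obtain D where D: "open D" "connected D" "simply_connected D" "h ` UHP \<subset> D" "D \<subset> UHP"
    using intermediate_simply_connected_UHP[OF hh(2,3)] by metis
  obtain g k where gk: "g \<in> hydro_maps" "k \<in> hydro_maps" "h = compose UHP g k" "g ` UHP = D"
    using hydro_onto_domain[OF h D(1,3)] D by (metis psubset_imp_subset)
  have "uhp_id ` UHP = UHP" by simp
  then have "g \<noteq> uhp_id" using gk D by auto
  moreover have "k \<noteq> uhp_id"
  proof
    assume "k = uhp_id"
    then have "h ` UHP = g ` UHP" unfolding gk(3) by (simp add: compose_def)
    then show False using gk D by blast
  qed
  ultimately have "0 < hcap g" "0 < hcap k"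
    using hcap_0_imp_id gk not_le by blast+
  then show thesis using that gk by blast
qed

section \<open>Maximal chains\<close>

text \<open>Schwarz-Pick acts as equicontinuity: convergence at the fixed point \<open>b\<close>
  carries over to the moving points \<open>u n\<close>, as limits of compositions require.\<close>

lemma compose_limit:
  assumes G: "\<And>n::nat. G n \<in> hydro_maps" and u: "\<And>n. u n \<in> UHP" "u \<longlonglongrightarrow> b" "b \<in> UHP"
    and g: "(\<lambda>n. G n b) \<longlonglongrightarrow> g" and f: "(\<lambda>n. G n (u n)) \<longlonglongrightarrow> f"
  shows "f = g"
proof -
  have "(\<lambda>n. (cmod (G n (u n) - G n b))\<^sup>2 * Im (u n) * Im b) \<longlonglongrightarrow> (cmod (f - g))\<^sup>2 * Im b * Im b"
    by (intro tendsto_intros assms)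
  moreover have "(\<lambda>n. (cmod (u n - b))\<^sup>2 * Im (G n (u n)) * Im (G n b)) \<longlonglongrightarrow> (cmod (b - b))\<^sup>2 * Im f * Im g"
    by (intro tendsto_intros assms)
  moreover have "(cmod (G n (u n) - G n b))\<^sup>2 * Im (u n) * Im b \<le> (cmod (u n - b))\<^sup>2 * Im (G n (u n)) * Im (G n b)" for n
    using Schwarz_Pick_UHP[OF hydro_mapsD(2,4)[OF G] u(1,3)] .
  ultimately have "(cmod (f - g))\<^sup>2 * Im b * Im b \<le> (cmod (b - b))\<^sup>2 * Im f * Im g"
    by (intro LIMSEQ_le) auto
  moreover have "Im b > 0" using u by (simp add: UHP_iff)
  ultimately show "f = g" by (simp add: mult_le_0_iff)
qed

lemma subord_refl: "f \<in> hydro_maps \<Longrightarrow> subord f f"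
  unfolding subord_def using uhp_id_hydro
  by (intro bexI[of _ uhp_id] extensionalityI[of _ UHP]) (auto simp: compose_def hydro_mapsD)

lemma subord_uhp_id: "f \<in> hydro_maps \<Longrightarrow> subord f uhp_id"
  unfolding subord_def
  by (intro bexI[of _ f] extensionalityI[of _ UHP]) (auto simp: compose_def hydro_mapsD hydro_in_UHP)

lemma compose_assoc_hydro:
  assumes "f \<in> hydro_maps" "g \<in> hydro_maps" "h \<in> hydro_maps"
  shows "compose UHP (compose UHP f g) h = compose UHP f (compose UHP g h)"
  using hydro_in_UHP[OF assms(3)] by (auto simp: compose_def fun_eq_iff restrict_def)

lemma subord_trans:
  assumes "f \<in> hydro_maps" "g \<in> hydro_maps" "h \<in> hydro_maps" "subord f g" "subord g h"
  shows "subord f h"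
proof -
  obtain a b where ab: "a \<in> hydro_maps" "f = compose UHP g a" "b \<in> hydro_maps" "g = compose UHP h b"
    using assms by (auto simp: subord_def)
  then have "f = compose UHP h (compose UHP b a)" using compose_assoc_hydro assms(3) by metis
  then show ?thesis unfolding subord_def using compose_hydro(1)[OF ab(3,1)] by blast
qed

lemma subord_hcap:
  assumes "f \<in> hydro_maps" "g \<in> hydro_maps" "subord f g"
  obtains k where "k \<in> hydro_maps" "f = compose UHP g k" "hcap k = hcap f - hcap g"
  using assms compose_hydro(2)[OF assms(2)] unfolding subord_def by force

lemma subord_hcap_le: "f \<in> hydro_maps \<Longrightarrow> g \<in> hydro_maps \<Longrightarrow> subord f g \<Longrightarrow> hcap g \<le> hcap f"
  by (metis subord_hcap diff_ge_0_iff_ge hcap_nonneg)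

lemma subord_hcap_eq:
  assumes "f \<in> hydro_maps" "g \<in> hydro_maps" "subord f g" "hcap f = hcap g"
  shows "f = g"
proof -
  obtain k where k: "k \<in> hydro_maps" "f = compose UHP g k" "hcap k = hcap f - hcap g"
    using subord_hcap[OF assms(1-3)] .
  then have "k = uhp_id" using hcap_0_imp_id assms by simp
  then show ?thesis using k(2) assms(2)
    by (intro extensionalityI[of f UHP g]) (auto simp: compose_def hydro_mapsD)
qed

text \<open>The order reverses capacity, so a chain is sorted by it. The third fact is maximality in
  the form in which new members are produced.\<close>

lemma Loewner_familyD:
  assumes "chordal_Loewner_family F"
  shows "F \<subseteq> hydro_maps"
    and "\<And>f g. f \<in> F \<Longrightarrow> g \<in> F \<Longrightarrow> hcap f \<le> hcap g \<Longrightarrow> subord g f"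
    and "\<And>g. g \<in> hydro_maps \<Longrightarrow> (\<And>f. f \<in> F \<Longrightarrow> subord f g \<or> subord g f) \<Longrightarrow> g \<in> F"
proof -
  have mc: "pred_on.maxchain hydro_maps subord F" using assms by (simp add: chordal_Loewner_family_def)
  then have ch: "pred_on.chain hydro_maps subord F" by (simp add: pred_on.maxchain_def)
  show 1: "F \<subseteq> hydro_maps" using ch by (simp add: pred_on.chain_def)
  have tot: "subord f g \<or> subord g f" if "f \<in> F" "g \<in> F" for f g
    using pred_on.chain_total[OF ch that] subord_refl 1 that by auto
  show "subord g f" if "f \<in> F" "g \<in> F" "hcap f \<le> hcap g" for f g
  proof (cases "subord g f")
    case False
    then have s: "subord f g" using tot that by blast
    then have "hcap f = hcap g" using subord_hcap_le[of f g] 1 that by force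
    then have "f = g" using subord_hcap_eq s 1 that by blast
    then show ?thesis using s by simp
  qed
  show "g \<in> F" if g: "g \<in> hydro_maps" "\<And>f. f \<in> F \<Longrightarrow> subord f g \<or> subord g f" for g
  proof (rule ccontr)
    assume "g \<notin> F"
    moreover have "pred_on.chain hydro_maps subord (insert g F)"
      unfolding pred_on.chain_def using g 1 tot subord_refl[OF g(1)] by blast
    ultimately show False using mc unfolding pred_on.maxchain_def by blast
  qed
qed

lemma Loewner_family_eqI:
  assumes F: "chordal_Loewner_family F" and "f \<in> F" "g \<in> F" "hcap f = hcap g"
  shows "f = g"
proof -
  have R: "f \<in> hydro_maps" "g \<in> hydro_maps" using Loewner_familyD(1)[OF F] assms by blast+
  have "subord g f" by (rule Loewner_familyD(2)[OF F assms(2,3)]) (simp add: assms(4))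
  then show ?thesis using subord_hcap_eq[OF R(2,1)] assms(4) by simp
qed

lemma Loewner_family_id:
  assumes F: "chordal_Loewner_family F" shows "uhp_id \<in> F"
  by (rule Loewner_familyD(3)[OF F uhp_id_hydro]) (use Loewner_familyD(1)[OF F] subord_uhp_id in blast)

text \<open>Capacity is only lower semicontinuous under pointwise limits. For decreasing capacities the
  limit \<open>g\<close> still has full capacity, because a fixed \<open>e = g \<circ> k\<close> of the chain bounds it from below.\<close>

lemma Loewner_family_closed:
  assumes F: "chordal_Loewner_family F" and f: "\<And>n::nat. f n \<in> F" and lim: "(\<lambda>n. hcap (f n)) \<longlonglongrightarrow> a"
  shows "\<exists>g\<in>F. hcap g = a"
proof (rule ccontr)
  assume no: "\<not> ?thesis"
  have FR: "e \<in> hydro_maps" if "e \<in> F" for e using Loewner_familyD(1)[OF F] that by blast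
  obtain r g where r: "strict_mono (r :: nat \<Rightarrow> nat)" and g: "g \<in> hydro_maps" "hcap g \<le> a"
    and ptw: "\<And>z. z \<in> UHP \<Longrightarrow> (\<lambda>n. f (r n) z) \<longlonglongrightarrow> g z"
    using hydro_compact[OF FR[OF f] order_refl lim] by blast
  have limr: "(\<lambda>n. hcap (f (r n))) \<longlonglongrightarrow> a" using LIMSEQ_subseq_LIMSEQ[OF lim r] by (simp add: comp_def)
  \<comment> \<open>Almost all \<open>f (r n)\<close> have the form \<open>e\<close> after some
    \<open>k n\<close>; a limit \<open>K\<close> of these right factors exhibits \<open>g\<close> as
    \<open>e\<close> after \<open>K\<close>.\<close>
  have below: "subord g e \<and> hcap e \<le> hcap g" if e: "e \<in> F" "hcap e < a" for e
  proof -
    obtain N where N: "\<And>n. n \<ge> N \<Longrightarrow> hcap e < hcap (f (r n))"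
      using order_tendstoD(1)[OF limr e(2)] by (auto simp: eventually_sequentially)
    have "subord (f (r (n + N))) e" for n
      using Loewner_familyD(2)[OF F e(1) f] N[of "n + N"] by simp
    then have "\<exists>k. k \<in> hydro_maps \<and> f (r (n + N)) = compose UHP e k \<and> hcap k = hcap (f (r (n + N))) - hcap e" for n
      using subord_hcap[OF FR[OF f] FR[OF e(1)]] by metis
    then obtain k where k: "\<And>n. k n \<in> hydro_maps" "\<And>n. f (r (n + N)) = compose UHP e (k n)"
      "\<And>n. hcap (k n) = hcap (f (r (n + N))) - hcap e" by metis
    have "(\<lambda>n. hcap (f (r (n + N))) - hcap e) \<longlonglongrightarrow> a - hcap e"
      by (intro tendsto_intros LIMSEQ_ignore_initial_segment[OF limr])
    then obtain s K where s: "strict_mono (s :: nat \<Rightarrow> nat)" and K: "K \<in> hydro_maps"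
      and kK: "\<And>z. z \<in> UHP \<Longrightarrow> (\<lambda>n. k (s n) z) \<longlonglongrightarrow> K z"
      using hydro_compact[where a = "\<lambda>n. hcap (f (r (n + N))) - hcap e", OF k(1) eq_refl[OF k(3)]] by blast
    have "g z = e (K z)" if z: "z \<in> UHP" for z
    proof (rule compose_limit[of "\<lambda>n. e" "\<lambda>n. k (s n) z" "K z"])
      have "(\<lambda>n. f (r (s n + N)) z) \<longlonglongrightarrow> g z"
        using LIMSEQ_subseq_LIMSEQ[OF LIMSEQ_ignore_initial_segment[OF ptw[OF z]] s] by (simp add: comp_def)
      then show "(\<lambda>n. e (k (s n) z)) \<longlonglongrightarrow> g z" using z by (simp add: k(2) compose_def)
    qed (use FR[OF e(1)] k(1) K hydro_in_UHP z kK in auto)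
    then have "g = compose UHP e K"
      by (intro extensionalityI[OF hydro_mapsD(1)[OF g(1)]]) (auto simp: compose_def)
    then have "subord g e" using K by (auto simp: subord_def)
    then show ?thesis using subord_hcap_le[OF g(1) FR[OF e(1)]] by simp
  qed
  \<comment> \<open>Here the left factors vary and tend to \<open>g\<close>. Since
    \<open>hcap K \<le> hcap e - a\<close>, additivity forces \<open>hcap g \<ge> a\<close>, which
    excludes a loss of capacity.\<close>
  have above: "subord e g \<and> a \<le> hcap g" if e: "e \<in> F" "a < hcap e" for e
  proof -
    obtain N where N: "\<And>n. n \<ge> N \<Longrightarrow> hcap (f (r n)) < hcap e"
      using order_tendstoD(2)[OF limr e(2)] by (auto simp: eventually_sequentially)
    have "subord e (f (r (n + N)))" for n
      using Loewner_familyD(2)[OF F f e(1)] N[of "n + N"] by simp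
    then have "\<exists>k. k \<in> hydro_maps \<and> e = compose UHP (f (r (n + N))) k \<and> hcap k = hcap e - hcap (f (r (n + N)))" for n
      using subord_hcap[OF FR[OF e(1)] FR[OF f]] by metis
    then obtain k where k: "\<And>n. k n \<in> hydro_maps" "\<And>n. e = compose UHP (f (r (n + N))) (k n)"
      "\<And>n. hcap (k n) = hcap e - hcap (f (r (n + N)))" by metis
    have "(\<lambda>n. hcap e - hcap (f (r (n + N)))) \<longlonglongrightarrow> hcap e - a"
      by (intro tendsto_intros LIMSEQ_ignore_initial_segment[OF limr])
    then obtain s K where s: "strict_mono (s :: nat \<Rightarrow> nat)" and K: "K \<in> hydro_maps" "hcap K \<le> hcap e - a"
      and kK: "\<And>z. z \<in> UHP \<Longrightarrow> (\<lambda>n. k (s n) z) \<longlonglongrightarrow> K z"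
      using hydro_compact[where a = "\<lambda>n. hcap e - hcap (f (r (n + N)))", OF k(1) eq_refl[OF k(3)]] by blast
    have "e z = g (K z)" if z: "z \<in> UHP" for z
    proof (rule compose_limit[of "\<lambda>n. f (r (s n + N))" "\<lambda>n. k (s n) z" "K z"])
      show "(\<lambda>n. f (r (s n + N)) (K z)) \<longlonglongrightarrow> g (K z)"
        using LIMSEQ_subseq_LIMSEQ[OF LIMSEQ_ignore_initial_segment[OF ptw[OF hydro_in_UHP[OF K(1) z]]] s] by (simp add: comp_def)
      have "f (r (s n + N)) (k (s n) z) = e z" for n using k(2)[of "s n"] z by (metis compose_eq)
      then show "(\<lambda>n. f (r (s n + N)) (k (s n) z)) \<longlonglongrightarrow> e z" by simp
    qed (use FR[OF f] k(1) K hydro_in_UHP z kK in auto)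
    then have eq: "e = compose UHP g K"
      by (intro extensionalityI[OF hydro_mapsD(1)[OF FR[OF e(1)]]]) (auto simp: compose_def)
    then have "hcap e = hcap g + hcap K" using compose_hydro(2)[OF g(1) K(1)] by simp
    then show ?thesis using eq K by (auto simp: subord_def)
  qed
  have ne: "hcap e \<noteq> a" if "e \<in> F" for e using no that by blast
  have "g \<in> F"
    using Loewner_familyD(3)[OF F g(1)] above below ne by (metis linorder_cases)
  \<comment> \<open>A member above \<open>a\<close> would now contradict \<open>above\<close>, so
    every \<open>f n\<close> has capacity below \<open>a\<close>, hence at most
    \<open>hcap g\<close> by \<open>below\<close>. In the limit \<open>a \<le> hcap g\<close>, a
    contradiction.\<close>
  then have ga: "hcap g < a" using ne g(2) by force
  then have "hcap (f n) < a" for n using above[OF f] ne[OF f] by (metis linorder_cases not_le)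
  then have "hcap (f n) \<le> hcap g" for n using below[OF f] by blast
  then have "a \<le> hcap g" by (intro LIMSEQ_le_const2[OF lim]) auto
  then show False using ga by simp
qed

text \<open>Used to prolong a chain of bounded capacity. For \<open>z - 1 / (z + \<i>)\<close> equal
  values at distinct \<open>a\<close> and \<open>b\<close> would need
  \<open>(a + \<i>) * (b + \<i>) = -1\<close>, impossible as both factors have modulus above
  1.\<close>

lemma ex_hydro_pos: "\<exists>e\<in>hydro_maps. hcap e > 0"
proof -
  define e where "e = restrict (\<lambda>z. z - 1 / (z + \<i>)) UHP"
  have im: "Im (1 / (z + \<i>)) < 0" if "z \<in> UHP" for z
    using that by (auto simp: Im_divide UHP_iff intro!: divide_neg_pos add_nonneg_pos)
  have big: "cmod (z + \<i>) > 1" if "z \<in> UHP" for z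
    using abs_Im_le_cmod[of "z + \<i>"] that by (auto simp: UHP_iff)
  have "e \<in> hydro_maps"
  proof (rule hydroI(1)[of _ 1])
    show "e \<in> extensional UHP" by (simp add: e_def)
    show "inj_on e UHP"
    proof (rule inj_onI)
      fix a b assume ab: "a \<in> UHP" "b \<in> UHP" "e a = e b"
      define A B where "A = a + \<i>" and "B = b + \<i>"
      have n: "A \<noteq> 0" "B \<noteq> 0" using ab UHP_plus_i by (auto simp: A_def B_def)
      have "A - 1 / A = B - 1 / B" using ab by (simp add: e_def A_def B_def algebra_simps)
      then have "(A - B) * (1 + A * B) = 0" using n by (simp add: field_simps)
      moreover have "1 + A * B \<noteq> 0"
      proof
        assume "1 + A * B = 0"
        then have "A * B = - 1" by (simp add: add_eq_0_iff)
        then have "cmod A * cmod B = 1" by (metis norm_minus_cancel norm_mult norm_one)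
        moreover have "1 * 1 < cmod A * cmod B"
          using big[OF ab(1)] big[OF ab(2)] n unfolding A_def B_def by (intro mult_strict_mono) auto
        ultimately show False by simp
      qed
      ultimately show "a = b" by (simp add: A_def B_def)
    qed
    show "e holomorphic_on UHP"
      by (rule holomorphic_transform[of "\<lambda>z. z - 1 / (z + \<i>)"])
        (auto simp: e_def dest: UHP_plus_i intro!: holomorphic_intros)
    show "e ` UHP \<subseteq> UHP" using im by (force simp: e_def UHP_iff)
    show "cmod (e z - z) * Im z \<le> 1" if z: "z \<in> UHP" for z
    proof -
      have "Im z \<le> cmod (z + \<i>)" using abs_Im_le_cmod[of "z + \<i>"] z by (auto simp: UHP_iff)
      then show ?thesis using z big[OF z] by (simp add: e_def norm_divide divide_simps)
    qed
  qed
  moreover have "e \<noteq> uhp_id"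
  proof
    assume "e = uhp_id"
    then have "e \<i> = uhp_id \<i>" by simp
    moreover have "\<i> \<in> UHP" by (simp add: UHP_iff)
    ultimately show False by (simp add: e_def complex_eq_iff)
  qed
  ultimately show ?thesis using hcap_0_imp_id not_le by blast
qed

text \<open>By closedness the largest capacity below \<open>t\<close> and the smallest one above it
  are attained. With no member above, the lower one is prolonged; otherwise a decomposition of the
  connecting map gives a map strictly inside the gap. Either way maximality puts the new map into
  \<open>F\<close>, against the choice of the gap.\<close>

lemma Loewner_family_attains:
  assumes F: "chordal_Loewner_family F" and t: "t \<ge> 0"
  shows "\<exists>f\<in>F. hcap f = t"
proof (rule ccontr)
  assume no: "\<not> ?thesis"
  have FR: "e \<in> hydro_maps" if "e \<in> F" for e using Loewner_familyD(1)[OF F] that by blast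
  define A where "A = hcap ` {f \<in> F. hcap f \<le> t}"
  define B where "B = hcap ` {f \<in> F. t \<le> hcap f}"
  have "0 \<in> A" using Loewner_family_id[OF F] t hcap_uhp_id by (force simp: A_def)
  have bA: "bdd_above A" by (rule bdd_aboveI[of _ t]) (auto simp: A_def)
  obtain fa where fa: "fa \<in> F" "hcap fa = Sup A"
  proof -
    obtain u where u: "\<And>n. u n \<in> A" "u \<longlonglongrightarrow> Sup A"
      using closure_contains_Sup[OF _ bA] \<open>0 \<in> A\<close> unfolding closure_sequential by blast
    have "\<exists>f\<in>F. hcap f = u n" for n using u(1)[of n] by (auto simp: A_def)
    then obtain f where "\<And>n. f n \<in> F" "\<And>n. hcap (f n) = u n" by metis
    then show thesis using Loewner_family_closed[OF F, of f "Sup A"] u(2) that by auto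
  qed
  have a: "hcap fa < t"
  proof -
    have "Sup A \<le> t" by (rule cSup_least) (use \<open>0 \<in> A\<close> in \<open>auto simp: A_def\<close>)
    moreover have "hcap fa \<noteq> t" using no fa(1) by blast
    ultimately show ?thesis using fa(2) by simp
  qed
  have Aup: "hcap f \<le> hcap fa" if "f \<in> F" "hcap f \<le> t" for f
    unfolding fa(2) by (rule cSup_upper[OF _ bA]) (use that in \<open>auto simp: A_def\<close>)
  show False
  proof (cases "B = {}")
    case True
    obtain e where e: "e \<in> hydro_maps" "hcap e > 0" using ex_hydro_pos by blast
    define g where "g = compose UHP fa e"
    have g: "g \<in> hydro_maps" "hcap g = hcap fa + hcap e"
      using compose_hydro[OF FR[OF fa(1)] e(1)] by (auto simp: g_def)
    have "subord g fa" using e by (auto simp: g_def subord_def)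
    have le_t: "hcap f \<le> t" if "f \<in> F" for f
    proof (rule ccontr)
      assume "\<not> hcap f \<le> t"
      then have "hcap f \<in> B" using that by (auto simp: B_def)
      then show False using True by blast
    qed
    then have "subord fa f" if "f \<in> F" for f using Loewner_familyD(2)[OF F that fa(1)] Aup that by blast
    then have "subord g f" if "f \<in> F" for f
      using subord_trans[OF g(1) FR[OF fa(1)] FR[OF that] \<open>subord g fa\<close>] that by blast
    then have "g \<in> F" using Loewner_familyD(3)[OF F g(1)] by blast
    then show False using Aup[of g] le_t[of g] g(2) e(2) by linarith
  next
    case False
    have bB: "bdd_below B" by (rule bdd_belowI[of _ t]) (auto simp: B_def)
    obtain fb where fb: "fb \<in> F" "hcap fb = Inf B"
    proof -
      obtain u where u: "\<And>n. u n \<in> B" "u \<longlonglongrightarrow> Inf B"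
        using closure_contains_Inf[OF False bB] unfolding closure_sequential by blast
      have "\<exists>f\<in>F. hcap f = u n" for n using u(1)[of n] by (auto simp: B_def)
      then obtain f where "\<And>n. f n \<in> F" "\<And>n. hcap (f n) = u n" by metis
      then show thesis using Loewner_family_closed[OF F, of f "Inf B"] u(2) that by auto
    qed
    have b: "t < hcap fb"
    proof -
      have "t \<le> Inf B" by (rule cInf_greatest[OF False]) (auto simp: B_def)
      moreover have "hcap fb \<noteq> t" using no fb(1) by blast
      ultimately show ?thesis using fb(2) by simp
    qed
    have Blow: "hcap fb \<le> hcap f" if "f \<in> F" "t \<le> hcap f" for f
      unfolding fb(2) by (rule cInf_lower[OF _ bB]) (use that in \<open>auto simp: B_def\<close>)
    have "subord fb fa" using Loewner_familyD(2)[OF F fa(1) fb(1)] a b by simp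
    then obtain h where h: "h \<in> hydro_maps" "fb = compose UHP fa h" "hcap h = hcap fb - hcap fa"
      by (rule subord_hcap[OF FR[OF fb(1)] FR[OF fa(1)]])
    then have "h \<noteq> uhp_id" using a b hcap_uhp_id by auto
    then obtain g k where gk: "g \<in> hydro_maps" "k \<in> hydro_maps" "h = compose UHP g k" "0 < hcap g" "0 < hcap k"
      using hydro_decomposition[OF h(1)] by blast
    define m where "m = compose UHP fa g"
    have m: "m \<in> hydro_maps" "hcap m = hcap fa + hcap g"
      using compose_hydro[OF FR[OF fa(1)] gk(1)] by (auto simp: m_def)
    have mfa: "subord m fa" using gk by (auto simp: m_def subord_def)
    have "fb = compose UHP m k"
      unfolding m_def h(2) gk(3) using compose_assoc_hydro[OF FR[OF fa(1)] gk(1,2)] by simp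
    then have fbm: "subord fb m" "hcap fb = hcap m + hcap k"
      using gk compose_hydro(2)[OF m(1) gk(2)] by (auto simp: subord_def)
    have "subord f m \<or> subord m f" if f: "f \<in> F" for f
    proof (cases "hcap f \<le> t")
      case True
      then have "subord fa f" using Loewner_familyD(2)[OF F f fa(1)] Aup f by blast
      then show ?thesis using subord_trans[OF m(1) FR[OF fa(1)] FR[OF f] mfa] by blast
    next
      case False
      then have "subord f fb" using Loewner_familyD(2)[OF F fb(1) f] Blow f by simp
      then show ?thesis using subord_trans[OF FR[OF f] FR[OF fb(1)] m(1) _ fbm(1)] by blast
    qed
    then have "m \<in> F" using Loewner_familyD(3)[OF F m(1)] by blast
    then show False using Aup[of m] Blow[of m] m(2) fbm(2) gk(4,5) by linarith
  qed
qed

lemma family_at: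
  assumes F: "chordal_Loewner_family F" and t: "t \<ge> 0"
  shows "family_at F t \<in> F" "hcap (family_at F t) = t"
proof -
  have FR: "e \<in> hydro_maps" if "e \<in> F" for e using Loewner_familyD(1)[OF F] that by blast
  obtain f where f: "f \<in> F" "hcap f = t" using Loewner_family_attains[OF F t] by blast
  have "family_at F t = f"
    unfolding family_at_def
    by (rule the_equality) (use f FR has_hcap_iff Loewner_family_eqI[OF F] in auto)
  then show "family_at F t \<in> F" "hcap (family_at F t) = t" using f by auto
qed

lemma family_at_hydro: "chordal_Loewner_family F \<Longrightarrow> t \<ge> 0 \<Longrightarrow> family_at F t \<in> hydro_maps"
  using family_at(1) Loewner_familyD(1) by blast

lemma Loewner_family_eq_image:
  assumes F: "chordal_Loewner_family F" shows "F = family_at F ` {0..}"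
proof
  show "family_at F ` {0..} \<subseteq> F" using family_at(1)[OF F] by auto
  show "F \<subseteq> family_at F ` {0..}"
  proof
    fix f assume f: "f \<in> F"
    then have "hcap f \<ge> 0" using hcap_nonneg Loewner_familyD(1)[OF F] by blast
    moreover from this have "f = family_at F (hcap f)"
      using Loewner_family_eqI[OF F f] family_at[OF F] by simp
    ultimately show "f \<in> family_at F ` {0..}" by auto
  qed
qed

lemma family_at_compose:
  assumes F: "chordal_Loewner_family F" and st: "0 \<le> s" "s \<le> t"
  obtains k where "k \<in> hydro_maps" "family_at F t = compose UHP (family_at F s) k" "hcap k = t - s"
proof -
  have t: "0 \<le> t" using st by simp
  have "subord (family_at F t) (family_at F s)"
    using Loewner_familyD(2)[OF F family_at(1)[OF F st(1)] family_at(1)[OF F t]] st t by (simp add: family_at(2)[OF F])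
  then show thesis
    using that st t subord_hcap[OF family_at_hydro[OF F t] family_at_hydro[OF F st(1)]] family_at(2)[OF F] by metis
qed

text \<open>For maximality, a further map in a larger chain would be comparable with the
  \<open>f t\<close> of its own capacity, hence equal to it.\<close>

lemma Loewner_familyI:
  assumes f: "\<And>t. t \<ge> 0 \<Longrightarrow> f t \<in> hydro_maps" "\<And>t. t \<ge> 0 \<Longrightarrow> hcap (f t) = t"
    and sub: "\<And>s t. 0 \<le> s \<Longrightarrow> s \<le> t \<Longrightarrow> subord (f t) (f s)"
  shows "chordal_Loewner_family (f ` {0..})" "\<And>t. t \<ge> 0 \<Longrightarrow> family_at (f ` {0..}) t = f t"
proof -
  let ?F = "f ` {0..}"
  have ch: "pred_on.chain hydro_maps subord ?F"
    unfolding pred_on.chain_def using f sub by (auto, meson linear)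
  have "\<not> (pred_on.chain hydro_maps subord S \<and> ?F \<subset> S)" for S
  proof
    assume S: "pred_on.chain hydro_maps subord S \<and> ?F \<subset> S"
    then obtain g where g: "g \<in> S" "g \<notin> ?F" by blast
    have gR: "g \<in> hydro_maps" using S g by (auto simp: pred_on.chain_def)
    define t where "t = hcap g"
    have t: "t \<ge> 0" unfolding t_def by (rule hcap_nonneg[OF gR])
    then have "f t \<in> S" using S by auto
    then have "subord (f t) g \<or> subord g (f t) \<or> f t = g"
      using S g unfolding pred_on.chain_def by auto
    moreover have "hcap (f t) = hcap g" using f(2)[OF t] by (simp add: t_def)
    ultimately have "f t = g" using subord_hcap_eq f(1)[OF t] gR by metis
    then show False using g t by auto
  qed
  then show F: "chordal_Loewner_family ?F"
    using ch by (auto simp: chordal_Loewner_family_def pred_on.maxchain_def)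
  show "family_at ?F t = f t" if "t \<ge> 0" for t
    using Loewner_family_eqI[OF F family_at(1)[OF F that], of "f t"] that f family_at(2)[OF F that] by simp
qed

section \<open>Gronwall's lemma and Lebesgue differentiation\<close>

text \<open>Cauchy estimate on circles of radius \<open>r / 4\<close>; these stay inside the ball
  when centred at distance below \<open>r / 2\<close> from \<open>z0\<close>, and give the factor
  4.\<close>

lemma bounded_holomorphic_Lipschitz:
  assumes hol: "f holomorphic_on ball z0 r" and r: "r > 0" and B: "\<And>z. z \<in> ball z0 r \<Longrightarrow> cmod (f z) \<le> B"
    and ab: "a \<in> ball z0 (r/2)" "b \<in> ball z0 (r/2)"
  shows "cmod (f a - f b) \<le> 4 * B / r * cmod (a - b)"
proof (rule field_differentiable_bound[of "ball z0 (r/2)" f "deriv f"])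
  fix z assume z: "z \<in> ball z0 (r/2)"
  have sub: "cball z (r/4) \<subseteq> ball z0 r"
  proof
    fix x assume "x \<in> cball z (r/4)"
    then show "x \<in> ball z0 r" using z dist_triangle[of z0 x z] r by simp
  qed
  have "norm ((deriv ^^ 1) f z) \<le> fact 1 * B / (r/4) ^ 1"
  proof (rule Cauchy_inequality)
    show "f holomorphic_on ball z (r/4)" using hol sub by (meson ball_subset_cball holomorphic_on_subset order_trans)
    show "continuous_on (cball z (r/4)) f" using holomorphic_on_imp_continuous_on[OF hol] sub continuous_on_subset by blast
    show "cmod (f x) \<le> B" if "cmod (z - x) = r / 4" for x
      using B[of x] sub that r by (auto simp: dist_norm)
  qed (use r in auto)
  then show "norm (deriv f z) \<le> 4 * B / r" by (simp add: field_simps)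
  have "z \<in> ball z0 r" using z r by auto
  then have "(f has_field_derivative deriv f z) (at z)"
    using hol by (simp add: holomorphic_derivI)
  then show "(f has_field_derivative deriv f z) (at z within ball z0 (r/2))"
    by (rule has_field_derivative_at_within)
qed (use ab in auto)

text \<open>Difference quotients are dominated by the Lipschitz constant \<open>4 * B / d\<close>,
  so dominated convergence along sequences applies; this copes with a merely integrable dependence
  on \<open>r\<close>.\<close>

lemma holomorphic_integral:
  fixes f :: "real \<Rightarrow> complex \<Rightarrow> complex"
  assumes S: "open S" and hol: "\<And>r. r \<in> {a..b} \<Longrightarrow> f r holomorphic_on S"
    and int: "\<And>z. z \<in> S \<Longrightarrow> (\<lambda>r. f r z) integrable_on {a..b}"
    and bd: "\<And>z0. z0 \<in> S \<Longrightarrow> \<exists>d>0. \<exists>B. ball z0 d \<subseteq> S \<and> (\<forall>r\<in>{a..b}. \<forall>z\<in>ball z0 d. cmod (f r z) \<le> B)"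
  shows "(\<lambda>z. integral {a..b} (\<lambda>r. f r z)) holomorphic_on S"
proof (rule holomorphic_onI)
  fix z0 assume z0: "z0 \<in> S"
  obtain d B where d: "d > 0" "ball z0 d \<subseteq> S" and B: "\<And>r z. r \<in> {a..b} \<Longrightarrow> z \<in> ball z0 d \<Longrightarrow> cmod (f r z) \<le> B"
    using bd[OF z0] by blast
  define F where "F = (\<lambda>z. integral {a..b} (\<lambda>r. f r z))"
  have "((\<lambda>z. (F z - F z0) / (z - z0)) \<longlongrightarrow> integral {a..b} (\<lambda>r. deriv (f r) z0)) (at z0)"
    unfolding tendsto_at_iff_sequentially
  proof (intro allI impI)
    fix X assume X0: "\<forall>i. X i \<in> UNIV - {z0}" and Xlim: "X \<longlonglongrightarrow> z0"
    obtain N where N: "\<And>n. n \<ge> N \<Longrightarrow> X n \<in> ball z0 (d/2)"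
      using Xlim d(1) unfolding lim_sequentially by (metis dist_commute half_gt_zero mem_ball)
    define Y where "Y = (\<lambda>n. X (n + N))"
    have Y: "Y n \<in> ball z0 (d/2)" "Y n \<noteq> z0" for n using N X0 by (auto simp: Y_def)
    have YS: "Y n \<in> S" for n using Y(1)[of n] d by auto
    have Ylim: "Y \<longlonglongrightarrow> z0" unfolding Y_def by (rule LIMSEQ_ignore_initial_segment[OF Xlim])
    define q where "q = (\<lambda>n r. (f r (Y n) - f r z0) / (Y n - z0))"
    have "(\<lambda>n. integral {a..b} (q n)) \<longlonglongrightarrow> integral {a..b} (\<lambda>r. deriv (f r) z0)"
    proof (rule dominated_convergence(2))
      show "q n integrable_on {a..b}" for n
        unfolding q_def by (intro integrable_on_divide integrable_diff int YS z0)
      show "(\<lambda>r. 4 * B / d) integrable_on {a..b}" by (rule integrable_const_ivl)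
      show "norm (q n r) \<le> 4 * B / d" if r: "r \<in> {a..b}" for n r
      proof -
        have "cmod (f r (Y n) - f r z0) \<le> 4 * B / d * cmod (Y n - z0)"
          by (rule bounded_holomorphic_Lipschitz[of "f r" z0 d B])
            (use r d Y B in \<open>auto intro: holomorphic_on_subset[OF hol]\<close>)
        then show ?thesis using Y(2)[of n] by (simp add: q_def norm_divide divide_le_eq)
      qed
      show "(\<lambda>n. q n r) \<longlonglongrightarrow> deriv (f r) z0" if r: "r \<in> {a..b}" for r
      proof -
        have "(f r has_field_derivative deriv (f r) z0) (at z0)"
          using hol[OF r] S z0 by (rule holomorphic_derivI)
        then show ?thesis
          unfolding has_field_derivative_iff tendsto_at_iff_sequentially q_def
          using Ylim Y(2) by (auto simp: comp_def)
      qed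
    qed
    moreover have "integral {a..b} (q n) = (F (Y n) - F z0) / (Y n - z0)" for n
      unfolding q_def F_def using integral_diff[OF int[OF YS] int[OF z0]] by simp
    ultimately have "(\<lambda>n. (F (Y n) - F z0) / (Y n - z0)) \<longlonglongrightarrow> integral {a..b} (\<lambda>r. deriv (f r) z0)"
      by simp
    then have "(\<lambda>n. (\<lambda>z. (F z - F z0) / (z - z0)) (X (n + N))) \<longlonglongrightarrow> integral {a..b} (\<lambda>r. deriv (f r) z0)"
      by (simp add: Y_def)
    then show "((\<lambda>z. (F z - F z0) / (z - z0)) \<circ> X) \<longlonglongrightarrow> integral {a..b} (\<lambda>r. deriv (f r) z0)"
      unfolding comp_def by (rule LIMSEQ_offset)
  qed
  then have "(F has_field_derivative integral {a..b} (\<lambda>r. deriv (f r) z0)) (at z0)"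
    by (simp add: has_field_derivative_iff)
  then show "(\<lambda>z. integral {a..b} (\<lambda>r. f r z)) field_differentiable at z0 within S"
    unfolding F_def field_differentiable_def using has_field_derivative_at_within by blast
qed

text \<open>The primitive of \<open>\<delta>\<close> times \<open>exp (- L * r)\<close> is
  nonincreasing, starts at zero and is nonnegative.\<close>

lemma Gronwall_zero:
  fixes \<delta> :: "real \<Rightarrow> real"
  assumes cont: "continuous_on {a..b} \<delta>" and nn: "\<And>r. r \<in> {a..b} \<Longrightarrow> 0 \<le> \<delta> r"
    and le: "\<And>r. r \<in> {a..b} \<Longrightarrow> \<delta> r \<le> L * integral {a..r} \<delta>" and L: "L \<ge> 0" and x: "x \<in> {a..b}"
  shows "\<delta> x = 0"
proof -
  define U where "U = (\<lambda>r. integral {a..r} \<delta>)"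
  have U': "(U has_real_derivative \<delta> r) (at r within {a..b})" if "r \<in> {a..b}" for r
    unfolding U_def by (rule integral_has_real_derivative[OF cont that])
  have Un: "0 \<le> U r" if "r \<in> {a..b}" for r
    unfolding U_def using nn that
    by (intro integral_nonneg integrable_continuous_interval continuous_on_subset[OF cont]) auto
  define V where "V = (\<lambda>r. exp (- L * r) * U r)"
  have "V x \<le> V a"
  proof (rule DERIV_nonpos_imp_decreasing_open[of a x V])
    show "a \<le> x" using x by simp
    show "\<exists>y. (V has_real_derivative y) (at r) \<and> y \<le> 0" if r: "a < r" "r < x" for r
    proof (intro exI conjI)
      have "(U has_real_derivative \<delta> r) (at r)"
        using U'[of r] r x by (simp add: at_within_Icc_at)
      then show "(V has_real_derivative (exp (- L * r) * (\<delta> r - L * U r))) (at r)"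
        unfolding V_def by (auto intro!: derivative_eq_intros simp: algebra_simps)
      show "exp (- L * r) * (\<delta> r - L * U r) \<le> 0"
        using le[of r] r x by (intro mult_nonneg_nonpos) (auto simp: U_def)
    qed
    have "continuous_on {a..b} U"
      using U' by (meson DERIV_continuous_on)
    then show "continuous_on {a..x} V"
      unfolding V_def using x by (intro continuous_intros) (auto intro: continuous_on_subset)
  qed
  then have "exp (- L * x) * U x \<le> 0" by (simp add: V_def U_def)
  then have "U x \<le> 0" by (simp add: mult_le_0_iff)
  then have "L * U x \<le> 0" using L by (simp add: mult_nonneg_nonpos)
  then show ?thesis using le[OF x] nn[OF x] by (simp add: U_def)
qed

lemma Gronwall_zero_backward:
  fixes \<delta> :: "real \<Rightarrow> real"
  assumes cont: "continuous_on {a..b} \<delta>" and nn: "\<And>r. r \<in> {a..b} \<Longrightarrow> 0 \<le> \<delta> r"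
    and le: "\<And>r. r \<in> {a..b} \<Longrightarrow> \<delta> r \<le> L * integral {r..b} \<delta>" and L: "L \<ge> 0" and x: "x \<in> {a..b}"
  shows "\<delta> x = 0"
proof -
  have "\<delta> (- (- x)) = 0"
  proof (rule Gronwall_zero[where \<delta> = "\<lambda>r. \<delta> (- r)" and x = "- x" and a = "-b" and b = "-a" and L = L])
    show "continuous_on {-b..-a} (\<lambda>r. \<delta> (- r))"
      by (intro continuous_on_compose2[OF cont] continuous_intros) auto
    show "\<delta> (- r) \<le> L * integral {-b..r} (\<lambda>r. \<delta> (- r))" if "r \<in> {-b..-a}" for r
      using le[of "-r"] that Henstock_Kurzweil_Integration.integral_reflect_real[where a = "-r" and b = b and f = \<delta>] by simp
  qed (use nn L x in auto)
  then show ?thesis by simp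
qed

text \<open>One-sided differentiation of \<open>f\<close> and of its reflection covers the right and
  the left part of an interval around \<open>x\<close>. Both sides are needed, since increments in
  time are taken forwards and backwards.\<close>

lemma Lebesgue_differentiation:
  fixes f :: "real \<Rightarrow> complex"
  assumes int: "\<And>a b. f integrable_on {a..b}"
  obtains N where "negligible N"
    "\<And>x e. x \<notin> N \<Longrightarrow> e > 0 \<Longrightarrow> \<exists>d>0. \<forall>a b. a \<le> x \<longrightarrow> x \<le> b \<longrightarrow> b - a < d \<longrightarrow>
       cmod (integral {a..b} f - (b - a) *\<^sub>R f x) \<le> e * (b - a)"
proof -
  obtain N1 where N1: "negligible N1"
    "\<And>x e. \<lbrakk>x \<notin> N1; 0 < e\<rbrakk> \<Longrightarrow> \<exists>d>0. \<forall>h. 0 < h \<and> h < d \<longrightarrow> norm(integral (cbox x (x + h *\<^sub>R One)) f /\<^sub>R h ^ DIM(real) - f x) < e"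
    using integrable_ccontinuous_explicit[of f] int by (metis cbox_interval)
  have int': "(\<lambda>x. f (- x)) integrable_on cbox a b" for a b
    using Henstock_Kurzweil_Integration.integrable_reflect_real[where f = f and a = "-b" and b = "-a"] int by simp
  obtain N2 where N2: "negligible N2"
    "\<And>x e. \<lbrakk>x \<notin> N2; 0 < e\<rbrakk> \<Longrightarrow> \<exists>d>0. \<forall>h. 0 < h \<and> h < d \<longrightarrow> norm(integral (cbox x (x + h *\<^sub>R One)) (\<lambda>x. f (- x)) /\<^sub>R h ^ DIM(real) - f (- x)) < e"
    using integrable_ccontinuous_explicit[of "\<lambda>x. f (- x)", OF int'] by metis
  define N where "N = N1 \<union> uminus ` N2"
  have "negligible N"
    unfolding N_def
  proof (intro negligible_Un negligible_locally_Lipschitz_image[OF _ N2(1)] N1(1))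
    show "\<exists>T B. open T \<and> x \<in> T \<and> (\<forall>y\<in>N2 \<inter> T. norm (- y - - x) \<le> B * norm (y - x))" for x :: real
      by (intro exI[of _ UNIV] exI[of _ 1]) auto
  qed simp
  moreover have "\<exists>d>0. \<forall>a b. a \<le> x \<longrightarrow> x \<le> b \<longrightarrow> b - a < d \<longrightarrow>
       cmod (integral {a..b} f - (b - a) *\<^sub>R f x) \<le> e * (b - a)" if x: "x \<notin> N" and e: "e > 0" for x e
  proof -
    have x1: "x \<notin> N1" and x2: "- x \<notin> N2" using x by (auto simp: N_def image_iff)
    obtain d1 where d1: "d1 > 0" "\<And>h. 0 < h \<Longrightarrow> h < d1 \<Longrightarrow> cmod (integral {x..x+h} f /\<^sub>R h - f x) < e"
      using N1(2)[OF x1 e] by auto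
    obtain d2 where d2: "d2 > 0" "\<And>h. 0 < h \<Longrightarrow> h < d2 \<Longrightarrow> cmod (integral {-x..-x+h} (\<lambda>x. f (-x)) /\<^sub>R h - f x) < e"
      using N2(2)[OF x2 e] by auto
    have right: "cmod (integral {x..b} f - (b - x) *\<^sub>R f x) \<le> e * (b - x)" if "x \<le> b" "b - x < d1" for b
    proof (cases "x = b")
      case False
      then have h: "0 < b - x" using that by simp
      have "integral {x..b} f - (b - x) *\<^sub>R f x = (b - x) *\<^sub>R (integral {x..b} f /\<^sub>R (b - x) - f x)"
        using h by (simp add: scaleR_right_diff_distrib)
      then have "cmod (integral {x..b} f - (b - x) *\<^sub>R f x) = (b - x) * cmod (integral {x..b} f /\<^sub>R (b - x) - f x)"
        using h by (metis abs_of_pos norm_scaleR)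
      also have "\<dots> \<le> (b - x) * e" using d1(2)[of "b - x"] h that by (intro mult_left_mono) auto
      finally show ?thesis by (simp add: mult.commute)
    qed simp
    have left: "cmod (integral {a..x} f - (x - a) *\<^sub>R f x) \<le> e * (x - a)" if "a \<le> x" "x - a < d2" for a
    proof (cases "x = a")
      case False
      then have h: "0 < x - a" using that by simp
      have "integral {-x..-x+(x-a)} (\<lambda>x. f (-x)) = integral {a..x} f"
        using Henstock_Kurzweil_Integration.integral_reflect_real[where f = f and a = a and b = x] by simp
      then have b: "cmod (integral {a..x} f /\<^sub>R (x - a) - f x) < e" using d2(2)[of "x - a"] h that by simp
      have "integral {a..x} f - (x - a) *\<^sub>R f x = (x - a) *\<^sub>R (integral {a..x} f /\<^sub>R (x - a) - f x)"
        using h by (simp add: scaleR_right_diff_distrib)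
      then have "cmod (integral {a..x} f - (x - a) *\<^sub>R f x) = (x - a) * cmod (integral {a..x} f /\<^sub>R (x - a) - f x)"
        using h by (metis abs_of_pos norm_scaleR)
      also have "\<dots> \<le> (x - a) * e" using b h by (intro mult_left_mono) auto
      finally show ?thesis by (simp add: mult.commute)
    qed simp
    show ?thesis
    proof (intro exI[of _ "min d1 d2"] conjI allI impI)
      fix a b assume ab: "a \<le> x" "x \<le> b" "b - a < min d1 d2"
      have "integral {a..b} f - (b - a) *\<^sub>R f x
        = (integral {a..x} f - (x - a) *\<^sub>R f x) + (integral {x..b} f - (b - x) *\<^sub>R f x)"
        using Henstock_Kurzweil_Integration.integral_combine[OF ab(1,2) int] by (simp add: algebra_simps)
      then have "cmod (integral {a..b} f - (b - a) *\<^sub>R f x)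
        \<le> cmod (integral {a..x} f - (x - a) *\<^sub>R f x) + cmod (integral {x..b} f - (b - x) *\<^sub>R f x)"
        by (simp only: norm_triangle_ineq)
      also have "\<dots> \<le> e * (x - a) + e * (b - x)" using left[of a] right[of b] ab by (intro add_mono) auto
      finally show "cmod (integral {a..b} f - (b - a) *\<^sub>R f x) \<le> e * (b - a)" by (simp add: algebra_simps)
    qed (use d1 d2 in auto)
  qed
  ultimately show thesis by (rule that)
qed

text \<open>The gauge at a point of the exceptional set comes from the vanishing of the integral of its
  indicator; the Lipschitz bound controls the increments there.\<close>

lemma Lipschitz_derivative_zero_ae_const:
  fixes \<phi> :: "real \<Rightarrow> 'a::real_normed_vector"
  assumes ab: "a \<le> b" and lip: "\<And>u v. a \<le> u \<Longrightarrow> u \<le> v \<Longrightarrow> v \<le> b \<Longrightarrow> norm (\<phi> v - \<phi> u) \<le> L * (v - u)"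
    and N: "negligible N"
    and der: "\<And>x e. x \<in> {a..b} - N \<Longrightarrow> e > 0 \<Longrightarrow> \<exists>d>0. \<forall>u v. a \<le> u \<longrightarrow> u \<le> x \<longrightarrow> x \<le> v \<longrightarrow> v \<le> b \<longrightarrow> v - u < d \<longrightarrow>
        norm (\<phi> v - \<phi> u) \<le> e * (v - u)"
  shows "\<phi> a = \<phi> b"
proof (cases "a = b")
  case False
  then have "a < b" using ab by simp
  have L0: "L \<ge> 0" 
  proof -
    have "0 \<le> L * (b - a)" using lip[of a b] ab by (meson norm_ge_zero order_refl order_trans)
    then show ?thesis using \<open>a < b\<close> by (simp add: zero_le_mult_iff)
  qed
  have "norm (\<phi> b - \<phi> a) \<le> e * ((b - a) + L)" if e: "e > 0" for e
  proof -
    have "((indicator N :: real \<Rightarrow> real) has_integral 0) (cbox a b)"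
      using N by (simp add: negligible_def)
    from this[unfolded has_integral, rule_format, OF e]
    obtain \<gamma> where \<gamma>: "gauge \<gamma>" and
      \<gamma>': "\<forall>p. p tagged_division_of cbox a b \<and> \<gamma> fine p \<longrightarrow>
        norm ((\<Sum>(x,k)\<in>p. measure lborel k *\<^sub>R indicator N x) - (0::real)) < e"
      by (elim exE conjE)
    have "\<exists>d>0. x \<in> {a..b} - N \<longrightarrow> (\<forall>u v. a \<le> u \<longrightarrow> u \<le> x \<longrightarrow> x \<le> v \<longrightarrow> v \<le> b \<longrightarrow> v - u < d \<longrightarrow>
        norm (\<phi> v - \<phi> u) \<le> e * (v - u))" for x
      using der[OF _ e, of x] by (cases "x \<in> {a..b} - N") (auto intro: exI[of _ 1])
    then obtain d where d: "\<And>x. d x > 0" "\<And>x u v. x \<in> {a..b} - N \<Longrightarrow> a \<le> u \<Longrightarrow> u \<le> x \<Longrightarrow> x \<le> v \<Longrightarrow> v \<le> b \<Longrightarrow> v - u < d x \<Longrightarrow>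
        norm (\<phi> v - \<phi> u) \<le> e * (v - u)" by metis
    \<comment> \<open>The radius \<open>d x / 2\<close> makes a cell tagged at \<open>x\<close>
      shorter than \<open>d x\<close>.\<close>
    have "gauge (\<lambda>x. \<gamma> x \<inter> ball x (d x / 2))"
      using \<gamma> d(1) by (intro gauge_Int gauge_ball_dependent) auto
    then obtain p where p: "p tagged_division_of {a..b}" "(\<lambda>x. \<gamma> x \<inter> ball x (d x / 2)) fine p"
      using fine_division_exists_real by blast
    have fin1: "\<gamma> fine p" and fin2: "(\<lambda>x. ball x (d x / 2)) fine p" using p(2) by (auto simp: fine_Int)
    have pd: "p tagged_division_of cbox a b" using p(1) by simp
    have fp: "finite p" using pd by blast
    have bound: "norm (\<phi> (Sup k) - \<phi> (Inf k)) \<le> e * measure lborel k + L * (measure lborel k *\<^sub>R indicator N x)" if xk: "(x, k) \<in> p" for x k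
    proof -
      obtain u v where k: "k = cbox u v" using tagged_division_ofD(4)[OF pd xk] by blast
      have xin: "x \<in> k" and sub: "k \<subseteq> {a..b}" using tagged_division_ofD(2,3)[OF pd xk] by auto
      then have uv: "u \<le> x" "x \<le> v" "a \<le> u" "v \<le> b" using k by auto
      have SI: "Sup k = v" "Inf k = u" "measure lborel k = v - u" using uv k by auto
      show ?thesis
      proof (cases "x \<in> N")
        case True
        have "norm (\<phi> v - \<phi> u) \<le> L * (v - u)" using lip uv by simp
        also have "\<dots> \<le> e * (v - u) + L * (v - u)" using e uv by simp
        finally show ?thesis using True by (simp add: SI)
      next
        case False
        have "k \<subseteq> ball x (d x / 2)" using fin2 xk by (auto simp: fine_def)
        moreover have "u \<in> k" "v \<in> k" using k uv by auto
        ultimately have "dist x u < d x / 2" "dist x v < d x / 2" by auto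
        then have "v - u < d x" using uv by (simp add: dist_real_def)
        then show ?thesis using d(2)[of x u v] uv False sub xin by (auto simp: SI)
      qed
    qed
    have "(\<Sum>(x,k)\<in>p. \<phi> (Sup k) - \<phi> (Inf k)) = \<phi> b - \<phi> a"
      using additive_tagged_division_1[OF ab p(1)] by simp
    then have "norm (\<phi> b - \<phi> a) = norm (\<Sum>(x,k)\<in>p. \<phi> (Sup k) - \<phi> (Inf k))" by simp
    also have "\<dots> \<le> (\<Sum>(x,k)\<in>p. e * measure lborel k + L * (measure lborel k *\<^sub>R indicator N x))"
      using bound by (intro sum_norm_le) auto
    also have "\<dots> = e * (\<Sum>(x,k)\<in>p. measure lborel k) + L * (\<Sum>(x,k)\<in>p. measure lborel k *\<^sub>R indicator N x)"
      by (simp add: case_prod_unfold sum.distrib sum_distrib_left)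
    also have "(\<Sum>(x,k)\<in>p. measure lborel k) = b - a"
      using additive_content_tagged_division[OF pd] ab by simp
    also have "L * (\<Sum>(x,k)\<in>p. measure lborel k *\<^sub>R indicator N x) \<le> L * e"
      using \<gamma>'[rule_format, OF conjI[OF pd fin1]] L0 by (intro mult_left_mono) auto
    finally show ?thesis by (simp add: algebra_simps)
  qed
  then have *: "norm (\<phi> b - \<phi> a) / ((b - a) + L) \<le> e" if "e > 0" for e
    using that L0 \<open>a < b\<close> by (simp add: pos_divide_le_eq)
  have "norm (\<phi> b - \<phi> a) / ((b - a) + L) \<le> 0"
    by (rule field_le_epsilon) (use * in simp)
  then have "norm (\<phi> b - \<phi> a) \<le> 0" using L0 \<open>a < b\<close> by (simp add: divide_le_0_iff)
  then show ?thesis by simp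
qed simp

section \<open>Solution of the Loewner equation\<close>

text \<open>The properties of Cauchy transforms that the flow uses. The sign of the imaginary part
  keeps backward solutions in the half-plane, the bound and the Lipschitz estimate drive the Picard
  iteration, and the asymptotics at infinity give the map at time \<open>t\<close> capacity
  \<open>t\<close>.\<close>

locale Loewner_field =
  fixes G :: "real \<Rightarrow> complex \<Rightarrow> complex"
  assumes G_measurable: "\<And>z. z \<in> upper_half_plane \<Longrightarrow> (\<lambda>t. G t z) \<in> borel_measurable (lebesgue_on {0..})"
    and G_holomorphic: "\<And>t. t \<ge> 0 \<Longrightarrow> G t holomorphic_on upper_half_plane"
    and G_Im: "\<And>t z. t \<ge> 0 \<Longrightarrow> z \<in> upper_half_plane \<Longrightarrow> Im (G t z) \<le> 0"
    and G_bound: "\<And>t z. t \<ge> 0 \<Longrightarrow> z \<in> upper_half_plane \<Longrightarrow> cmod (G t z) \<le> 1 / Im z"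
    and G_Lipschitz: "\<And>t z w. t \<ge> 0 \<Longrightarrow> z \<in> upper_half_plane \<Longrightarrow> w \<in> upper_half_plane \<Longrightarrow>
      cmod (G t z - G t w) \<le> cmod (z - w) / (Im z * Im w)"
    and G_asymptotic: "\<And>t y w B. t \<ge> 0 \<Longrightarrow> filterlim y at_top sequentially \<Longrightarrow> (\<And>n::nat. w n \<in> upper_half_plane) \<Longrightarrow>
      (\<And>n. cmod (w n - \<i> * of_real (y n)) \<le> B) \<Longrightarrow> (\<lambda>n. \<i> * of_real (y n) * G t (w n)) \<longlonglongrightarrow> 1"
begin

text \<open>Measurability in time is given at fixed points only. Sampling the path on the grid of
  mesh \<open>1 / (n + 1)\<close> involves countably many points for each \<open>n\<close>, and
  continuity of \<open>G r\<close> recovers the path in the limit.\<close>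

lemma G_path_measurable:
  assumes w: "continuous_on UNIV w" "\<And>r. w r \<in> UHP"
  shows "(\<lambda>r. G r (w r)) \<in> borel_measurable (lebesgue_on {0..})"
proof -
  define c where "c = (\<lambda>(n::nat) (k::int). w (of_int k / real (Suc n)))"
  define j where "j = (\<lambda>(n::nat) (r::real). \<lfloor>r * real (Suc n)\<rfloor>)"
  have j: "j n \<in> measurable (lebesgue_on {0..}) (count_space UNIV)" for n
  proof -
    have "(\<lambda>r::real. \<lfloor>r * real (Suc n)\<rfloor>) \<in> measurable borel (count_space UNIV)" by measurable
    then have "(\<lambda>r::real. \<lfloor>r * real (Suc n)\<rfloor>) \<in> measurable lebesgue (count_space UNIV)"
      by (intro measurable_completion) simp
    then show ?thesis unfolding j_def by (rule measurable_restrict_space1)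
  qed
  have "(\<lambda>r. (\<lambda>k r. G r (c n k)) (j n r) r) \<in> borel_measurable (lebesgue_on {0..})" for n
    by (rule measurable_compose_countable[OF _ j]) (simp add: c_def G_measurable w(2))
  then have m: "(\<lambda>r. G r (c n (j n r))) \<in> borel_measurable (lebesgue_on {0..})" for n by simp
  show ?thesis
  proof (rule borel_measurable_LIMSEQ_metric[OF m])
    fix r :: real assume "r \<in> space (lebesgue_on {0..})"
    then have r: "r \<ge> 0" by (simp add: space_restrict_space)
    have "(\<lambda>n. of_int (j n r) / real (Suc n)) \<longlonglongrightarrow> r"
    proof -
      have "(\<lambda>n. of_int (j n r) / real (Suc n) - r) \<longlonglongrightarrow> 0"
      proof (rule Lim_null_comparison)
        show "(\<lambda>n. 1 / real (Suc n)) \<longlonglongrightarrow> 0" using LIMSEQ_Suc[OF lim_1_over_n] by simp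
        have "norm (of_int (j n r) / real (Suc n) - r) \<le> 1 / real (Suc n)" for n
        proof -
          have "\<bar>of_int (j n r) - r * real (Suc n)\<bar> \<le> 1" unfolding j_def by linarith
          moreover have "of_int (j n r) / real (Suc n) - r = (of_int (j n r) - r * real (Suc n)) / real (Suc n)"
            by (simp add: diff_divide_distrib)
          ultimately show ?thesis by (simp add: divide_right_mono)
        qed
        then show "\<forall>\<^sub>F n in sequentially. norm (of_int (j n r) / real (Suc n) - r) \<le> 1 / real (Suc n)" by simp
      qed
      then show ?thesis using LIM_zero_iff by blast
    qed
    moreover have "isCont w r" using w(1) continuous_on_eq_continuous_at[OF open_UNIV] by blast
    ultimately have "(\<lambda>n. c n (j n r)) \<longlonglongrightarrow> w r" unfolding c_def by (rule isCont_tendsto_compose[rotated])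
    moreover have "isCont (G r) (w r)"
      using holomorphic_on_imp_continuous_on[OF G_holomorphic[OF r]] open_UHP w(2) continuous_on_eq_continuous_at by blast
    ultimately show "(\<lambda>n. G r (c n (j n r))) \<longlonglongrightarrow> G r (w r)" by (rule isCont_tendsto_compose[rotated])
  qed
qed

lemma G_path_integrable:
  assumes w: "continuous_on UNIV w" "\<And>r. w r \<in> UHP" and a: "0 \<le> a"
  shows "(\<lambda>r. G r (w r)) integrable_on {a..b}"
proof -
  have "(\<lambda>r. G r (w r)) absolutely_integrable_on {a..b}"
  proof (rule measurable_bounded_by_integrable_imp_absolutely_integrable)
    show "(\<lambda>r. G r (w r)) \<in> borel_measurable (lebesgue_on {a..b})"
      using G_path_measurable[OF w] by (rule measurable_restrict_mono) (use a in auto)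
    have "Im (w r) \<noteq> 0" for r using w(2)[of r] by (simp add: UHP_iff)
    then show "(\<lambda>r. 1 / Im (w r)) integrable_on {a..b}"
      by (intro integrable_continuous_interval continuous_intros continuous_on_subset[OF w(1)]) auto
    show "norm (G r (w r)) \<le> 1 / Im (w r)" if "r \<in> {a..b}" for r
      using G_bound[OF _ w(2)] that a by simp
  qed simp
  then show ?thesis using absolutely_integrable_on_def by blast
qed

lemma integral_G_Im_nonpos:
  assumes w: "continuous_on UNIV w" "\<And>r. w r \<in> UHP" and a: "0 \<le> a"
  shows "Im (integral {a..b} (\<lambda>r. G r (w r))) \<le> 0"
proof -
  note int = G_path_integrable[OF assms, of b]
  have "Im (integral {a..b} (\<lambda>r. G r (w r))) = integral {a..b} (\<lambda>r. Im (G r (w r)))"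
    using integral_linear[OF int bounded_linear_Im] by (simp add: comp_def)
  also have "\<dots> \<le> integral {a..b} (\<lambda>r. 0)"
    using integrable_linear[OF int bounded_linear_Im] G_Im[OF _ w(2)] a
    by (intro integral_le) (auto simp: comp_def)
  finally show ?thesis by simp
qed

lemma integral_G_bound:
  assumes w: "continuous_on UNIV w" "\<And>r. w r \<in> UHP" and a: "0 \<le> a" "a \<le> b"
    and \<epsilon>: "\<epsilon> > 0" "\<And>r. r \<in> {a..b} \<Longrightarrow> \<epsilon> \<le> Im (w r)"
  shows "cmod (integral {a..b} (\<lambda>r. G r (w r))) \<le> (b - a) / \<epsilon>"
proof -
  have "cmod (integral {a..b} (\<lambda>r. G r (w r))) \<le> integral {a..b} (\<lambda>r. 1 / \<epsilon>)"
  proof (rule integral_norm_bound_integral[OF G_path_integrable[OF w a(1)]])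
    show "norm (G r (w r)) \<le> 1 / \<epsilon>" if r: "r \<in> {a..b}" for r
    proof -
      have "cmod (G r (w r)) \<le> 1 / Im (w r)" using G_bound[OF _ w(2)] r a by simp
      also have "\<dots> \<le> 1 / \<epsilon>" using \<epsilon> r by (intro divide_left_mono mult_pos_pos) (auto intro: less_le_trans)
      finally show ?thesis .
    qed
  qed (rule integrable_const_ivl)
  also have "\<dots> = (b - a) / \<epsilon>" using a by simp
  finally show ?thesis .
qed

lemma G_diff_bound:
  assumes "t \<ge> 0" "\<epsilon> > 0" "\<epsilon> \<le> Im z" "\<epsilon> \<le> Im w"
  shows "cmod (G t z - G t w) \<le> cmod (z - w) / \<epsilon>\<^sup>2"
proof -
  have "cmod (G t z - G t w) \<le> cmod (z - w) / (Im z * Im w)"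
    using assms by (intro G_Lipschitz) (auto simp: UHP_iff)
  also have "\<dots> \<le> cmod (z - w) / \<epsilon>\<^sup>2"
    unfolding power2_eq_square using assms by (intro divide_left_mono mult_mono mult_pos_pos) auto
  finally show ?thesis .
qed

text \<open>Integral form, as the field is only measurable in time. Paths are total with values in
  the half-plane at every real time, which spares side conditions when \<open>G\<close> is evaluated
  along them.\<close>

definition flow :: "real \<Rightarrow> (real \<Rightarrow> complex) \<Rightarrow> bool" where
  "flow T w \<longleftrightarrow> continuous_on UNIV w \<and> (\<forall>r. w r \<in> upper_half_plane) \<and>
     (\<forall>s s'. 0 \<le> s \<and> s \<le> s' \<and> s' \<le> T \<longrightarrow> w s' - w s = integral {s..s'} (\<lambda>r. G r (w r)))"

lemma flowD:
  assumes "flow T w"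
  shows "continuous_on UNIV w" "w r \<in> UHP"
    "0 \<le> s \<Longrightarrow> s \<le> s' \<Longrightarrow> s' \<le> T \<Longrightarrow> w s' - w s = integral {s..s'} (\<lambda>r. G r (w r))"
  using assms by (auto simp: flow_def)

lemma flow_mono: "flow T w \<Longrightarrow> S \<le> T \<Longrightarrow> flow S w"
  by (auto simp: flow_def)

text \<open>Going backwards moves the point up, so the height at \<open>T\<close> is the minimum and
  serves as the uniform distance from the real line.\<close>

lemma flow_Im:
  assumes "flow T w" "0 \<le> s" "s \<le> s'" "s' \<le> T"
  shows "Im (w s') \<le> Im (w s)"
proof -
  have "Im (w s' - w s) \<le> 0"
    unfolding flowD(3)[OF assms] by (rule integral_G_Im_nonpos[OF flowD(1,2)[OF assms(1)] assms(2)])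
  then show ?thesis by simp
qed

lemma flow_dist:
  assumes w: "flow T w" and s: "0 \<le> s" "s \<le> s'" "s' \<le> T"
  shows "cmod (w s' - w s) \<le> (s' - s) / Im (w T)"
  unfolding flowD(3)[OF assms]
  by (rule integral_G_bound[OF flowD(1,2)[OF w] s(1,2)])
    (use flowD(2)[OF w] flow_Im[OF w] s in \<open>auto simp: UHP_iff\<close>)

text \<open>Agreement at one time propagates both ways: backwards it gives the semigroup property,
  forwards the injectivity of \<open>loewner_map\<close>.\<close>

lemma flow_unique:
  assumes u: "flow T u" and v: "flow T v" and c: "c \<in> {0..T}" "u c = v c" and r: "r \<in> {0..T}"
  shows "u r = v r"
proof -
  define \<epsilon> where "\<epsilon> = min (Im (u T)) (Im (v T))"
  have \<epsilon>: "\<epsilon> > 0" using flowD(2)[OF u] flowD(2)[OF v] by (simp add: \<epsilon>_def UHP_iff)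
  define \<delta> where "\<delta> = (\<lambda>r. cmod (u r - v r))"
  have cont: "continuous_on A \<delta>" for A
    unfolding \<delta>_def using flowD(1)[OF u] flowD(1)[OF v]
    by (intro continuous_intros) (auto intro: continuous_on_subset)
  have diff: "cmod (integral {a..b} (\<lambda>r. G r (u r)) - integral {a..b} (\<lambda>r. G r (v r))) \<le> 1 / \<epsilon>\<^sup>2 * integral {a..b} \<delta>"
    if "0 \<le> a" "a \<le> b" "b \<le> T" for a b
  proof -
    have "integral {a..b} (\<lambda>r. G r (u r)) - integral {a..b} (\<lambda>r. G r (v r)) = integral {a..b} (\<lambda>r. G r (u r) - G r (v r))"
      using that by (intro integral_diff[symmetric] G_path_integrable flowD(1,2)[OF u] flowD(1,2)[OF v]) auto
    also have "cmod \<dots> \<le> integral {a..b} (\<lambda>r. 1 / \<epsilon>\<^sup>2 * \<delta> r)"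
    proof (rule integral_norm_bound_integral)
      show "(\<lambda>r. G r (u r) - G r (v r)) integrable_on {a..b}"
        using that by (intro integrable_diff G_path_integrable flowD(1,2)[OF u] flowD(1,2)[OF v]) auto
      show "(\<lambda>r. 1 / \<epsilon>\<^sup>2 * \<delta> r) integrable_on {a..b}"
        by (intro integrable_continuous_interval continuous_intros cont)
      show "cmod (G r (u r) - G r (v r)) \<le> 1 / \<epsilon>\<^sup>2 * \<delta> r" if r: "r \<in> {a..b}" for r
        using G_diff_bound[of r \<epsilon> "u r" "v r"] r \<open>0 \<le> a\<close> \<open>b \<le> T\<close> \<epsilon> flow_Im[OF u, of r T] flow_Im[OF v, of r T]
        by (auto simp: \<epsilon>_def \<delta>_def min_def split: if_splits)
    qed
    also have "\<dots> = 1 / \<epsilon>\<^sup>2 * integral {a..b} \<delta>" by simp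
    finally show ?thesis .
  qed
  have "\<delta> r = 0"
  proof (cases "c \<le> r")
    case True
    show ?thesis
    proof (rule Gronwall_zero[OF cont, of c T "1 / \<epsilon>\<^sup>2"])
      show "\<delta> x \<le> 1 / \<epsilon>\<^sup>2 * integral {c..x} \<delta>" if x: "x \<in> {c..T}" for x
      proof -
        have "u x - v x = (u x - u c) - (v x - v c)" using c(2) by simp
        also have "\<dots> = integral {c..x} (\<lambda>r. G r (u r)) - integral {c..x} (\<lambda>r. G r (v r))"
          using flowD(3)[OF u, of c x] flowD(3)[OF v, of c x] x c(1) by simp
        finally show ?thesis using diff[of c x] x c(1) by (simp add: \<delta>_def)
      qed
    qed (use True r in \<open>auto simp: \<delta>_def\<close>)
  next
    case False
    show ?thesis
    proof (rule Gronwall_zero_backward[OF cont, of 0 c "1 / \<epsilon>\<^sup>2"])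
      show "\<delta> x \<le> 1 / \<epsilon>\<^sup>2 * integral {x..c} \<delta>" if x: "x \<in> {0..c}" for x
      proof -
        have "v x - u x = (u c - u x) - (v c - v x)" using c(2) by simp
        also have "\<dots> = integral {x..c} (\<lambda>r. G r (u r)) - integral {x..c} (\<lambda>r. G r (v r))"
          using flowD(3)[OF u, of x c] flowD(3)[OF v, of x c] x c(1) by simp
        finally have "cmod (v x - u x) \<le> 1 / \<epsilon>\<^sup>2 * integral {x..c} \<delta>" using diff[of x c] x c(1) by simp
        then show ?thesis by (simp add: \<delta>_def norm_minus_commute)
      qed
    qed (use False r in \<open>auto simp: \<delta>_def\<close>)
  qed
  then show ?thesis by (simp add: \<delta>_def)
qed

section \<open>Picard iteration for the backward equation\<close>

text \<open>Iterates for the terminal value \<open>z\<close> at time \<open>T\<close>. Clamping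
  \<open>s\<close> to \<open>{0..T}\<close> extends them to continuous paths on the whole
  line.\<close>

primrec picard :: "nat \<Rightarrow> real \<Rightarrow> complex \<Rightarrow> real \<Rightarrow> complex" where
  "picard 0 T z s = z"
| "picard (Suc n) T z s = z - integral {max 0 (min T s)..T} (\<lambda>r. G r (picard n T z r))"

lemma picard_props:
  assumes T: "0 \<le> T" and z: "z \<in> UHP"
  shows "continuous_on UNIV (picard n T z)" "Im z \<le> Im (picard n T z s)"
proof -
  have "continuous_on UNIV (picard n T z) \<and> (\<forall>s. Im z \<le> Im (picard n T z s))"
  proof (induction n)
    case (Suc n)
    have w: "continuous_on UNIV (picard n T z)" "\<And>r. picard n T z r \<in> UHP"
      using Suc z by (auto simp: UHP_iff intro: less_le_trans)
    have int: "(\<lambda>r. G r (picard n T z r)) integrable_on {0..T}" by (rule G_path_integrable[OF w]) simp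
    have "continuous_on UNIV (\<lambda>s. integral {max 0 (min T s)..T} (\<lambda>r. G r (picard n T z r)))"
      by (rule continuous_on_compose2[OF indefinite_integral_continuous_1'[OF int]])
        (use T in \<open>auto intro!: continuous_intros\<close>)
    then have "continuous_on UNIV (picard (Suc n) T z)"
      by (simp add: continuous_on_diff)
    moreover have "Im z \<le> Im (picard (Suc n) T z s)" for s
      using integral_G_Im_nonpos[OF w, of "max 0 (min T s)" T] by simp
    ultimately show ?case by blast
  qed auto
  then show "continuous_on UNIV (picard n T z)" "Im z \<le> Im (picard n T z s)" by auto
qed

lemma picard_UHP: "0 \<le> T \<Longrightarrow> z \<in> UHP \<Longrightarrow> picard n T z s \<in> UHP"
  using picard_props(2)[of T z n s] by (simp add: UHP_iff)

text \<open>The exponential weight makes each iteration step contract by the factor \<open>1/2\<close> on all of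
  \<open>{0..T}\<close>, however large \<open>T\<close> is.\<close>

lemma picard_step:
  assumes T: "0 \<le> T" and \<epsilon>: "0 < \<epsilon>" "\<epsilon> \<le> Im z"
  shows "cmod (picard (Suc n) T z s - picard n T z s) \<le> T / \<epsilon> * (1/2) ^ n * exp (2 / \<epsilon>\<^sup>2 * (T - max 0 (min T s)))"
proof (induction n arbitrary: s)
  case 0
  have z: "z \<in> UHP" using \<epsilon> by (simp add: UHP_iff)
  define c where "c = max 0 (min T s)"
  have c: "0 \<le> c" "c \<le> T" using T by (auto simp: c_def)
  have "cmod (picard (Suc 0) T z s - picard 0 T z s) = cmod (integral {c..T} (\<lambda>r. G r z))"
    by (simp add: c_def)
  also have "\<dots> \<le> (T - c) / \<epsilon>"
    by (rule integral_G_bound[OF _ _ c \<epsilon>(1)]) (use z \<epsilon> in auto)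
  also have "\<dots> \<le> T / \<epsilon> * exp (2 / \<epsilon>\<^sup>2 * (T - c))"
  proof -
    have "(T - c) / \<epsilon> * 1 \<le> T / \<epsilon> * exp (2 / \<epsilon>\<^sup>2 * (T - c))"
      using c \<epsilon> T by (intro mult_mono divide_right_mono) auto
    then show ?thesis by simp
  qed
  finally show ?case by (simp add: c_def)
next
  case (Suc n)
  have z: "z \<in> UHP" using \<epsilon> by (simp add: UHP_iff)
  define c where "c = max 0 (min T s)"
  have c: "0 \<le> c" "c \<le> T" using T by (auto simp: c_def)
  define K where "K = T / \<epsilon> * (1/2) ^ n"
  \<comment> \<open>Lipschitz constant of the field on heights at least \<open>\<epsilon>\<close>.
    The weight has rate \<open>2 * L\<close>, so integrating it contributes
    \<open>1 / (2 * L)\<close>, and the product with \<open>L\<close> is the contraction factor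
    \<open>1/2\<close>.\<close>
  define L where "L = 1 / \<epsilon>\<^sup>2"
  have L: "L > 0" using \<epsilon> by (simp add: L_def)
  have K: "K \<ge> 0" using T \<epsilon> by (simp add: K_def)
  let ?u = "picard (Suc n) T z" and ?v = "picard n T z"
  have int: "(\<lambda>r. G r (?u r)) integrable_on {c..T}" "(\<lambda>r. G r (?v r)) integrable_on {c..T}"
    using c by (auto intro!: G_path_integrable picard_props picard_UHP T z simp del: picard.simps)
  have eint: "((\<lambda>r. exp (2 * L * (T - r))) has_integral (exp (2 * L * (T - c)) - 1) / (2 * L)) {c..T}"
  proof -
    have "((\<lambda>r. exp (2 * L * (T - r))) has_integral (- exp (2 * L * (T - T)) / (2 * L)) - (- exp (2 * L * (T - c)) / (2 * L))) {c..T}"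
      by (rule fundamental_theorem_of_calculus[OF c(2)])
        (use L in \<open>auto intro!: derivative_eq_intros simp flip: has_real_derivative_iff_has_vector_derivative\<close>)
    moreover have "(- exp (2 * L * (T - T)) / (2 * L)) - (- exp (2 * L * (T - c)) / (2 * L)) = (exp (2 * L * (T - c)) - 1) / (2 * L)"
      by (simp add: diff_divide_distrib)
    ultimately show ?thesis by simp
  qed
  have "picard (Suc (Suc n)) T z s - picard (Suc n) T z s
     = - (integral {c..T} (\<lambda>r. G r (?u r)) - integral {c..T} (\<lambda>r. G r (?v r)))"
    unfolding picard.simps(2)[of "Suc n"] picard.simps(2)[of n T z s] c_def by simp
  then have "cmod (picard (Suc (Suc n)) T z s - picard (Suc n) T z s)
     = cmod (integral {c..T} (\<lambda>r. G r (?u r)) - integral {c..T} (\<lambda>r. G r (?v r)))"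
    by (simp only: norm_minus_cancel)
  also have "\<dots> = cmod (integral {c..T} (\<lambda>r. G r (?u r) - G r (?v r)))"
    using integral_diff[OF int] by simp
  also have "\<dots> \<le> integral {c..T} (\<lambda>r. L * K * exp (2 * L * (T - r)))"
  proof (rule integral_norm_bound_integral)
    show "(\<lambda>r. G r (?u r) - G r (?v r)) integrable_on {c..T}" by (rule integrable_diff[OF int])
    show "(\<lambda>r. L * K * exp (2 * L * (T - r))) integrable_on {c..T}"
      using eint by (intro integrable_on_mult_right) blast
    fix r assume r: "r \<in> {c..T}"
    have "cmod (G r (?u r) - G r (?v r)) \<le> cmod (?u r - ?v r) / \<epsilon>\<^sup>2"
      using r c picard_props(2)[OF T z, of "Suc n" r] picard_props(2)[OF T z, of n r] \<epsilon>
      by (intro G_diff_bound) (auto simp del: picard.simps)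
    also have "\<dots> \<le> (K * exp (2 / \<epsilon>\<^sup>2 * (T - max 0 (min T r)))) / \<epsilon>\<^sup>2"
      using Suc.IH[of r] by (intro divide_right_mono) (auto simp: K_def simp del: picard.simps)
    also have "max 0 (min T r) = r" using r c by auto
    finally show "cmod (G r (?u r) - G r (?v r)) \<le> L * K * exp (2 * L * (T - r))" by (simp add: L_def mult_ac)
  qed
  also have "\<dots> = L * K * ((exp (2 * L * (T - c)) - 1) / (2 * L))"
    using integral_unique[OF eint] by simp
  also have "\<dots> = K / 2 * (exp (2 * L * (T - c)) - 1)" using L by (simp add: field_simps)
  also have "\<dots> \<le> K / 2 * exp (2 * L * (T - c))" using K by (intro mult_left_mono) auto
  finally show ?case by (simp add: K_def L_def c_def mult_ac del: picard.simps)
qed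

text \<open>Telescoping series for the limit of the iterates, the form to which the Weierstrass test
  applies.\<close>

definition loewner_flow :: "real \<Rightarrow> complex \<Rightarrow> real \<Rightarrow> complex" where
  "loewner_flow T z s = z + (\<Sum>i. picard (Suc i) T z s - picard i T z s)"

text \<open>Uniformity in \<open>s\<close> gives continuity of the limit path; uniformity in
  \<open>z\<close> on \<open>\<epsilon> \<le> Im z\<close> gives holomorphy.\<close>

lemma picard_uniform_limit:
  assumes T: "0 \<le> T" and \<epsilon>: "0 < \<epsilon>"
  shows "uniform_limit ({z. \<epsilon> \<le> Im z} \<times> UNIV) (\<lambda>n (z, s). picard n T z s) (\<lambda>(z, s). loewner_flow T z s) sequentially"
proof -
  define M where "M = (\<lambda>n::nat. T / \<epsilon> * exp (2 / \<epsilon>\<^sup>2 * T) * (1/2) ^ n)"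
  let ?f = "\<lambda>i (z, s). picard (Suc i) T z s - picard i T z s"
  have "uniform_limit ({z. \<epsilon> \<le> Im z} \<times> UNIV) (\<lambda>n x. \<Sum>i<n. ?f i x) (\<lambda>x. \<Sum>i. ?f i x) sequentially"
  proof (rule Weierstrass_m_test)
    show "summable M" unfolding M_def by (intro summable_mult summable_geometric) simp
    fix n and x :: "complex \<times> real" assume "x \<in> {z. \<epsilon> \<le> Im z} \<times> UNIV"
    then obtain z s where x: "x = (z, s)" "\<epsilon> \<le> Im z" by (cases x) auto
    have "cmod (picard (Suc n) T z s - picard n T z s) \<le> T / \<epsilon> * (1/2) ^ n * exp (2 / \<epsilon>\<^sup>2 * (T - max 0 (min T s)))"
      by (rule picard_step[OF T \<epsilon> x(2)])
    also have "\<dots> \<le> T / \<epsilon> * (1/2) ^ n * exp (2 / \<epsilon>\<^sup>2 * T)"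
      using T \<epsilon> by (intro mult_left_mono) (auto intro!: divide_right_mono mult_left_mono)
    finally show "cmod (?f n x) \<le> M n" by (simp add: x M_def mult_ac del: picard.simps)
  qed
  then have "uniform_limit ({z. \<epsilon> \<le> Im z} \<times> UNIV) (\<lambda>n x. fst x + (\<Sum>i<n. ?f i x)) (\<lambda>x. fst x + (\<Sum>i. ?f i x)) sequentially"
    by (intro uniform_limit_add uniform_limit_const)
  moreover have "fst x + (\<Sum>i<n. ?f i x) = (\<lambda>(z, s). picard n T z s) x" for n x
    using sum_lessThan_telescope[of "\<lambda>i. picard i T (fst x) (snd x)" n]
    by (cases x) (simp del: picard.simps(2))
  moreover have "fst x + (\<Sum>i. ?f i x) = (\<lambda>(z, s). loewner_flow T z s) x" for x
    by (cases x) (simp add: loewner_flow_def del: picard.simps)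
  ultimately show ?thesis by (simp only: case_prod_unfold)
qed

lemma picard_limit:
  assumes T: "0 \<le> T" and z: "z \<in> UHP"
  shows "uniform_limit UNIV (\<lambda>n. picard n T z) (loewner_flow T z) sequentially" "(\<lambda>n. picard n T z s) \<longlonglongrightarrow> loewner_flow T z s"
proof -
  have "uniform_limit ((\<lambda>s. (z, s)) ` UNIV) (\<lambda>n (z, s). picard n T z s) (\<lambda>(z, s). loewner_flow T z s) sequentially"
    by (rule uniform_limit_on_subset[OF picard_uniform_limit[OF T, of "Im z"]]) (use z in \<open>auto simp: UHP_iff\<close>)
  then show u: "uniform_limit UNIV (\<lambda>n. picard n T z) (loewner_flow T z) sequentially"
    by (simp add: uniform_limit_iff)
  show "(\<lambda>n. picard n T z s) \<longlonglongrightarrow> loewner_flow T z s" by (rule tendsto_uniform_limitI[OF u]) simp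
qed

text \<open>The integral equation passes to the limit by dominated convergence: the iterates never
  sink below height \<open>Im z\<close>, so the field along them is bounded by
  \<open>1 / Im z\<close>.\<close>

lemma loewner_flow:
  assumes T: "0 \<le> T" and z: "z \<in> UHP"
  shows "flow T (loewner_flow T z)" "loewner_flow T z T = z" "Im z \<le> Im (loewner_flow T z s)"
proof -
  let ?w = "loewner_flow T z"
  have cont: "continuous_on UNIV ?w"
    by (rule uniform_limit_theorem[OF _ picard_limit(1)[OF T z]]) (use picard_props(1)[OF T z] in auto)
  show Im: "Im z \<le> Im (?w s)" for s
  proof (rule tendsto_le[OF sequentially_bot])
    show "(\<lambda>n. Im (picard n T z s)) \<longlonglongrightarrow> Im (?w s)" by (intro tendsto_intros picard_limit(2) T z)
    show "\<forall>\<^sub>F n in sequentially. Im z \<le> Im (picard n T z s)" using picard_props(2)[OF T z] by simp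
  qed auto
  have U: "?w s \<in> UHP" for s using Im[of s] z by (simp add: UHP_iff)
  have int: "(\<lambda>r. G r (?w r)) integrable_on {a..b}" if "0 \<le> a" for a b
    by (rule G_path_integrable[OF cont U that])
  have eq: "?w s = z - integral {s..T} (\<lambda>r. G r (?w r))" if s: "0 \<le> s" "s \<le> T" for s
  proof -
    have "(\<lambda>n. integral {s..T} (\<lambda>r. G r (picard n T z r))) \<longlonglongrightarrow> integral {s..T} (\<lambda>r. G r (?w r))"
    proof (rule dominated_convergence(2))
      show "(\<lambda>r. G r (picard n T z r)) integrable_on {s..T}" for n
        using s by (intro G_path_integrable picard_props picard_UHP T z)
      show "(\<lambda>r. 1 / Im z) integrable_on {s..T}" by (rule integrable_const_ivl)
      fix r assume r: "r \<in> {s..T}"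
      show "norm (G r (picard n T z r)) \<le> 1 / Im z" for n
      proof -
        have "cmod (G r (picard n T z r)) \<le> 1 / Im (picard n T z r)"
          using r s by (intro G_bound picard_UHP T z) auto
        also have "\<dots> \<le> 1 / Im z"
          using z picard_props(2)[OF T z, of n r] by (intro divide_left_mono) (auto simp: UHP_iff)
        finally show ?thesis .
      qed
      have "isCont (G r) (?w r)"
        using holomorphic_on_imp_continuous_on[OF G_holomorphic[of r]] open_UHP U r s continuous_on_eq_continuous_at
        by (metis atLeastAtMost_iff order_trans)
      then show "(\<lambda>n. G r (picard n T z r)) \<longlonglongrightarrow> G r (?w r)"
        using picard_limit(2)[OF T z] by (rule isCont_tendsto_compose)
    qed
    then have "(\<lambda>n. z - integral {s..T} (\<lambda>r. G r (picard n T z r))) \<longlonglongrightarrow> z - integral {s..T} (\<lambda>r. G r (?w r))"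
      by (intro tendsto_intros)
    moreover have "z - integral {s..T} (\<lambda>r. G r (picard n T z r)) = picard (Suc n) T z s" for n
      using s by (simp add: max_absorb2)
    ultimately have "(\<lambda>n. picard (Suc n) T z s) \<longlonglongrightarrow> z - integral {s..T} (\<lambda>r. G r (?w r))"
      by (simp only:)
    then show ?thesis by (rule LIMSEQ_unique[OF LIMSEQ_Suc[OF picard_limit(2)[OF T z]]])
  qed
  show "?w T = z" using eq[of T] T by simp
  have "?w s' - ?w s = integral {s..s'} (\<lambda>r. G r (?w r))" if "0 \<le> s" "s \<le> s'" "s' \<le> T" for s s'
  proof -
    have "?w s' - ?w s = integral {s..T} (\<lambda>r. G r (?w r)) - integral {s'..T} (\<lambda>r. G r (?w r))"
      using eq[of s] eq[of s'] that by simp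
    also have "\<dots> = integral {s..s'} (\<lambda>r. G r (?w r))"
      by (subst Henstock_Kurzweil_Integration.integral_combine[OF that(2,3) int[OF that(1)], symmetric]) simp
    finally show ?thesis .
  qed
  then show "flow T ?w" using cont U by (simp add: flow_def)
qed

lemma loewner_flow_UHP: "0 \<le> T \<Longrightarrow> z \<in> UHP \<Longrightarrow> loewner_flow T z s \<in> UHP"
  using loewner_flow(1) flowD(2) by blast

lemma picard_holomorphic:
  assumes T: "0 \<le> T"
  shows "(\<lambda>z. picard n T z s) holomorphic_on UHP"
proof (induction n arbitrary: s)
  case (Suc n)
  have "(\<lambda>z. integral {max 0 (min T s)..T} (\<lambda>r. G r (picard n T z r))) holomorphic_on UHP"
  proof (rule holomorphic_integral[OF open_UHP])
    fix r assume r: "r \<in> {max 0 (min T s)..T}"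
    have "(G r \<circ> (\<lambda>z. picard n T z r)) holomorphic_on UHP"
      by (rule holomorphic_on_compose_gen[OF Suc.IH G_holomorphic]) (use r picard_UHP[OF T] in auto)
    then show "(\<lambda>z. G r (picard n T z r)) holomorphic_on UHP" by (simp add: comp_def)
  next
    show "(\<lambda>r. G r (picard n T z r)) integrable_on {max 0 (min T s)..T}" if "z \<in> UHP" for z
      by (intro G_path_integrable picard_props picard_UHP T that) simp
    show "\<exists>d>0. \<exists>B. ball z0 d \<subseteq> UHP \<and> (\<forall>r\<in>{max 0 (min T s)..T}. \<forall>z\<in>ball z0 d. cmod (G r (picard n T z r)) \<le> B)"
      if z0: "z0 \<in> UHP" for z0
    proof (intro exI conjI ballI)
      show d: "Im z0 / 2 > 0" using z0 by (simp add: UHP_iff)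
      have Im: "Im z0 / 2 \<le> Im z" if "z \<in> ball z0 (Im z0 / 2)" for z
        using that abs_Im_le_cmod[of "z0 - z"] by (auto simp: dist_norm)
      then show "ball z0 (Im z0 / 2) \<subseteq> UHP" using d unfolding UHP_iff subset_iff by (meson less_le_trans)
      fix r z assume r: "r \<in> {max 0 (min T s)..T}" and z: "z \<in> ball z0 (Im z0 / 2)"
      have zU: "z \<in> UHP" using Im[OF z] d by (simp add: UHP_iff)
      have "cmod (G r (picard n T z r)) \<le> 1 / Im (picard n T z r)"
        using r by (intro G_bound picard_UHP T zU) auto
      also have "\<dots> \<le> 1 / (Im z0 / 2)"
        using Im[OF z] d picard_props(2)[OF T zU, of n r] by (intro divide_left_mono) auto
      finally show "cmod (G r (picard n T z r)) \<le> 1 / (Im z0 / 2)" .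
    qed
  qed
  then show ?case by (auto intro!: holomorphic_intros)
qed (auto intro!: holomorphic_intros)

lemma loewner_flow_holomorphic:
  assumes T: "0 \<le> T"
  shows "(\<lambda>z. loewner_flow T z s) holomorphic_on UHP"
proof (rule holomorphic_uniform_sequence[OF open_UHP picard_holomorphic[OF T]])
  fix z0 assume z0: "z0 \<in> UHP"
  show "\<exists>d>0. cball z0 d \<subseteq> UHP \<and> uniform_limit (cball z0 d) (\<lambda>n z. picard n T z s) (\<lambda>z. loewner_flow T z s) sequentially"
  proof (intro exI conjI)
    show d: "Im z0 / 2 > 0" using z0 by (simp add: UHP_iff)
    have Im: "Im z0 / 2 \<le> Im z" if "z \<in> cball z0 (Im z0 / 2)" for z
      using that abs_Im_le_cmod[of "z0 - z"] by (auto simp: dist_norm)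
    then show "cball z0 (Im z0 / 2) \<subseteq> UHP" using d unfolding UHP_iff subset_iff by (meson less_le_trans)
    have "uniform_limit ((\<lambda>z. (z, s)) ` cball z0 (Im z0 / 2)) (\<lambda>n (z, s). picard n T z s) (\<lambda>(z, s). loewner_flow T z s) sequentially"
      by (rule uniform_limit_on_subset[OF picard_uniform_limit[OF T d]]) (use Im in auto)
    then show "uniform_limit (cball z0 (Im z0 / 2)) (\<lambda>n z. picard n T z s) (\<lambda>z. loewner_flow T z s) sequentially"
      by (simp add: uniform_limit_iff)
  qed
qed

lemma loewner_flow_semigroup:
  assumes "0 \<le> a" "a \<le> s" "s \<le> t" and z: "z \<in> UHP"
  shows "loewner_flow t z a = loewner_flow s (loewner_flow t z s) a"
proof (rule flow_unique[of s _ _ s])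
  have t: "0 \<le> t" and s: "0 \<le> s" using assms by auto
  show "flow s (loewner_flow t z)" by (rule flow_mono[OF loewner_flow(1)[OF t z] assms(3)])
  show "flow s (loewner_flow s (loewner_flow t z s))"
    by (rule loewner_flow(1)[OF s loewner_flow_UHP[OF t z]])
  show "loewner_flow t z s = loewner_flow s (loewner_flow t z s) s"
    using loewner_flow(2)[OF s loewner_flow_UHP[OF t z]] by simp
qed (use assms in auto)

section \<open>Transition maps and their capacity\<close>

definition loewner_map :: "real \<Rightarrow> real \<Rightarrow> complex \<Rightarrow> complex" where
  "loewner_map s t = restrict (\<lambda>z. loewner_flow t z s) upper_half_plane"

lemma loewner_map_eq: "z \<in> UHP \<Longrightarrow> loewner_map s t z = loewner_flow t z s"
  by (simp add: loewner_map_def)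

lemma loewner_map_dist:
  assumes "0 \<le> s" "s \<le> t" "z \<in> UHP"
  shows "cmod (loewner_flow t z s - z) \<le> (t - s) / Im z"
  using flow_dist[OF loewner_flow(1), of t z s t] loewner_flow(2)[of t z] assms by (simp add: norm_minus_commute)

lemma loewner_map_hydro:
  assumes "0 \<le> s" "s \<le> t"
  shows "loewner_map s t \<in> hydro_maps"
proof (rule hydroI(1))
  have t: "0 \<le> t" using assms by simp
  show "loewner_map s t \<in> extensional UHP" by (simp add: loewner_map_def)
  show "inj_on (loewner_map s t) UHP"
  proof (rule inj_onI)
    fix a b assume ab: "a \<in> UHP" "b \<in> UHP" "loewner_map s t a = loewner_map s t b"
    have "loewner_flow t a t = loewner_flow t b t"
      by (rule flow_unique[OF loewner_flow(1)[OF t ab(1)] loewner_flow(1)[OF t ab(2)], of s])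
        (use ab assms in \<open>auto simp: loewner_map_eq\<close>)
    then show "a = b" using loewner_flow(2) t ab by simp
  qed
  show "loewner_map s t holomorphic_on UHP"
    by (rule holomorphic_transform[OF loewner_flow_holomorphic[OF t, of s]]) (simp add: loewner_map_eq)
  show "loewner_map s t ` UHP \<subseteq> UHP" using loewner_flow_UHP[OF t] by (auto simp: loewner_map_eq)
  show "cmod (loewner_map s t z - z) * Im z \<le> t - s" if "z \<in> UHP" for z
    using loewner_map_dist[OF assms that] that by (simp add: loewner_map_eq UHP_iff field_simps)
qed

lemma loewner_map_compose:
  assumes "0 \<le> a" "a \<le> s" "s \<le> t"
  shows "loewner_map a t = compose UHP (loewner_map a s) (loewner_map s t)"
  using loewner_flow_semigroup[OF assms] loewner_flow_UHP[of t] assms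
  by (auto simp: loewner_map_def compose_def fun_eq_iff restrict_def)

text \<open>The capacity is the limit of the integrals of \<open>\<i> * y * G r (w r)\<close> over
  \<open>{0..t}\<close>. The integrand is bounded by 1 because the flow does not sink below height
  \<open>y\<close>, and tends to 1 because the flow stays within \<open>t\<close> of
  \<open>\<i> * y\<close>.\<close>

lemma hcap_loewner_map:
  assumes t: "0 \<le> t"
  shows "hcap (loewner_map 0 t) = t"
proof -
  define y where "y = (\<lambda>n. real (Suc n))"
  have y: "filterlim y at_top sequentially" unfolding y_def by (rule filterlim_real_Suc)
  have y1: "y n \<ge> 1" for n by (simp add: y_def)
  have yU: "\<i> * y n \<in> UHP" for n by (simp add: UHP_iff y_def)
  define w where "w = (\<lambda>n. loewner_flow t (\<i> * y n))"
  have w: "flow t (w n)" "w n t = \<i> * y n" for n using loewner_flow[OF t yU] by (auto simp: w_def)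
  have Imw: "y n \<le> Im (w n s)" for n s using loewner_flow(3)[OF t yU, of n s] by (simp add: w_def)
  have l1: "(\<lambda>n. \<i> * y n * (\<i> * y n - loewner_map 0 t (\<i> * y n))) \<longlonglongrightarrow> of_real (hcap (loewner_map 0 t))"
    by (rule hcap_seq[OF loewner_map_hydro[OF order_refl t] y, of _ 0]) (auto simp: yU)
  have eq: "\<i> * y n * (\<i> * y n - loewner_map 0 t (\<i> * y n)) = integral {0..t} (\<lambda>r. \<i> * y n * G r (w n r))" for n
    using flowD(3)[OF w(1)[of n], of 0 t] t w(2)[of n] by (simp add: loewner_map_eq[OF yU] w_def)
  have "(\<lambda>n. integral {0..t} (\<lambda>r. \<i> * y n * G r (w n r))) \<longlonglongrightarrow> integral {0..t} (\<lambda>r. 1)"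
  proof (rule dominated_convergence(2))
    show "(\<lambda>r. \<i> * y n * G r (w n r)) integrable_on {0..t}" for n
      by (intro integrable_on_mult_right G_path_integrable flowD(1,2)[OF w(1)] order_refl)
    show "(\<lambda>r. 1::real) integrable_on {0..t}" by (rule integrable_const_ivl)
    fix r assume r: "r \<in> {0..t}"
    show "norm (\<i> * y n * G r (w n r)) \<le> 1" for n
    proof -
      have "y n * cmod (G r (w n r)) \<le> y n * (1 / Im (w n r))"
        using G_bound[OF _ flowD(2)[OF w(1)], of r n r] r y1[of n] by (intro mult_left_mono) auto
      also have "\<dots> \<le> 1" using Imw[of n r] y1[of n] by (simp add: divide_le_eq)
      finally show ?thesis using y1[of n] by (simp add: norm_mult)
    qed
    show "(\<lambda>n. \<i> * y n * G r (w n r)) \<longlonglongrightarrow> 1"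
    proof (rule G_asymptotic[OF _ y])
      show "w n r \<in> UHP" for n by (rule flowD(2)[OF w(1)])
      show "cmod (w n r - \<i> * y n) \<le> t" for n
      proof -
        have "cmod (w n r - \<i> * y n) \<le> (t - r) / Im (\<i> * y n)"
          unfolding w_def using r by (intro loewner_map_dist yU) auto
        also have "\<dots> = (t - r) / y n" by simp
        also have "\<dots> \<le> (t - r) / 1" using r y1[of n] by (intro divide_left_mono) auto
        finally show ?thesis using r by simp
      qed
    qed (use r in auto)
  qed
  then have "(\<lambda>n. \<i> * y n * (\<i> * y n - loewner_map 0 t (\<i> * y n))) \<longlonglongrightarrow> of_real t"
    using t by (simp add: eq scaleR_conv_of_real)
  then have "complex_of_real (hcap (loewner_map 0 t)) = of_real t" using l1 LIMSEQ_unique by blast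
  then show ?thesis by simp
qed

lemma loewner_family:
  shows "chordal_Loewner_family (loewner_map 0 ` {0..})"
    and "\<And>t. t \<ge> 0 \<Longrightarrow> family_at (loewner_map 0 ` {0..}) t = loewner_map 0 t"
proof -
  have sub: "subord (loewner_map 0 t) (loewner_map 0 s)" if "0 \<le> s" "s \<le> t" for s t
    unfolding subord_def using loewner_map_compose[OF order_refl that] loewner_map_hydro[OF that] by blast
  show "chordal_Loewner_family (loewner_map 0 ` {0..})" "\<And>t. t \<ge> 0 \<Longrightarrow> family_at (loewner_map 0 ` {0..}) t = loewner_map 0 t"
    using Loewner_familyI[of "loewner_map 0", OF loewner_map_hydro[OF order_refl] hcap_loewner_map sub] by auto
qed

end

section \<open>Differentiation in time and uniqueness\<close>

text \<open>Schwarz-Pick together with \<open>Im (f x) \<le> A * Im x\<close> turns hyperbolic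
  contraction into a Euclidean bound on heights at least \<open>\<epsilon>\<close>.\<close>

lemma hydro_Lipschitz:
  assumes f: "f \<in> hydro_maps" and \<epsilon>: "\<epsilon> > 0" "\<epsilon> \<le> Im a" "\<epsilon> \<le> Im b"
  shows "cmod (f a - f b) \<le> (1 + hcap f / \<epsilon>\<^sup>2) * cmod (a - b)"
proof -
  define A where "A = 1 + hcap f / \<epsilon>\<^sup>2"
  have A: "A \<ge> 1" using hcap_nonneg[OF f] by (simp add: A_def)
  have ab: "a \<in> UHP" "b \<in> UHP" using \<epsilon> by (auto simp: UHP_iff)
  have Im: "Im (f x) \<le> A * Im x" if x: "x \<in> UHP" "\<epsilon> \<le> Im x" for x
  proof -
    have "Im (f x) - Im x \<le> cmod (f x - x)" using abs_Im_le_cmod[of "f x - x"] by simp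
    also have "\<dots> \<le> hcap f / Im x" by (rule hydro_dist_le[OF f x(1)])
    also have "\<dots> = hcap f / (Im x)\<^sup>2 * Im x" using x \<epsilon> by (simp add: power2_eq_square)
    also have "\<dots> \<le> hcap f / \<epsilon>\<^sup>2 * Im x"
      using x \<epsilon> hcap_nonneg[OF f] by (intro mult_right_mono divide_left_mono power_mono) auto
    finally show ?thesis by (simp add: A_def distrib_right)
  qed
  have "(cmod (f a - f b))\<^sup>2 * (Im a * Im b) \<le> (cmod (a - b))\<^sup>2 * (Im (f a) * Im (f b))"
    using Schwarz_Pick_UHP[OF hydro_mapsD(2,4)[OF f] ab] by (simp add: mult.assoc)
  also have "\<dots> \<le> (cmod (a - b))\<^sup>2 * ((A * Im a) * (A * Im b))"
    using Im ab \<epsilon> A hydro_in_UHP[OF f] by (intro mult_left_mono mult_mono) (auto simp: UHP_iff less_imp_le)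
  also have "\<dots> = (A * cmod (a - b))\<^sup>2 * (Im a * Im b)" by (simp add: power2_eq_square mult_ac)
  finally have "(cmod (f a - f b))\<^sup>2 \<le> (A * cmod (a - b))\<^sup>2"
    using ab by (simp add: UHP_iff)
  then have "cmod (f a - f b) \<le> A * cmod (a - b)" by (rule power2_le_imp_le) (use A in auto)
  then show ?thesis by (simp add: A_def)
qed

text \<open>A later map is the earlier one after some \<open>k\<close> of capacity
  \<open>b - a\<close>, which moves \<open>z\<close> by at most \<open>(b - a) / \<epsilon>\<close>;
  \<open>hydro_Lipschitz\<close> supplies the other factor.\<close>

lemma family_at_dist:
  assumes F: "chordal_Loewner_family F" and st: "0 \<le> s" "s \<le> T" "0 \<le> t" "t \<le> T" and \<epsilon>: "\<epsilon> > 0" "\<epsilon> \<le> Im z"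
  shows "cmod (family_at F s z - family_at F t z) \<le> \<bar>s - t\<bar> * ((1 + T / \<epsilon>\<^sup>2) / \<epsilon>)"
proof -
  have z: "z \<in> UHP" using \<epsilon> by (simp add: UHP_iff)
  have *: "cmod (family_at F b z - family_at F a z) \<le> (b - a) * ((1 + T / \<epsilon>\<^sup>2) / \<epsilon>)" if ab: "0 \<le> a" "a \<le> b" "b \<le> T" for a b
  proof -
    obtain k where k: "k \<in> hydro_maps" "family_at F b = compose UHP (family_at F a) k" "hcap k = b - a"
      using family_at_compose[OF F ab(1,2)] .
    have kz: "cmod (k z - z) \<le> (b - a) / \<epsilon>"
    proof -
      have "cmod (k z - z) \<le> (b - a) / Im z" using hydro_dist_le[OF k(1) z] k(3) by simp
      also have "\<dots> \<le> (b - a) / \<epsilon>" using ab \<epsilon> by (intro divide_left_mono) auto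
      finally show ?thesis .
    qed
    have "cmod (family_at F a (k z) - family_at F a z) \<le> (1 + hcap (family_at F a) / \<epsilon>\<^sup>2) * cmod (k z - z)"
      using hydro_strong(1)[OF k(1) z] \<epsilon> by (intro hydro_Lipschitz family_at_hydro[OF F ab(1)]) auto
    also have "\<dots> \<le> (1 + T / \<epsilon>\<^sup>2) * ((b - a) / \<epsilon>)"
      using kz ab \<epsilon> by (intro mult_mono) (auto simp: family_at(2)[OF F] divide_right_mono)
    finally show ?thesis using k(2) z by (simp add: compose_def mult_ac)
  qed
  show ?thesis
  proof (cases "t \<le> s")
    case True
    then show ?thesis using *[of t s] st by simp
  next
    case False
    then show ?thesis using *[of s t] st by (simp add: norm_minus_commute)
  qed
qed

text \<open>The expansion uses the derivative at time \<open>t\<close> but the map at a nearby time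
  \<open>s\<close>. The difference of the two maps is of order \<open>\<bar>s - t\<bar>\<close>, and
  the Cauchy estimate transfers this to its increments in space.\<close>

lemma family_at_increment:
  assumes F: "chordal_Loewner_family F" and t: "0 \<le> t" and p: "p \<in> UHP" and e: "e > 0"
  obtains d where "d > 0" "\<And>s \<zeta>. 0 \<le> s \<Longrightarrow> \<bar>s - t\<bar> < d \<Longrightarrow> cmod (\<zeta> - p) < d \<Longrightarrow>
    cmod (family_at F s \<zeta> - family_at F s p - deriv (family_at F t) p * (\<zeta> - p)) \<le> e * cmod (\<zeta> - p)"
proof -
  define r where "r = Im p / 2"
  have r: "r > 0" using p by (simp add: r_def UHP_iff)
  have Im: "r \<le> Im z" if "z \<in> ball p r" for z
    using that abs_Im_le_cmod[of "p - z"] by (auto simp: dist_norm r_def)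
  have sub: "ball p r \<subseteq> UHP" using Im r unfolding UHP_iff subset_iff by (meson less_le_trans)
  define T where "T = t + 1"
  define B where "B = (1 + T / r\<^sup>2) / r"
  have B: "B > 0" using t r by (auto simp: B_def T_def intro!: divide_pos_pos add_pos_nonneg)
  have "(family_at F t has_field_derivative deriv (family_at F t) p) (at p)"
    using hydro_mapsD(2)[OF family_at_hydro[OF F t]] open_UHP p by (rule holomorphic_derivI)
  then obtain d1 where d1: "d1 > 0" "\<And>\<zeta>. cmod (\<zeta> - p) < d1 \<Longrightarrow>
     cmod (family_at F t \<zeta> - family_at F t p - deriv (family_at F t) p * (\<zeta> - p)) \<le> e / 2 * cmod (\<zeta> - p)"
    using e unfolding has_field_derivative_def has_derivative_at_alt by (meson half_gt_zero)
  \<comment> \<open>The last entry limits the contribution of the time difference to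
    \<open>e / 2\<close>; the entry \<open>1\<close> keeps \<open>s\<close> below
    \<open>T = t + 1\<close>.\<close>
  define d where "d = Min {d1, r / 2, 1, e / 2 / (4 * B / r)}"
  have Bpos: "4 * B / r > 0" using B r by simp
  have d: "d > 0" using d1 r e B by (auto simp: d_def)
  have dle: "d \<le> d1" "d \<le> r / 2" "d \<le> 1" "d \<le> e / 2 / (4 * B / r)" by (auto simp: d_def)
  show thesis
  proof (rule that[OF d])
    fix s \<zeta> assume s: "0 \<le> s" "\<bar>s - t\<bar> < d" and \<zeta>: "cmod (\<zeta> - p) < d"
    define g where "g = (\<lambda>z. family_at F s z - family_at F t z)"
    have "cmod (g \<zeta> - g p) \<le> 4 * (\<bar>s - t\<bar> * B) / r * cmod (\<zeta> - p)"
    proof (rule bounded_holomorphic_Lipschitz[of g p r])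
      show "g holomorphic_on ball p r" unfolding g_def
        using hydro_mapsD(2)[OF family_at_hydro[OF F t]] hydro_mapsD(2)[OF family_at_hydro[OF F s(1)]] sub
        by (intro holomorphic_intros) (auto intro: holomorphic_on_subset)
      show "cmod (g z) \<le> \<bar>s - t\<bar> * B" if "z \<in> ball p r" for z
        unfolding g_def B_def using s t dle(3)
        by (intro family_at_dist[OF F] r Im that) (auto simp: T_def)
      show "\<zeta> \<in> ball p (r / 2)" "p \<in> ball p (r / 2)" using \<zeta> dle(2) r by (auto simp: dist_norm norm_minus_commute)
    qed (rule r)
    also have "4 * (\<bar>s - t\<bar> * B) / r = \<bar>s - t\<bar> * (4 * B / r)" by simp
    also have "\<dots> \<le> d * (4 * B / r)" using s Bpos by (intro mult_right_mono) auto
    also have "\<dots> \<le> e / 2" using dle(4) by (simp only: pos_le_divide_eq[OF Bpos])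
    finally have 1: "cmod (g \<zeta> - g p) \<le> e / 2 * cmod (\<zeta> - p)" by (simp add: mult_right_mono)
    have 2: "cmod (family_at F t \<zeta> - family_at F t p - deriv (family_at F t) p * (\<zeta> - p)) \<le> e / 2 * cmod (\<zeta> - p)"
      using \<zeta> dle(1) by (intro d1) simp
    have "family_at F s \<zeta> - family_at F s p - deriv (family_at F t) p * (\<zeta> - p)
      = (g \<zeta> - g p) + (family_at F t \<zeta> - family_at F t p - deriv (family_at F t) p * (\<zeta> - p))"
      by (simp add: g_def)
    then have "cmod (family_at F s \<zeta> - family_at F s p - deriv (family_at F t) p * (\<zeta> - p))
      \<le> cmod (g \<zeta> - g p) + cmod (family_at F t \<zeta> - family_at F t p - deriv (family_at F t) p * (\<zeta> - p))"
      by (simp only: norm_triangle_ineq)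
    then show "cmod (family_at F s \<zeta> - family_at F s p - deriv (family_at F t) p * (\<zeta> - p)) \<le> e * cmod (\<zeta> - p)"
      using 1 2 by simp
  qed
qed

context Loewner_field
begin

lemma G_integral_diff:
  assumes w: "continuous_on UNIV w" "\<And>r. w r \<in> UHP" and ab: "0 \<le> a" "a \<le> b"
    and \<epsilon>: "\<epsilon> > 0" "\<epsilon> \<le> Im z" "\<And>r. r \<in> {a..b} \<Longrightarrow> \<epsilon> \<le> Im (w r)"
    and \<eta>: "\<And>r. r \<in> {a..b} \<Longrightarrow> cmod (w r - z) \<le> \<eta>"
  shows "cmod (integral {a..b} (\<lambda>r. G r (w r)) - integral {a..b} (\<lambda>r. G r z)) \<le> (b - a) * (\<eta> / \<epsilon>\<^sup>2)"
proof -
  have z: "z \<in> UHP" using \<epsilon> by (simp add: UHP_iff)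
  have int: "(\<lambda>r. G r (w r)) integrable_on {a..b}" "(\<lambda>r. G r z) integrable_on {a..b}"
    using G_path_integrable[OF w ab(1)] G_path_integrable[of "\<lambda>_. z", OF _ _ ab(1)] z by auto
  have "integral {a..b} (\<lambda>r. G r (w r)) - integral {a..b} (\<lambda>r. G r z) = integral {a..b} (\<lambda>r. G r (w r) - G r z)"
    by (rule integral_diff[OF int, symmetric])
  also have "cmod \<dots> \<le> integral {a..b} (\<lambda>r. \<eta> / \<epsilon>\<^sup>2)"
  proof (rule integral_norm_bound_integral[OF integrable_diff[OF int] integrable_const_ivl])
    fix r assume r: "r \<in> {a..b}"
    have "cmod (G r (w r) - G r z) \<le> cmod (w r - z) / \<epsilon>\<^sup>2"
      using r ab \<epsilon> by (intro G_diff_bound) auto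
    also have "\<dots> \<le> \<eta> / \<epsilon>\<^sup>2" using \<eta>[OF r] by (simp add: divide_right_mono)
    finally show "cmod (G r (w r) - G r z) \<le> \<eta> / \<epsilon>\<^sup>2" .
  qed
  also have "\<dots> = (b - a) * (\<eta> / \<epsilon>\<^sup>2)" using ab by simp
  finally show ?thesis .
qed

text \<open>The quantifier over \<open>z\<close> stands inside, so that one null set serves all
  points. The conjunct \<open>0 \<le> a\<close> sits in the conclusion: as \<open>t > 0\<close>,
  short intervals stay in the domain of the field, and callers obtain this together with
  \<open>d\<close>.\<close>

definition regular_time :: "real \<Rightarrow> bool" where
  "regular_time t \<longleftrightarrow> t > 0 \<and> (\<forall>z\<in>upper_half_plane. \<forall>e>0. \<exists>d>0. \<forall>a b. a \<le> t \<longrightarrow> t \<le> b \<longrightarrow> b - a < d \<longrightarrow>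
     0 \<le> a \<and> cmod (integral {a..b} (\<lambda>r. G r z) - (b - a) *\<^sub>R G t z) \<le> e * (b - a))"

lemma negligible_not_regular_time: "negligible {t \<in> {0..}. \<not> regular_time t}"
proof -
  obtain D :: "complex set" where D0: "countable D \<and> (\<forall>X. open X \<longrightarrow> X \<noteq> {} \<longrightarrow> (\<exists>d\<in>D. d \<in> X))"
    by (rule exE[OF countable_dense_exists])
  then have D: "countable D" "\<And>X. open X \<Longrightarrow> X \<noteq> {} \<Longrightarrow> \<exists>d\<in>D. d \<in> X" by auto
  \<comment> \<open>Extended by zero to negative times, because
    \<open>Lebesgue_differentiation\<close> asks for integrability on every interval.\<close>
  define f where "f = (\<lambda>z r. if r \<in> {0..} then G r z else 0)"
  have fint: "f z integrable_on {a..b}" if z: "z \<in> UHP" for z a b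
  proof -
    have "(\<lambda>r. G r z) integrable_on {max 0 a..b}"
      using G_path_integrable[of "\<lambda>_. z" "max 0 a" b] z by simp
    moreover have "{0..} \<inter> {a..b} = {max 0 a..b}" by auto
    ultimately show ?thesis unfolding f_def by (simp only: integrable_restrict_Int)
  qed
  have "\<exists>N. negligible N \<and> (\<forall>x e. x \<notin> N \<longrightarrow> e > 0 \<longrightarrow> (\<exists>d>0. \<forall>a b. a \<le> x \<longrightarrow> x \<le> b \<longrightarrow> b - a < d \<longrightarrow>
       cmod (integral {a..b} (f z) - (b - a) *\<^sub>R f z x) \<le> e * (b - a)))" if "z \<in> UHP" for z
    using Lebesgue_differentiation[OF fint[OF that]] by metis
  then obtain N where N: "\<And>z. z \<in> UHP \<Longrightarrow> negligible (N z)"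
    "\<And>z x e. z \<in> UHP \<Longrightarrow> x \<notin> N z \<Longrightarrow> e > 0 \<Longrightarrow> \<exists>d>0. \<forall>a b. a \<le> x \<longrightarrow> x \<le> b \<longrightarrow> b - a < d \<longrightarrow>
       cmod (integral {a..b} (f z) - (b - a) *\<^sub>R f z x) \<le> e * (b - a)"
    by metis
  define N0 where "N0 = {0} \<union> (\<Union>z\<in>D \<inter> UHP. N z)"
  have "negligible N0"
    unfolding N0_def using D(1) N(1)
    by (intro negligible_Un negligible_countable_Union) auto
  moreover have "regular_time t" if t: "t \<ge> 0" "t \<notin> N0" for t
    unfolding regular_time_def
  proof (intro conjI ballI allI impI)
    show t0: "t > 0" using t by (auto simp: N0_def)
    fix z and e :: real assume z: "z \<in> UHP" and e: "e > 0"
    define \<epsilon> where "\<epsilon> = Im z / 2"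
    have \<epsilon>: "\<epsilon> > 0" using z by (simp add: \<epsilon>_def UHP_iff)
    \<comment> \<open>Replacing \<open>z\<close> by a dense point \<open>z'\<close> costs
      \<open>\<eta> / \<epsilon>\<^sup>2\<close> twice, in the integral and in the value at
      \<open>t\<close>. Each cost is at most \<open>e / 3\<close>, and the last third is the error
      at \<open>z'\<close> itself.\<close>
    define \<eta> where "\<eta> = min \<epsilon> (e / 3 * \<epsilon>\<^sup>2)"
    have \<eta>: "\<eta> > 0" using \<epsilon> e by (simp add: \<eta>_def)
    then obtain z' where z': "z' \<in> D" "z' \<in> ball z \<eta>" using D(2)[of "ball z \<eta>"] by auto
    have zz: "cmod (z - z') \<le> \<eta>" using z' by (simp add: dist_norm)
    have Imz': "\<epsilon> \<le> Im z'" using abs_Im_le_cmod[of "z - z'"] zz by (auto simp: \<epsilon>_def \<eta>_def min_def split: if_splits)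
    have z'U: "z' \<in> UHP" using Imz' \<epsilon> by (simp add: UHP_iff)
    have "t \<notin> N z'" using t z' z'U by (auto simp: N0_def)
    then obtain d where d: "d > 0" "\<And>a b. a \<le> t \<Longrightarrow> t \<le> b \<Longrightarrow> b - a < d \<Longrightarrow>
       cmod (integral {a..b} (f z') - (b - a) *\<^sub>R f z' t) \<le> e / 3 * (b - a)"
      using N(2)[OF z'U, of t "e / 3"] e by auto
    show "\<exists>d>0. \<forall>a b. a \<le> t \<longrightarrow> t \<le> b \<longrightarrow> b - a < d \<longrightarrow>
      0 \<le> a \<and> cmod (integral {a..b} (\<lambda>r. G r z) - (b - a) *\<^sub>R G t z) \<le> e * (b - a)"
    proof (rule exI[of _ "min d t"], intro conjI allI impI)
      show "0 < min d t" using d t0 by simp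
      fix a b assume ab: "a \<le> t" "t \<le> b" "b - a < min d t"
      show a: "0 \<le> a" using ab by simp
      have "integral {a..b} (f z') = integral {a..b} (\<lambda>r. G r z')"
        by (rule integral_cong) (use a in \<open>auto simp: f_def\<close>)
      then have 1: "cmod (integral {a..b} (\<lambda>r. G r z') - (b - a) *\<^sub>R G t z') \<le> e / 3 * (b - a)"
        using d(2)[of a b] ab t by (simp add: f_def)
      have 2: "cmod (integral {a..b} (\<lambda>r. G r z) - integral {a..b} (\<lambda>r. G r z')) \<le> (b - a) * (\<eta> / \<epsilon>\<^sup>2)"
        by (rule G_integral_diff[of "\<lambda>_. z"]) (use z a ab \<epsilon> Imz' zz in \<open>auto simp: \<epsilon>_def\<close>)
      have 3: "cmod (G t z - G t z') \<le> \<eta> / \<epsilon>\<^sup>2"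
        using G_diff_bound[of t \<epsilon> z z'] t0 \<epsilon> Imz' divide_right_mono[OF zz, of "\<epsilon>\<^sup>2"] by (simp add: \<epsilon>_def)
      have 4: "\<eta> / \<epsilon>\<^sup>2 \<le> e / 3" using \<epsilon> by (simp add: \<eta>_def divide_le_eq)
      have "integral {a..b} (\<lambda>r. G r z) - (b - a) *\<^sub>R G t z
         = (integral {a..b} (\<lambda>r. G r z) - integral {a..b} (\<lambda>r. G r z')) + (integral {a..b} (\<lambda>r. G r z') - (b - a) *\<^sub>R G t z')
           - (b - a) *\<^sub>R (G t z - G t z')"
        by (simp add: algebra_simps)
      also have "cmod \<dots> \<le> cmod (integral {a..b} (\<lambda>r. G r z) - integral {a..b} (\<lambda>r. G r z'))
         + cmod (integral {a..b} (\<lambda>r. G r z') - (b - a) *\<^sub>R G t z') + cmod ((b - a) *\<^sub>R (G t z - G t z'))"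
        by (intro order_trans[OF norm_triangle_ineq4] add_mono norm_triangle_ineq order_refl)
      also have "\<dots> \<le> (b - a) * (e / 3) + e / 3 * (b - a) + (b - a) * (e / 3)"
        using ab 1 order_trans[OF 2 mult_left_mono[OF 4, of "b - a"]] mult_left_mono[OF order_trans[OF 3 4], of "b - a"]
        by (intro add_mono) auto
      also have "\<dots> = e * (b - a)" by (simp add: field_simps)
      finally show "cmod (integral {a..b} (\<lambda>r. G r z) - (b - a) *\<^sub>R G t z) \<le> e * (b - a)" .
    qed
  qed
  ultimately show ?thesis by (elim negligible_subset) auto
qed

text \<open>Over a short interval a path at distance at most \<open>c * (b - a)\<close> from
  \<open>z\<close> may be frozen at \<open>z\<close>, because the field is Lipschitz in
  space.\<close>

lemma regular_time_path:
  assumes t: "regular_time t" and z: "z \<in> UHP" and e: "e > 0" and c: "c \<ge> 0"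
  obtains d where "d > 0" "\<And>a b w. a \<le> t \<Longrightarrow> t \<le> b \<Longrightarrow> b - a < d \<Longrightarrow> continuous_on UNIV w \<Longrightarrow> (\<And>r. w r \<in> UHP) \<Longrightarrow>
    (\<And>r. r \<in> {a..b} \<Longrightarrow> cmod (w r - z) \<le> c * (b - a)) \<Longrightarrow>
    cmod (integral {a..b} (\<lambda>r. G r (w r)) - (b - a) *\<^sub>R G t z) \<le> e * (b - a)"
proof -
  define \<epsilon> where "\<epsilon> = Im z / 2"
  have \<epsilon>: "\<epsilon> > 0" using z by (simp add: \<epsilon>_def UHP_iff)
  obtain d1 where d1: "d1 > 0" "\<And>a b. a \<le> t \<Longrightarrow> t \<le> b \<Longrightarrow> b - a < d1 \<Longrightarrow>
     0 \<le> a \<and> cmod (integral {a..b} (\<lambda>r. G r z) - (b - a) *\<^sub>R G t z) \<le> e / 2 * (b - a)"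
    using t z e unfolding regular_time_def by (meson half_gt_zero)
  define \<eta> where "\<eta> = min \<epsilon> (e / 2 * \<epsilon>\<^sup>2)"
  have \<eta>: "\<eta> > 0" using \<epsilon> e by (simp add: \<eta>_def)
  define d where "d = min d1 (\<eta> / (c + 1))"
  show thesis
  proof (rule that)
    show "d > 0" using d1 \<eta> c by (simp add: d_def)
    fix a b w
    assume ab: "a \<le> t" "t \<le> b" "b - a < d" and w: "continuous_on UNIV w" "\<And>r. w r \<in> UHP"
      and wz: "\<And>r. r \<in> {a..b} \<Longrightarrow> cmod (w r - z) \<le> c * (b - a)"
    have a: "0 \<le> a" and 1: "cmod (integral {a..b} (\<lambda>r. G r z) - (b - a) *\<^sub>R G t z) \<le> e / 2 * (b - a)"
      using d1(2)[of a b] ab by (auto simp: d_def)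
    have "c * (b - a) \<le> (c + 1) * (b - a)" using ab by (intro mult_right_mono) auto
    also have "\<dots> \<le> (c + 1) * (\<eta> / (c + 1))" using ab c by (intro mult_left_mono) (auto simp: d_def)
    also have "\<dots> = \<eta>" using c by simp
    finally have wz': "cmod (w r - z) \<le> \<eta>" if "r \<in> {a..b}" for r using wz[OF that] by simp
    have 2: "cmod (integral {a..b} (\<lambda>r. G r (w r)) - integral {a..b} (\<lambda>r. G r z)) \<le> (b - a) * (\<eta> / \<epsilon>\<^sup>2)"
    proof (rule G_integral_diff[OF w a _ \<epsilon> _ _ wz'])
      show "\<epsilon> \<le> Im (w r)" if "r \<in> {a..b}" for r
        using abs_Im_le_cmod[of "w r - z"] wz'[OF that] by (auto simp: \<epsilon>_def \<eta>_def min_def split: if_splits)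
    qed (use ab \<epsilon> in \<open>auto simp: \<epsilon>_def\<close>)
    have "\<eta> / \<epsilon>\<^sup>2 \<le> e / 2" using \<epsilon> by (simp add: \<eta>_def divide_le_eq)
    then have 3: "(b - a) * (\<eta> / \<epsilon>\<^sup>2) \<le> (b - a) * (e / 2)" using ab by (intro mult_left_mono) auto
    have "integral {a..b} (\<lambda>r. G r (w r)) - (b - a) *\<^sub>R G t z
       = (integral {a..b} (\<lambda>r. G r (w r)) - integral {a..b} (\<lambda>r. G r z)) + (integral {a..b} (\<lambda>r. G r z) - (b - a) *\<^sub>R G t z)"
      by simp
    also have "cmod \<dots> \<le> (b - a) * (e / 2) + e / 2 * (b - a)"
      by (rule order_trans[OF norm_triangle_ineq add_mono[OF order_trans[OF 2 3] 1]])
    also have "\<dots> = e * (b - a)" by (simp add: field_simps)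
    finally show "cmod (integral {a..b} (\<lambda>r. G r (w r)) - (b - a) *\<^sub>R G t z) \<le> e * (b - a)" .
  qed
qed

end

context Loewner_field
begin

definition loewner_chain :: "(complex \<Rightarrow> complex) set" where
  "loewner_chain = loewner_map 0 ` {0..}"

lemma loewner_chain: "chordal_Loewner_family loewner_chain"
  and family_at_loewner_chain: "t \<ge> 0 \<Longrightarrow> family_at loewner_chain t = loewner_map 0 t"
  unfolding loewner_chain_def using loewner_family by auto

text \<open>With \<open>m\<close> and \<open>M\<close> the smaller and the larger of
  \<open>s\<close> and \<open>t\<close>, the flow \<open>w\<close> with \<open>w M = z\<close> gives
  \<open>f M z = f m \<zeta>\<close> for \<open>\<zeta> = w m\<close>. An increment in time becomes
  an increment in space, with \<open>\<zeta> - z\<close> minus an integral of the field; both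
  one-sided derivatives are treated alike.\<close>

lemma loewner_chain_derivative:
  assumes t: "regular_time t" and z: "z \<in> UHP"
  shows "((\<lambda>s. family_at loewner_chain s z) has_vector_derivative
     - G t z * deriv (family_at loewner_chain t) z) (at t within {0..})"
proof -
  define f where "f = family_at loewner_chain"
  define D where "D = deriv (f t) z"
  have t0: "t > 0" using t by (simp add: regular_time_def)
  have Imz: "Im z > 0" using z by (simp add: UHP_iff)
  have "\<exists>d>0. \<forall>s\<in>{0..}. norm (s - t) < d \<longrightarrow> norm (f s z - f t z - (s - t) *\<^sub>R (- G t z * D)) \<le> e * norm (s - t)"
    if e: "e > 0" for e
  proof -
    \<comment> \<open>The \<open>+ 1\<close> guards against \<open>D = 0\<close>.\<close>
    define e1 where "e1 = e / 2 / (cmod D + 1)"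
    have "cmod D + 1 > 0" by (simp add: add_nonneg_pos)
    then have e1: "e1 > 0" "cmod D * e1 \<le> e / 2"
      using e by (auto simp: e1_def divide_simps mult_left_mono)
    obtain d1 where d1: "d1 > 0" "\<And>s \<zeta>. 0 \<le> s \<Longrightarrow> \<bar>s - t\<bar> < d1 \<Longrightarrow> cmod (\<zeta> - z) < d1 \<Longrightarrow>
      cmod (f s \<zeta> - f s z - D * (\<zeta> - z)) \<le> e / 2 * Im z * cmod (\<zeta> - z)"
      using family_at_increment[OF loewner_chain less_imp_le[OF t0] z, of "e / 2 * Im z"] e Imz
      unfolding f_def D_def by auto
    obtain d2 where d2: "d2 > 0" "\<And>a b w. a \<le> t \<Longrightarrow> t \<le> b \<Longrightarrow> b - a < d2 \<Longrightarrow> continuous_on UNIV w \<Longrightarrow> (\<And>r. w r \<in> UHP) \<Longrightarrow>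
      (\<And>r. r \<in> {a..b} \<Longrightarrow> cmod (w r - z) \<le> 1 / Im z * (b - a)) \<Longrightarrow>
      cmod (integral {a..b} (\<lambda>r. G r (w r)) - (b - a) *\<^sub>R G t z) \<le> e1 * (b - a)"
      by (rule regular_time_path[OF t z e1(1), of "1 / Im z"]) (use Imz in auto)
    define d where "d = min d1 (min d2 (d1 * Im z))"
    have d: "d > 0" using d1 d2 Imz by (simp add: d_def)
    have "norm (f s z - f t z - (s - t) *\<^sub>R (- G t z * D)) \<le> e * norm (s - t)" if s: "s \<ge> 0" "\<bar>s - t\<bar> < d" for s
    proof -
      define m M where "m = min s t" and "M = max s t"
      have mM: "0 \<le> m" "m \<le> M" "m \<le> t" "t \<le> M" "0 \<le> M" and \<Delta>: "M - m = \<bar>s - t\<bar>"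
        using s t0 by (auto simp: m_def M_def)
      have small: "M - m < d1" "M - m < d2" "M - m < d1 * Im z" using s \<Delta> by (auto simp: d_def)
      have md: "\<bar>m - t\<bar> < d1" using mM small by linarith
      define w where "w = loewner_flow M z"
      define \<zeta> where "\<zeta> = w m"
      have w: "flow M w" "w M = z" using loewner_flow[OF mM(5) z] by (auto simp: w_def)
      define I where "I = integral {m..M} (\<lambda>r. G r (w r))"
      have "\<zeta> - z = - (w M - w m)" by (simp add: \<zeta>_def w(2))
      then have \<zeta>I: "\<zeta> - z = - I" unfolding I_def flowD(3)[OF w(1) mM(1,2) order_refl] .
      have wr: "cmod (w r - z) \<le> 1 / Im z * (M - m)" if r: "r \<in> {m..M}" for r
      proof -
        have "cmod (w r - z) \<le> (M - r) / Im z"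
          unfolding w_def using r mM(1) by (intro loewner_map_dist z) auto
        also have "\<dots> \<le> (M - m) / Im z" using r Imz by (intro divide_right_mono) auto
        finally show ?thesis by simp
      qed
      have I: "cmod (I - (M - m) *\<^sub>R G t z) \<le> e1 * (M - m)"
        unfolding I_def by (rule d2(2)[OF mM(3,4) small(2) flowD(1,2)[OF w(1)] wr])
      have \<zeta>z: "cmod (\<zeta> - z) \<le> (M - m) / Im z" using wr[of m] mM by (simp add: \<zeta>_def)
      also have "\<dots> < d1" using small(3) Imz by (simp add: divide_less_eq)
      finally have \<zeta>d: "cmod (\<zeta> - z) < d1" .
      have \<zeta>U: "\<zeta> \<in> UHP" unfolding \<zeta>_def by (rule flowD(2)[OF w(1)])
      have "f M z = loewner_flow M z 0" using mM z by (simp add: f_def family_at_loewner_chain loewner_map_eq)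
      also have "\<dots> = loewner_flow m \<zeta> 0"
        unfolding \<zeta>_def w_def by (rule loewner_flow_semigroup[OF order_refl mM(1,2) z])
      also have "\<dots> = f m \<zeta>" using mM \<zeta>U by (simp add: f_def family_at_loewner_chain loewner_map_eq)
      finally have fM: "f M z = f m \<zeta>" .
      have A: "cmod (f m \<zeta> - f m z - D * (\<zeta> - z)) \<le> e / 2 * (M - m)"
      proof -
        have "cmod (f m \<zeta> - f m z - D * (\<zeta> - z)) \<le> e / 2 * Im z * cmod (\<zeta> - z)"
          by (rule d1(2)[OF mM(1) md \<zeta>d])
        also have "\<dots> \<le> e / 2 * Im z * ((M - m) / Im z)" using \<zeta>z e Imz by (intro mult_left_mono) auto
        also have "\<dots> = e / 2 * (M - m)" using Imz by simp
        finally show ?thesis .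
      qed
      have "cmod (D * (I - (M - m) *\<^sub>R G t z)) \<le> cmod D * (e1 * (M - m))"
        unfolding norm_mult by (rule mult_left_mono[OF I]) simp
      also have "\<dots> \<le> e / 2 * (M - m)" using mult_right_mono[OF e1(2), of "M - m"] mM by simp
      finally have B: "cmod (D * (I - (M - m) *\<^sub>R G t z)) \<le> e / 2 * (M - m)" .
      have "f M z - f m z + (M - m) *\<^sub>R (G t z * D)
        = (f m \<zeta> - f m z - D * (\<zeta> - z)) - D * (I - (M - m) *\<^sub>R G t z)"
        unfolding fM \<zeta>I by (simp add: scaleR_conv_of_real algebra_simps)
      also have "cmod \<dots> \<le> e / 2 * (M - m) + e / 2 * (M - m)"
        by (rule order_trans[OF norm_triangle_ineq4 add_mono[OF A B]])
      finally have C: "cmod (f M z - f m z + (M - m) *\<^sub>R (G t z * D)) \<le> e * (M - m)" by simp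
      show ?thesis
      proof (cases "t \<le> s")
        case True
        then show ?thesis using C by (simp add: m_def M_def)
      next
        case False
        then have "f s z - f t z - (s - t) *\<^sub>R (- G t z * D) = - (f M z - f m z + (M - m) *\<^sub>R (G t z * D))"
          by (simp add: m_def M_def scaleR_conv_of_real algebra_simps)
        then have "norm (f s z - f t z - (s - t) *\<^sub>R (- G t z * D)) = cmod (f M z - f m z + (M - m) *\<^sub>R (G t z * D))"
          by (simp only: norm_minus_cancel)
        then show ?thesis using C \<Delta> by simp
      qed
    qed
    then show ?thesis using d by auto
  qed
  then show ?thesis
    unfolding has_vector_derivative_def has_derivative_within_alt f_def[symmetric] D_def[symmetric]
    using bounded_linear_scaleR_left by blast
qed

lemma loewner_chain_unique:
  assumes F: "chordal_Loewner_family F" and N: "negligible N"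
    and der: "\<And>t z. t \<ge> 0 \<Longrightarrow> t \<notin> N \<Longrightarrow> z \<in> UHP \<Longrightarrow>
      ((\<lambda>s. family_at F s z) has_vector_derivative - G t z * deriv (family_at F t) z) (at t within {0..})"
  shows "F = loewner_chain"
proof -
  have eq: "family_at F T z = loewner_map 0 T z" if T: "0 \<le> T" and z: "z \<in> UHP" for T z
  proof -
    define f where "f = family_at F"
    define w where "w = loewner_flow T z"
    define \<epsilon> where "\<epsilon> = Im z"
    have \<epsilon>: "\<epsilon> > 0" using z by (simp add: \<epsilon>_def UHP_iff)
    have w: "flow T w" "w T = z" "\<And>r. \<epsilon> \<le> Im (w r)" using loewner_flow[OF T z] by (auto simp: w_def \<epsilon>_def)
    have wU: "w r \<in> UHP" for r by (rule flowD(2)[OF w(1)])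
    have wd: "cmod (w v - w u) \<le> 1 / \<epsilon> * (v - u)" if "0 \<le> u" "u \<le> v" "v \<le> T" for u v
      using flow_dist[OF w(1) that] by (simp add: w(2) \<epsilon>_def)
    define \<phi> where "\<phi> = (\<lambda>s. f s (w s))"
    define A where "A = 1 + T / \<epsilon>\<^sup>2"
    have A: "A \<ge> 1" using T by (simp add: A_def)
    have "\<phi> 0 = \<phi> T"
    proof (rule Lipschitz_derivative_zero_ae_const[OF T])
      show "negligible (N \<union> {t \<in> {0..}. \<not> regular_time t})"
        by (intro negligible_Un N negligible_not_regular_time)
      \<comment> \<open>The constant is a sum of two equal parts: moving the point at fixed time
        (\<open>hydro_Lipschitz\<close>) and moving the time at a fixed point
        (\<open>family_at_dist\<close>).\<close>
      show "norm (\<phi> v - \<phi> u) \<le> (2 * A / \<epsilon>) * (v - u)" if uv: "0 \<le> u" "u \<le> v" "v \<le> T" for u v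
      proof -
        have v0: "0 \<le> v" using uv by simp
        have "cmod (f v (w v) - f v (w u)) \<le> (1 + hcap (f v) / \<epsilon>\<^sup>2) * cmod (w v - w u)"
          unfolding f_def by (rule hydro_Lipschitz[OF family_at_hydro[OF F v0] \<epsilon> w(3) w(3)])
        also have "\<dots> \<le> A * (1 / \<epsilon> * (v - u))"
          unfolding A_def f_def family_at(2)[OF F v0] using uv T \<epsilon>
          by (intro mult_mono add_mono divide_right_mono wd) auto
        finally have 1: "cmod (f v (w v) - f v (w u)) \<le> A / \<epsilon> * (v - u)" by simp
        have "cmod (f v (w u) - f u (w u)) \<le> \<bar>v - u\<bar> * ((1 + T / \<epsilon>\<^sup>2) / \<epsilon>)"
          unfolding f_def using uv by (intro family_at_dist[OF F] \<epsilon> w(3)) auto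
        then have 2: "cmod (f v (w u) - f u (w u)) \<le> A / \<epsilon> * (v - u)" using uv by (simp add: A_def mult_ac)
        have "\<phi> v - \<phi> u = (f v (w v) - f v (w u)) + (f v (w u) - f u (w u))" by (simp add: \<phi>_def)
        then have "cmod (\<phi> v - \<phi> u) \<le> A / \<epsilon> * (v - u) + A / \<epsilon> * (v - u)"
          using order_trans[OF norm_triangle_ineq add_mono[OF 1 2]] by simp
        then show ?thesis by simp
      qed
      fix x e :: real assume x: "x \<in> {0..T} - (N \<union> {t \<in> {0..}. \<not> regular_time t})" and e: "e > 0"
      have reg: "regular_time x" and x0: "0 \<le> x" "x \<le> T" and xN: "x \<notin> N" using x by auto
      \<comment> \<open>The point at which the differential equation is used changes with
        \<open>x\<close>; here it matters that \<open>N\<close> is the same for all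
        \<open>z\<close>.\<close>
      define p where "p = w x"
      define D where "D = deriv (f x) p"
      have pU: "p \<in> UHP" unfolding p_def by (rule wU)
      define e3 where "e3 = e / 4 / (cmod D + 1)"
      have "cmod D + 1 > 0" by (simp add: add_nonneg_pos)
      then have e3: "e3 > 0" "cmod D * e3 \<le> e / 4"
        using e by (auto simp: e3_def divide_simps mult_left_mono)
      obtain d1 where d1: "d1 > 0" "\<And>s \<zeta>. 0 \<le> s \<Longrightarrow> \<bar>s - x\<bar> < d1 \<Longrightarrow> cmod (\<zeta> - p) < d1 \<Longrightarrow>
        cmod (f s \<zeta> - f s p - D * (\<zeta> - p)) \<le> e / 4 * \<epsilon> * cmod (\<zeta> - p)"
        using family_at_increment[OF F x0(1) pU, of "e / 4 * \<epsilon>"] e \<epsilon>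
        unfolding f_def D_def by auto
      obtain d2 where d2: "d2 > 0" "\<And>s. 0 \<le> s \<Longrightarrow> \<bar>s - x\<bar> < d2 \<Longrightarrow>
        cmod (f s p - f x p - (s - x) *\<^sub>R (- G x p * D)) \<le> e / 4 * \<bar>s - x\<bar>"
      proof -
        have "\<forall>e>0. \<exists>d>0. \<forall>y\<in>{0..}. norm (y - x) < d \<longrightarrow> norm (f y p - f x p - (y - x) *\<^sub>R (- G x p * D)) \<le> e * norm (y - x)"
          using der[OF x0(1) xN pU] unfolding has_vector_derivative_def has_derivative_within_alt f_def[symmetric] D_def[symmetric]
          by blast
        from this[rule_format, of "e / 4"] e that show thesis by auto
      qed
      obtain d3 where d3: "d3 > 0" "\<And>a b w. a \<le> x \<Longrightarrow> x \<le> b \<Longrightarrow> b - a < d3 \<Longrightarrow> continuous_on UNIV w \<Longrightarrow> (\<And>r. w r \<in> UHP) \<Longrightarrow>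
        (\<And>r. r \<in> {a..b} \<Longrightarrow> cmod (w r - p) \<le> 1 / \<epsilon> * (b - a)) \<Longrightarrow>
        cmod (integral {a..b} (\<lambda>r. G r (w r)) - (b - a) *\<^sub>R G x p) \<le> e3 * (b - a)"
        by (rule regular_time_path[OF reg pU e3(1), of "1 / \<epsilon>"]) (use \<epsilon> in auto)
      define d where "d = Min {d1, d2, d3, d1 * \<epsilon>}"
      have d: "d > 0" using d1 d2 d3 \<epsilon> by (simp add: d_def)
      have dle: "d \<le> d1" "d \<le> d2" "d \<le> d3" "d \<le> d1 * \<epsilon>" by (auto simp: d_def)
      have main: "cmod (\<phi> s - \<phi> x) \<le> e * \<bar>s - x\<bar>" if s: "0 \<le> s" "s \<le> T" "\<bar>s - x\<bar> < d" for s
      proof -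
        define a b where "a = min s x" and "b = max s x"
        have ab: "a \<le> x" "x \<le> b" "0 \<le> a" "a \<le> b" "b \<le> T" "b - a = \<bar>s - x\<bar>"
          using s x0 by (auto simp: a_def b_def)
        have wr: "cmod (w r - p) \<le> 1 / \<epsilon> * (b - a)" if r: "r \<in> {a..b}" for r
        proof -
          have "cmod (w r - p) \<le> 1 / \<epsilon> * \<bar>r - x\<bar>"
            using wd[of x r] wd[of r x] r ab x0 by (cases "x \<le> r") (auto simp: p_def norm_minus_commute)
          also have "\<dots> \<le> 1 / \<epsilon> * (b - a)" using r ab \<epsilon> by (intro mult_left_mono) auto
          finally show ?thesis .
        qed
        have "s \<in> {a..b}" by (auto simp: a_def b_def)
        then have wsp: "cmod (w s - p) \<le> 1 / \<epsilon> * \<bar>s - x\<bar>" using wr ab by simp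
        also have "\<dots> < d1" using s dle(4) \<epsilon> by (simp add: divide_less_eq)
        finally have wsd: "cmod (w s - p) < d1" .
        have int: "cmod (integral {a..b} (\<lambda>r. G r (w r)) - (b - a) *\<^sub>R G x p) \<le> e3 * (b - a)"
          using ab s dle(3) by (intro d3(2) flowD(1)[OF w(1)] wU wr) auto
        have wp: "cmod (w s - p - (s - x) *\<^sub>R G x p) \<le> e3 * \<bar>s - x\<bar>"
        proof (cases "x \<le> s")
          case True
          then show ?thesis using int flowD(3)[OF w(1), of x s] x0 s by (simp add: a_def b_def p_def)
        next
          case False
          then have ab': "a = s" "b = x" by (auto simp: a_def b_def)
          have "w s - p - (s - x) *\<^sub>R G x p = - ((w x - w s) - (x - s) *\<^sub>R G x p)"
            by (simp add: p_def scaleR_conv_of_real algebra_simps)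
          also have "w x - w s = integral {s..x} (\<lambda>r. G r (w r))"
            using False x0 s by (intro flowD(3)[OF w(1)]) auto
          finally have "cmod (w s - p - (s - x) *\<^sub>R G x p) = cmod (integral {s..x} (\<lambda>r. G r (w r)) - (x - s) *\<^sub>R G x p)"
            by (simp only: norm_minus_cancel)
          also have "\<dots> \<le> e3 * (x - s)" using int unfolding ab' .
          also have "\<dots> = e3 * \<bar>s - x\<bar>" using False by simp
          finally show ?thesis .
        qed
        have "cmod (D * (w s - p - (s - x) *\<^sub>R G x p)) \<le> cmod D * (e3 * \<bar>s - x\<bar>)"
          unfolding norm_mult by (rule mult_left_mono[OF wp]) simp
        also have "\<dots> \<le> e / 4 * \<bar>s - x\<bar>" using mult_right_mono[OF e3(2), of "\<bar>s - x\<bar>"] by (simp add: mult.assoc)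
        finally have 2: "cmod (D * (w s - p - (s - x) *\<^sub>R G x p)) \<le> e / 4 * \<bar>s - x\<bar>" .
        have "cmod (f s (w s) - f s p - D * (w s - p)) \<le> e / 4 * \<epsilon> * cmod (w s - p)"
          using s dle(1) by (intro d1(2) wsd) auto
        also have "\<dots> \<le> e / 4 * \<epsilon> * (1 / \<epsilon> * \<bar>s - x\<bar>)" using wsp e \<epsilon> by (intro mult_left_mono) auto
        also have "\<dots> = e / 4 * \<bar>s - x\<bar>" using \<epsilon> by simp
        finally have 1: "cmod (f s (w s) - f s p - D * (w s - p)) \<le> e / 4 * \<bar>s - x\<bar>" .
        have 3: "cmod (f s p - f x p - (s - x) *\<^sub>R (- G x p * D)) \<le> e / 4 * \<bar>s - x\<bar>"
          using s dle(2) by (intro d2(2)) auto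
        \<comment> \<open>The term \<open>(s - x) * G x p * D\<close> from the motion of
          \<open>w\<close> cancels against the one from the differential equation, leaving three
          errors of \<open>e / 4\<close>.\<close>
        have "\<phi> s - \<phi> x = ((f s (w s) - f s p - D * (w s - p)) + D * (w s - p - (s - x) *\<^sub>R G x p))
            + (f s p - f x p - (s - x) *\<^sub>R (- G x p * D))"
          by (simp add: \<phi>_def p_def scaleR_conv_of_real algebra_simps)
        also have "cmod \<dots> \<le> (e / 4 * \<bar>s - x\<bar> + e / 4 * \<bar>s - x\<bar>) + e / 4 * \<bar>s - x\<bar>"
          by (rule order_trans[OF norm_triangle_ineq add_mono[OF order_trans[OF norm_triangle_ineq add_mono[OF 1 2]] 3]])
        also have "\<dots> \<le> e * \<bar>s - x\<bar>" using e by (simp add: field_simps)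
        finally show ?thesis .
      qed
      show "\<exists>d>0. \<forall>u v. 0 \<le> u \<longrightarrow> u \<le> x \<longrightarrow> x \<le> v \<longrightarrow> v \<le> T \<longrightarrow> v - u < d \<longrightarrow> norm (\<phi> v - \<phi> u) \<le> e * (v - u)"
      proof (intro exI[of _ d] conjI allI impI d)
        fix u v assume uv: "0 \<le> u" "u \<le> x" "x \<le> v" "v \<le> T" "v - u < d"
        have "cmod (\<phi> v - \<phi> u) \<le> cmod (\<phi> v - \<phi> x) + cmod (\<phi> u - \<phi> x)"
          using norm_triangle_ineq4[of "\<phi> v - \<phi> x" "\<phi> u - \<phi> x"] by simp
        also have "\<dots> \<le> e * \<bar>v - x\<bar> + e * \<bar>u - x\<bar>" using uv x0 by (intro add_mono main) auto
        also have "\<dots> = e * (v - u)" using uv by (simp add: algebra_simps)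
        finally show "norm (\<phi> v - \<phi> u) \<le> e * (v - u)" .
      qed
    qed
    \<comment> \<open>Capacity zero forces the identity; hence \<open>\<phi> 0 = w 0\<close>, while
      \<open>\<phi> T = f T z\<close>.\<close>
    moreover have "f 0 = uhp_id"
      unfolding f_def using family_at_hydro[OF F order_refl] family_at(2)[OF F order_refl] by (intro hcap_0_imp_id) auto
    ultimately have "f T z = w 0" using wU by (simp add: \<phi>_def w(2))
    then show ?thesis using z by (simp add: f_def w_def loewner_map_eq)
  qed
  have "family_at F T = loewner_map 0 T" if T: "0 \<le> T" for T
    using eq[OF T] by (intro extensionalityI[OF hydro_mapsD(1)[OF family_at_hydro[OF F T]]]) (auto simp: loewner_map_def)
  then show ?thesis
    unfolding loewner_chain_def by (subst Loewner_family_eq_image[OF F]) (intro image_cong, auto)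
qed

end

section \<open>Cauchy transforms\<close>

definition cauchy_transform :: "real measure \<Rightarrow> complex \<Rightarrow> complex" where
  "cauchy_transform M z = (LINT x|M. 1 / (z - complex_of_real x))"

lemma UHP_minus_real:
  assumes "z \<in> UHP"
  shows "z - complex_of_real x \<noteq> 0" "Im z \<le> cmod (z - complex_of_real x)"
proof -
  show "Im z \<le> cmod (z - complex_of_real x)" using abs_Im_le_cmod[of "z - complex_of_real x"] by simp
  then show "z - complex_of_real x \<noteq> 0" using assms by (auto simp: UHP_iff)
qed

lemma cauchy_kernel_continuous: "z \<in> UHP \<Longrightarrow> continuous_on UNIV (\<lambda>x. 1 / (z - complex_of_real x))"
  using UHP_minus_real(1) by (intro continuous_intros) auto

lemma cauchy_kernel_bound: "z \<in> UHP \<Longrightarrow> cmod (1 / (z - complex_of_real x)) \<le> 1 / Im z"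
  using UHP_minus_real[of z x] by (auto simp: norm_divide UHP_iff intro!: divide_left_mono mult_pos_pos)

locale borel_prob = prob_space M for M :: "real measure" +
  assumes sets_M: "sets M = sets borel"
begin

lemma integrable_bounded_continuous:
  fixes g :: "real \<Rightarrow> 'b::{banach, second_countable_topology}"
  assumes g: "continuous_on UNIV g" and B: "\<And>x. norm (g x) \<le> B"
  shows "integrable M g"
proof (rule integrable_const_bound[of _ B])
  show "g \<in> borel_measurable M"
    using borel_measurable_continuous_onI[OF g] measurable_cong_sets[OF sets_M refl] by blast
qed (use B in auto)

lemma integral_norm_le_const:
  fixes g :: "real \<Rightarrow> 'b::{banach, second_countable_topology}"
  assumes g: "continuous_on UNIV g" and B: "\<And>x. norm (g x) \<le> B"
  shows "norm (LINT x|M. g x) \<le> B"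
proof -
  have "norm (LINT x|M. g x) \<le> (LINT x|M. norm (g x))" by (rule integral_norm_bound)
  also have "\<dots> \<le> B"
    by (rule integral_le_const) (use integrable_bounded_continuous[OF assms] B in auto)
  finally show ?thesis .
qed

lemma kernel_integrable: "z \<in> UHP \<Longrightarrow> integrable M (\<lambda>x. 1 / (z - complex_of_real x))"
  by (rule integrable_bounded_continuous[OF cauchy_kernel_continuous cauchy_kernel_bound])

lemma cauchy_transform_bound: "z \<in> UHP \<Longrightarrow> cmod (cauchy_transform M z) \<le> 1 / Im z"
  unfolding cauchy_transform_def
  by (rule integral_norm_le_const[OF cauchy_kernel_continuous cauchy_kernel_bound])

lemma cauchy_transform_Im:
  assumes z: "z \<in> UHP"
  shows "Im (cauchy_transform M z) \<le> 0"
proof -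
  have "Im (cauchy_transform M z) = (LINT x|M. Im (1 / (z - complex_of_real x)))"
    unfolding cauchy_transform_def using integral_Im[OF kernel_integrable[OF z]] by simp
  also have "\<dots> \<le> (LINT x|M. 0)"
  proof (rule integral_mono)
    show "integrable M (\<lambda>x. Im (1 / (z - complex_of_real x)))" by (rule integrable_Im[OF kernel_integrable[OF z]])
    show "Im (1 / (z - complex_of_real x)) \<le> 0" for x
      using z by (simp add: Im_divide UHP_iff divide_le_0_iff)
  qed simp
  finally show ?thesis by simp
qed

lemma cauchy_transform_Lipschitz:
  assumes z: "z \<in> UHP" and w: "w \<in> UHP"
  shows "cmod (cauchy_transform M z - cauchy_transform M w) \<le> cmod (z - w) / (Im z * Im w)"
proof -
  have "cauchy_transform M z - cauchy_transform M w
      = (LINT x|M. 1 / (z - complex_of_real x) - 1 / (w - complex_of_real x))"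
    unfolding cauchy_transform_def
    by (rule Bochner_Integration.integral_diff[OF kernel_integrable[OF z] kernel_integrable[OF w], symmetric])
  also have "cmod \<dots> \<le> cmod (z - w) / (Im z * Im w)"
  proof (rule integral_norm_le_const)
    show "continuous_on UNIV (\<lambda>x. 1 / (z - complex_of_real x) - 1 / (w - complex_of_real x))"
      by (intro continuous_on_diff cauchy_kernel_continuous z w)
    fix x
    have "1 / (z - complex_of_real x) - 1 / (w - complex_of_real x) = (w - z) * (1 / (z - complex_of_real x) * (1 / (w - complex_of_real x)))"
      using UHP_minus_real(1)[OF z, of x] UHP_minus_real(1)[OF w, of x] by (simp add: field_simps)
    also have "cmod \<dots> \<le> cmod (w - z) * (1 / Im z * (1 / Im w))"
      unfolding norm_mult using z w
      by (intro mult_left_mono mult_mono cauchy_kernel_bound) (auto simp: UHP_iff)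
    finally show "cmod (1 / (z - complex_of_real x) - 1 / (w - complex_of_real x)) \<le> cmod (z - w) / (Im z * Im w)"
      by (simp add: norm_minus_commute)
  qed
  finally show ?thesis .
qed

text \<open>For \<open>k z = 1 / (z - x)\<close> the expansion \<open>k z - k z0 + (k z0)\<^sup>2 *
  (z - z0) = (z - z0)\<^sup>2 * k z * (k z0)\<^sup>2\<close> is exact, so the remainder is bounded
  uniformly in \<open>x\<close> and can be integrated directly.\<close>

lemma cauchy_transform_holomorphic: "cauchy_transform M holomorphic_on UHP"
proof (rule holomorphic_onI)
  fix z0 assume z0: "z0 \<in> UHP"
  have I0: "Im z0 > 0" using z0 by (simp add: UHP_iff)
  define k where "k = (\<lambda>z x. 1 / (z - complex_of_real x))"
  have kc: "continuous_on UNIV (k z)" and kb: "cmod (k z x) \<le> 1 / Im z" and ki: "integrable M (k z)" if "z \<in> UHP" for z x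
    unfolding k_def using that by (rule cauchy_kernel_continuous, rule cauchy_kernel_bound, rule kernel_integrable)
  have k2: "continuous_on UNIV (\<lambda>x. k z0 x * k z0 x)" by (intro continuous_on_mult kc z0)
  have k2b: "cmod (k z0 x * k z0 x) \<le> 1 / Im z0 * (1 / Im z0)" for x
    unfolding norm_mult using kb[OF z0, of x] I0 by (intro mult_mono) auto
  have k2i: "integrable M (\<lambda>x. k z0 x * k z0 x)" by (rule integrable_bounded_continuous[OF k2 k2b])
  have ct: "cauchy_transform M v = (LINT x|M. k v x)" for v by (simp add: cauchy_transform_def k_def)
  define d where "d = - (LINT x|M. k z0 x * k z0 x)"
  have "((\<lambda>z. (cauchy_transform M z - cauchy_transform M z0) / (z - z0)) \<longlongrightarrow> d) (at z0)"
  proof -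
    have "((\<lambda>z. (cauchy_transform M z - cauchy_transform M z0) / (z - z0) - d) \<longlongrightarrow> 0) (at z0)"
    proof (rule Lim_null_comparison)
      have "((\<lambda>z. cmod (z - z0) * (1 / Im z * (1 / Im z0 * (1 / Im z0)))) \<longlongrightarrow> cmod (z0 - z0) * (1 / Im z0 * (1 / Im z0 * (1 / Im z0)))) (at z0)"
        using I0 by (intro tendsto_intros) auto
      then show "((\<lambda>z. cmod (z - z0) * (1 / Im z * (1 / Im z0 * (1 / Im z0)))) \<longlongrightarrow> 0) (at z0)" by simp
      have "\<forall>\<^sub>F z in at z0. z \<in> UHP" using eventually_at_in_open'[OF open_UHP z0] .
      moreover have "\<forall>\<^sub>F z in at z0. z \<noteq> z0" by (simp add: eventually_at_filter)
      ultimately show "\<forall>\<^sub>F z in at z0. norm ((cauchy_transform M z - cauchy_transform M z0) / (z - z0) - d)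
         \<le> cmod (z - z0) * (1 / Im z * (1 / Im z0 * (1 / Im z0)))"
      proof eventually_elim
        case (elim z)
        have Iz: "Im z > 0" using elim by (simp add: UHP_iff)
        have "cauchy_transform M z - cauchy_transform M z0 - d * (z - z0)
          = (LINT x|M. (k z x - k z0 x) + (k z0 x * k z0 x) * (z - z0))"
          unfolding ct d_def using ki[OF elim(1)] ki[OF z0] k2i by simp
        also have "cmod \<dots> \<le> cmod (z - z0) * (cmod (z - z0) * (1 / Im z * (1 / Im z0 * (1 / Im z0))))"
        proof (rule integral_norm_le_const)
          show "continuous_on UNIV (\<lambda>x. (k z x - k z0 x) + (k z0 x * k z0 x) * (z - z0))"
            by (intro continuous_intros kc elim(1) z0)
          fix x
          have "(k z x - k z0 x) + (k z0 x * k z0 x) * (z - z0) = (z - z0) * ((z - z0) * (k z x * (k z0 x * k z0 x)))"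
          proof -
            define a b where "a = z - complex_of_real x" and "b = z0 - complex_of_real x"
            have ab: "a \<noteq> 0" "b \<noteq> 0" using UHP_minus_real(1) elim(1) z0 by (auto simp: a_def b_def)
            have zz: "z - z0 = a - b" by (simp add: a_def b_def)
            show ?thesis unfolding k_def a_def[symmetric] b_def[symmetric] zz using ab by (simp add: field_simps)
          qed
          also have "cmod \<dots> \<le> cmod (z - z0) * (cmod (z - z0) * (1 / Im z * (1 / Im z0 * (1 / Im z0))))"
            unfolding norm_mult using kb[OF elim(1), of x] kb[OF z0, of x] Iz I0
            by (intro mult_left_mono mult_mono) auto
          finally show "cmod ((k z x - k z0 x) + (k z0 x * k z0 x) * (z - z0))
            \<le> cmod (z - z0) * (cmod (z - z0) * (1 / Im z * (1 / Im z0 * (1 / Im z0))))" .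
        qed
        finally have *: "cmod (cauchy_transform M z - cauchy_transform M z0 - d * (z - z0))
          \<le> cmod (z - z0) * (cmod (z - z0) * (1 / Im z * (1 / Im z0 * (1 / Im z0))))" .
        have "(cauchy_transform M z - cauchy_transform M z0) / (z - z0) - d
          = (cauchy_transform M z - cauchy_transform M z0 - d * (z - z0)) / (z - z0)"
          using elim(2) by (simp add: field_simps)
        then have "norm ((cauchy_transform M z - cauchy_transform M z0) / (z - z0) - d)
          = cmod (cauchy_transform M z - cauchy_transform M z0 - d * (z - z0)) / cmod (z - z0)"
          by (simp only: norm_divide)
        also have "\<dots> \<le> cmod (z - z0) * (1 / Im z * (1 / Im z0 * (1 / Im z0)))"
        proof -
          have "cmod (z - z0) > 0" using elim(2) by simp
          then show ?thesis using * by (simp only: pos_divide_le_eq) (simp only: mult_ac)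
        qed
        finally show ?case .
      qed
    qed
    then show ?thesis using LIM_zero_iff by blast
  qed
  then have "(cauchy_transform M has_field_derivative d) (at z0)" by (simp add: has_field_derivative_iff)
  then show "cauchy_transform M field_differentiable at z0 within UHP"
    unfolding field_differentiable_def using has_field_derivative_at_within by blast
qed

lemma cauchy_transform_asymptotic:
  fixes w :: "nat \<Rightarrow> complex"
  assumes y: "filterlim y at_top sequentially" and w: "\<And>n. w n \<in> UHP" and wy: "\<And>n. cmod (w n - \<i> * of_real (y n)) \<le> B"
  shows "(\<lambda>n. \<i> * of_real (y n) * cauchy_transform M (w n)) \<longlonglongrightarrow> 1"
proof -
  \<comment> \<open>Beyond \<open>N\<close> the points satisfy
    \<open>Im (w n) \<ge> y n / 2\<close>, which makes the constant 2 a dominating function.\<close>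
  obtain N where N: "\<And>n. n \<ge> N \<Longrightarrow> 2 * \<bar>B\<bar> + 1 < y n"
    using y by (auto simp: filterlim_at_top_dense eventually_sequentially)
  define g where "g = (\<lambda>n x. \<i> * of_real (y (n + N)) * (1 / (w (n + N) - complex_of_real x)))"
  have yN: "y (n + N) > 2 * \<bar>B\<bar> + 1" for n using N[of "n + N"] by simp
  have inv: "(\<lambda>n. 1 / y (n + N)) \<longlonglongrightarrow> 0"
    by (rule LIMSEQ_ignore_initial_segment) (rule tendsto_divide_0[OF tendsto_const filterlim_at_top_imp_at_infinity[OF y]])
  have "(\<lambda>n. LINT x|M. g n x) \<longlonglongrightarrow> (LINT x|M. 1)"
  proof (rule integral_dominated_convergence[where w = "\<lambda>_. 2"])
    show "g n \<in> borel_measurable M" for n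
      unfolding g_def by (intro borel_measurable_times borel_measurable_const borel_measurable_integrable kernel_integrable w)
    show "AE x in M. (\<lambda>n. g n x) \<longlonglongrightarrow> 1"
    proof (rule AE_I2)
      fix x
      have "(\<lambda>n. (w (n + N) - complex_of_real x) / (\<i> * of_real (y (n + N))) - 1) \<longlonglongrightarrow> 0"
      proof (rule Lim_null_comparison)
        have "(\<lambda>n. (B + \<bar>x\<bar>) * (1 / y (n + N))) \<longlonglongrightarrow> (B + \<bar>x\<bar>) * 0" by (intro tendsto_intros inv)
        then show "(\<lambda>n. (B + \<bar>x\<bar>) * (1 / y (n + N))) \<longlonglongrightarrow> 0" by simp
        have "norm ((w (n + N) - complex_of_real x) / (\<i> * of_real (y (n + N))) - 1) \<le> (B + \<bar>x\<bar>) * (1 / y (n + N))" for n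
        proof -
          have yp: "y (n + N) > 0" using yN[of n] by linarith
          have "(w (n + N) - complex_of_real x) / (\<i> * of_real (y (n + N))) - 1
             = ((w (n + N) - \<i> * of_real (y (n + N))) - complex_of_real x) / (\<i> * of_real (y (n + N)))"
            using yp by (simp add: field_simps)
          then have "norm ((w (n + N) - complex_of_real x) / (\<i> * of_real (y (n + N))) - 1)
             = cmod ((w (n + N) - \<i> * of_real (y (n + N))) - complex_of_real x) / y (n + N)"
            using yp by (simp add: norm_divide norm_mult)
          also have "\<dots> \<le> (B + \<bar>x\<bar>) / y (n + N)"
            using yp order_trans[OF norm_triangle_ineq4 add_mono[OF wy[of "n + N"], of "cmod (complex_of_real x)" "\<bar>x\<bar>"]]
            by (intro divide_right_mono) auto
          finally show ?thesis by simp
        qed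
        then show "\<forall>\<^sub>F n in sequentially. norm ((w (n + N) - complex_of_real x) / (\<i> * of_real (y (n + N))) - 1) \<le> (B + \<bar>x\<bar>) * (1 / y (n + N))"
          by simp
      qed
      then have "(\<lambda>n. (w (n + N) - complex_of_real x) / (\<i> * of_real (y (n + N)))) \<longlonglongrightarrow> 1" using LIM_zero_iff by blast
      then have "(\<lambda>n. 1 / ((w (n + N) - complex_of_real x) / (\<i> * of_real (y (n + N))))) \<longlonglongrightarrow> 1 / 1"
        by (intro tendsto_divide tendsto_const) auto
      then show "(\<lambda>n. g n x) \<longlonglongrightarrow> 1" by (simp add: g_def)
    qed
    show "AE x in M. norm (g n x) \<le> 2" for n
    proof (rule AE_I2)
      fix x
      have Iw: "y (n + N) / 2 \<le> Im (w (n + N))"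
        using abs_Im_le_cmod[of "w (n + N) - \<i> * of_real (y (n + N))"] wy[of "n + N"] yN[of n] by auto
      have yp: "y (n + N) > 0" using yN[of n] by linarith
      have "cmod (1 / (w (n + N) - complex_of_real x)) \<le> 1 / Im (w (n + N))" by (rule cauchy_kernel_bound[OF w])
      also have "\<dots> \<le> 1 / (y (n + N) / 2)" using Iw yp by (intro divide_left_mono) auto
      finally have "y (n + N) * cmod (1 / (w (n + N) - complex_of_real x)) \<le> y (n + N) * (1 / (y (n + N) / 2))"
        using yp by (intro mult_left_mono) auto
      moreover have "norm (g n x) = y (n + N) * cmod (1 / (w (n + N) - complex_of_real x))"
        unfolding g_def norm_mult using yp by simp
      ultimately show "norm (g n x) \<le> 2" using yp by simp
    qed
  qed auto
  moreover have "(LINT x|M. g n x) = \<i> * of_real (y (n + N)) * cauchy_transform M (w (n + N))" for n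
    unfolding g_def cauchy_transform_def by (rule integral_mult_right_zero)
  ultimately have "(\<lambda>n. \<i> * of_real (y (n + N)) * cauchy_transform M (w (n + N))) \<longlonglongrightarrow> 1"
    by (simp add: prob_space)
  then show ?thesis by (rule LIMSEQ_offset)
qed

end

section \<open>From weak measurability of the measures to a Loewner field\<close>

lemma space_weak_borel: "space weak_borel = space (prob_algebra borel)"
  by (simp add: weak_borel_def topspace_weak_topology space_measure_of_conv)

lemma sets_weak_borel: "openin weak_topology V \<Longrightarrow> V \<in> sets weak_borel"
  unfolding weak_borel_def
  by (subst sets_measure_of) (auto dest: openin_subset intro: sigma_sets.Basic)

text \<open>The condition that the integral lies in \<open>U\<close> cuts out a subbasic open set of
  the weak topology, whose preimage under \<open>\<mu>\<close> is measurable.\<close>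

lemma measurable_weak_borel_integral:
  fixes \<phi> :: "real \<Rightarrow> real"
  assumes \<mu>: "\<mu> \<in> N \<rightarrow>\<^sub>M weak_borel" and \<phi>: "continuous_on UNIV \<phi>" "bounded (range \<phi>)"
  shows "(\<lambda>t. LINT x|\<mu> t. \<phi> x) \<in> borel_measurable N"
proof (rule borel_measurableI)
  fix U :: "real set" assume U: "open U"
  define V where "V = {M \<in> space (prob_algebra borel). (LINT x|M. \<phi> x) \<in> U}"
  have "openin weak_topology V"
    unfolding weak_topology_def by (rule topology_generated_by_Basis) (use \<phi> U in \<open>auto simp: V_def\<close>)
  then have "\<mu> -` V \<inter> space N \<in> sets N" using measurable_sets[OF \<mu>] sets_weak_borel by blast
  moreover have "\<mu> -` V \<inter> space N = (\<lambda>t. LINT x|\<mu> t. \<phi> x) -` U \<inter> space N"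
    using measurable_space[OF \<mu>] by (auto simp: V_def space_weak_borel)
  ultimately show "(\<lambda>t. LINT x|\<mu> t. \<phi> x) -` U \<inter> space N \<in> sets N" by simp
qed

lemma Loewner_field_cauchy_transform:
  assumes \<mu>: "\<mu> \<in> lebesgue_on {0..} \<rightarrow>\<^sub>M weak_borel"
  shows "Loewner_field (\<lambda>t. cauchy_transform (\<mu> t))"
proof
  have prob: "borel_prob (\<mu> t)" if "t \<ge> 0" for t
  proof -
    have "\<mu> t \<in> space (prob_algebra borel)"
      using measurable_space[OF \<mu>, of t] that by (simp add: space_weak_borel space_restrict_space)
    then show ?thesis
      by (auto simp: space_prob_algebra borel_prob_def borel_prob_axioms_def)
  qed
  show "(\<lambda>t. cauchy_transform (\<mu> t) z) \<in> borel_measurable (lebesgue_on {0..})" if z: "z \<in> UHP" for z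
  proof -
    \<comment> \<open>Real and imaginary part are treated separately because the weak topology is
      generated by real test functions.\<close>
    let ?k = "\<lambda>x. 1 / (z - complex_of_real x)"
    have "(\<lambda>t. LINT x|\<mu> t. Re (?k x)) \<in> borel_measurable (lebesgue_on {0..})"
    proof (rule measurable_weak_borel_integral[OF \<mu>])
      show "continuous_on UNIV (\<lambda>x. Re (?k x))" by (intro continuous_on_Re cauchy_kernel_continuous z)
      show "bounded (range (\<lambda>x. Re (?k x)))"
        unfolding bounded_iff
        using order_trans[OF abs_Re_le_cmod cauchy_kernel_bound[OF z]] by (intro exI[of _ "1 / Im z"]) auto
    qed
    then have Re: "(\<lambda>t. Re (cauchy_transform (\<mu> t) z)) \<in> borel_measurable (lebesgue_on {0..})"
      by (rule measurable_cong[THEN iffD1, rotated])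
        (use borel_prob.kernel_integrable[OF prob z] in \<open>auto simp: cauchy_transform_def space_restrict_space\<close>)
    have "(\<lambda>t. LINT x|\<mu> t. Im (?k x)) \<in> borel_measurable (lebesgue_on {0..})"
    proof (rule measurable_weak_borel_integral[OF \<mu>])
      show "continuous_on UNIV (\<lambda>x. Im (?k x))" by (intro continuous_on_Im cauchy_kernel_continuous z)
      show "bounded (range (\<lambda>x. Im (?k x)))"
        unfolding bounded_iff
        using order_trans[OF abs_Im_le_cmod cauchy_kernel_bound[OF z]] by (intro exI[of _ "1 / Im z"]) auto
    qed
    then have Im: "(\<lambda>t. Im (cauchy_transform (\<mu> t) z)) \<in> borel_measurable (lebesgue_on {0..})"
      by (rule measurable_cong[THEN iffD1, rotated])
        (use borel_prob.kernel_integrable[OF prob z] in \<open>auto simp: cauchy_transform_def space_restrict_space\<close>)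
    show ?thesis using Re Im by (simp add: borel_measurable_complex_iff)
  qed
  fix t :: real assume t: "t \<ge> 0"
  interpret borel_prob "\<mu> t" by (rule prob[OF t])
  show "cauchy_transform (\<mu> t) holomorphic_on UHP" by (rule cauchy_transform_holomorphic)
  show "Im (cauchy_transform (\<mu> t) z) \<le> 0" if "z \<in> UHP" for z using that by (rule cauchy_transform_Im)
  show "cmod (cauchy_transform (\<mu> t) z) \<le> 1 / Im z" if "z \<in> UHP" for z using that by (rule cauchy_transform_bound)
  show "cmod (cauchy_transform (\<mu> t) z - cauchy_transform (\<mu> t) w) \<le> cmod (z - w) / (Im z * Im w)"
    if "z \<in> UHP" "w \<in> UHP" for z w using that by (rule cauchy_transform_Lipschitz)
  show "(\<lambda>n. \<i> * of_real (y n) * cauchy_transform (\<mu> t) (w n)) \<longlonglongrightarrow> 1"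
    if "filterlim y at_top sequentially" "\<And>n. w n \<in> UHP" "\<And>n. cmod (w n - \<i> * of_real (y n)) \<le> B" for y w B
    using that by (rule cauchy_transform_asymptotic)
qed

text \<open>Connects the almost-everywhere quantifier of the theorem with the explicit negligible
  sets of the differentiation results.\<close>

lemma AE_lebesgue_on_atLeast_iff:
  "(AE t in lebesgue_on {0::real..}. P t) \<longleftrightarrow> (\<exists>N. negligible N \<and> (\<forall>t\<ge>0. t \<notin> N \<longrightarrow> P t))"
proof -
  have "(AE t in lebesgue_on {0::real..}. P t) \<longleftrightarrow> (AE t in lebesgue. t \<in> {0..} \<longrightarrow> P t)"
    by (rule AE_restrict_space_iff) simp
  also have "\<dots> \<longleftrightarrow> (\<exists>N. negligible N \<and> (\<forall>t\<ge>0. t \<notin> N \<longrightarrow> P t))"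
    unfolding eventually_ae_filter negligible_iff_null_sets by (auto simp: subset_iff)
  finally show ?thesis .
qed

theorem theorem5p6:
  fixes \<mu> :: "real \<Rightarrow> real measure"
  assumes "\<mu> \<in> lebesgue_on {0..} \<rightarrow>\<^sub>M weak_borel"
  shows "\<exists>!F. chordal_Loewner_family F \<and>
    (AE t in lebesgue_on {0..}. \<forall>z\<in>upper_half_plane.
       ((\<lambda>s. family_at F s z) has_vector_derivative
          - (LINT x|\<mu> t. 1 / (z - complex_of_real x)) * deriv (family_at F t) z)
         (at t within {0..}))"
proof -
  interpret Loewner_field "\<lambda>t. cauchy_transform (\<mu> t)" by (rule Loewner_field_cauchy_transform[OF assms])
  show ?thesis
    unfolding AE_lebesgue_on_atLeast_iff cauchy_transform_def[symmetric]
  proof (rule ex1I[of _ loewner_chain], intro conjI)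
    show "chordal_Loewner_family loewner_chain" by (rule loewner_chain)
    show "\<exists>N. negligible N \<and> (\<forall>t\<ge>0. t \<notin> N \<longrightarrow> (\<forall>z\<in>upper_half_plane. ((\<lambda>s. family_at loewner_chain s z) has_vector_derivative
          - cauchy_transform (\<mu> t) z * deriv (family_at loewner_chain t) z) (at t within {0..})))"
      using negligible_not_regular_time loewner_chain_derivative
      by (intro exI[of _ "{t \<in> {0..}. \<not> regular_time t}"]) auto
  qed (elim conjE exE, rule loewner_chain_unique, auto)
qed

end
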